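(* Let $\Delta$ be a finite simplicial complex with $\operatorname{depth}\Delta=d-1$, and let $r$ be an integer with $2\le r\le d/2$. Let $\mathcal{A},\mathcal{B}$ be nonempty cross-intersecting Sperner families consisting of faces of $\Delta$, each face having at most $r$ vertices. If $\Delta$ is shifted with respect to $\{v_1<\cdots<v_r\}$, then \[|\mathcal{A}|+|\mathcal{B}|\le f_r(\Delta)-\gamma+1,\] where $\gamma$ is the number of $r$-element faces of $\Delta$ containing no element of $\{v_1,\dots,v_r\}$.
   Context: A simplicial complex is a nonempty finite family of sets closed under subsets; $f_k(\Delta)$ is the number of $k$-element faces; $\operatorname{link}_\Delta A=\{B\in\Delta:A\cap B=\emptyset,A\cup B\in\Delta\}$. Fix a field $\mathbb{F}$. A complex $\Gamma$ is Cohen-Macaulay if $\tilde H_i(\operatorname{link}_\Gamma A;\mathbb{F})=0$ for all faces $A$ (including $\emptyset$) and all $i<\dim\operatorname{link}_\Gamma A$ (a face $A$ has dimension $|A|-1$). The depth of $\Delta$ is the largest $k$ such that the subcomplex of faces of dimension at most $k$ is Cohen-Macaulay. $\Delta$ is shifted with respect to $\{v_1<\cdots<v_t\}$ if for every $i\le t$, every face $B$, and every $w\in B$ with $w\notin\{v_1,\dots,v_i\}$ and $v_i\notin B$, the set $(B\setminus\{w\})\cup\{v_i\}$ is a face. A Sperner family is a family of sets with no member properly contained in another. $\mathcal{A},\mathcal{B}$ are cross-intersecting if $A\cap B\ne\emptyset$ for all $A\in\mathcal{A},B\in\mathcal{B}$. *)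

theory Defs
  imports Main
begin

definition simplicial_complex :: "'a set set \<Rightarrow> bool" where
  "simplicial_complex \<Delta> \<longleftrightarrow> \<Delta> \<noteq> {} \<and> finite \<Delta> \<and> (\<forall>A\<in>\<Delta>. \<forall>B. B \<subseteq> A \<longrightarrow> B \<in> \<Delta>)"

definition fvec :: "'a set set \<Rightarrow> nat \<Rightarrow> nat" where
  "fvec \<Delta> k = card {A \<in> \<Delta>. card A = k}"

definition link :: "'a set set \<Rightarrow> 'a set \<Rightarrow> 'a set set" where
  "link \<Delta> A = {B \<in> \<Delta>. A \<inter> B = {} \<and> A \<union> B \<in> \<Delta>}"

definition cdim :: "'a set set \<Rightarrow> int" where
  "cdim \<Delta> = int (Max (card ` \<Delta>)) - 1"

definition is_chain :: "'a set set \<Rightarrow> nat \<Rightarrow> ('a set \<Rightarrow> 'k::field) \<Rightarrow> bool" where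
  "is_chain \<Delta> n c \<longleftrightarrow> (\<forall>F. c F \<noteq> 0 \<longrightarrow> F \<in> \<Delta> \<and> card F = n)"

(* simplicial boundary map (oriented by the linear order on vertices):
   coefficient of the face G in the boundary of c *)
definition bdry :: "'a::linorder set set \<Rightarrow> ('a set \<Rightarrow> 'k::field) \<Rightarrow> 'a set \<Rightarrow> 'k" where
  "bdry \<Delta> c G = (\<Sum>v\<in>{v. v \<notin> G \<and> insert v G \<in> \<Delta>}.
      (- 1) ^ card {u \<in> G. u < v} * c (insert v G))"

(* reduced homology in degree i (faces of dimension i, i.e. i+1 elements)
   with coefficients in 'k vanishes: every cycle is a boundary *)
definition red_hom_vanishes :: "'k::field itself \<Rightarrow> 'a::linorder set set \<Rightarrow> int \<Rightarrow> bool" where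
  "red_hom_vanishes T \<Delta> i \<longleftrightarrow> i < -1 \<or>
     (\<forall>c :: 'a set \<Rightarrow> 'k.
        is_chain \<Delta> (nat (i + 1)) c \<and> (\<forall>G\<in>\<Delta>. card G + 1 = nat (i + 1) \<longrightarrow> bdry \<Delta> c G = 0)
        \<longrightarrow> (\<exists>e :: 'a set \<Rightarrow> 'k. is_chain \<Delta> (nat (i + 1) + 1) e \<and>
              (\<forall>G\<in>\<Delta>. card G = nat (i + 1) \<longrightarrow> bdry \<Delta> e G = c G)))"

definition cohen_macaulay :: "'k::field itself \<Rightarrow> 'a::linorder set set \<Rightarrow> bool" where
  "cohen_macaulay T \<Gamma> \<longleftrightarrow>
     (\<forall>A\<in>\<Gamma>. \<forall>i::int. i < cdim (link \<Gamma> A) \<longrightarrow> red_hom_vanishes T (link \<Gamma> A) i)"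

definition skeleton :: "'a set set \<Rightarrow> int \<Rightarrow> 'a set set" where
  "skeleton \<Delta> k = {A \<in> \<Delta>. int (card A) - 1 \<le> k}"

definition depth :: "'k::field itself \<Rightarrow> 'a::linorder set set \<Rightarrow> int" where
  "depth T \<Delta> = (GREATEST k. -1 \<le> k \<and> k \<le> cdim \<Delta> \<and> cohen_macaulay T (skeleton \<Delta> k))"

definition shifted_wrt :: "'a set set \<Rightarrow> (nat \<Rightarrow> 'a) \<Rightarrow> nat \<Rightarrow> bool" where
  "shifted_wrt \<Delta> v t \<longleftrightarrow> inj_on v {1..t} \<and>
     (\<forall>i\<in>{1..t}. \<forall>B\<in>\<Delta>. \<forall>w\<in>B. w \<notin> v ` {1..i} \<and> v i \<notin> B \<longrightarrow>
        insert (v i) (B - {w}) \<in> \<Delta>)"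

definition sperner :: "'a set set \<Rightarrow> bool" where
  "sperner \<F> \<longleftrightarrow> (\<forall>A\<in>\<F>. \<forall>B\<in>\<F>. A \<subseteq> B \<longrightarrow> A = B)"

definition cross_intersecting :: "'a set set \<Rightarrow> 'a set set \<Rightarrow> bool" where
  "cross_intersecting \<A> \<B> \<longleftrightarrow> (\<forall>A\<in>\<A>. \<forall>B\<in>\<B>. A \<inter> B \<noteq> {})"

end

theory Submission
  imports Defs "HOL-Library.Function_Algebras" "HOL-Library.Nat_Bijection" "HOL-Algebra.Algebraic_Closure_Type"
begin

text \<open>Pass to the \<open>(d - 1)\<close>-skeleton \<open>\<Gamma>\<close>, which is Cohen-Macaulay and hence pure; by upper shadows and
  double counting, \<open>\<A>\<close> and \<open>\<B>\<close> may be replaced by families of \<open>r\<close>-faces of \<open>\<Gamma>\<close>. Over the algebraic closure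
  of the field choose a generic frame \<open>f\<^sub>1, \<dots>, f\<^sub>N\<close> of functionals on the vertices. Contracting a chain
  successively by the \<open>f\<^sub>i\<close> with \<open>i \<in> T\<close> gives its coordinate at \<open>T\<close>, and the leading index sets of
  the chains supported on a family form a family of index sets of the same size. For a suitable
  frame the families obtained from \<open>\<A>\<close> and \<open>\<B>\<close> are shifted, and they still cross-intersect because
  a product of chains has the expected leading term.

  The Cohen-Macaulay property makes contraction by generic functionals exact below the top degree.
  Consequently the leading index sets of \<open>\<Gamma>\<close> remain leading when a prefix \<open>{1..t}\<close> is added, as long as
  the size does not exceed \<open>d\<close>, and so the family of leading \<open>r\<close>-sets is closed under complementing a
  set inside a prefix that it half fills. Complementing inside the longest such prefix is injective, maps
  the second family off the first, and together they miss all but one of the leading \<open>r\<close>-sets disjoint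
  from \<open>{1..r}\<close>. Shiftedness of \<open>\<Delta>\<close> provides at least \<open>\<gamma>\<close> sets of the latter kind.\<close>

section \<open>Linear systems over a field\<close>

text \<open>Exterior algebra moves the families to index sets, where exchanges can be enforced by
  the choice of frame. The price is that the ambient family of leading sets is controlled only
  through homology; it is not itself made shifted. The bound \<open>r \<le> d / 2\<close> is spent
  three times. Complementing \<open>T\<close> inside a half-filled prefix passes through
  \<open>T \<union> {1..t}\<close>, of size \<open>r + t / 2\<close>, which must not exceed
  \<open>d\<close>. Upper shadows below level \<open>r\<close> do not shrink, because a
  \<open>k\<close>-face with \<open>k < r\<close> has at least \<open>d - k \<ge> k + 1\<close>
  extensions. A face of size \<open>d\<close> has room for an \<open>r\<close>-set together with all
  of \<open>v 1, ..., v r\<close>. The algebraic closure also serves twice: it is infinite, so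
  finitely many bad parameters can be avoided, and operators over it have eigenvalues, which gives
  exactness for several contractions at once.\<close>

lemma homogeneous_system_nontrivial:
  fixes m :: "'p \<Rightarrow> 'b \<Rightarrow> 'k::field"
  assumes "finite A" "finite P" "card P < card A"
  obtains c where "\<And>F. F \<notin> A \<Longrightarrow> c F = 0" "\<exists>F\<in>A. c F \<noteq> 0"
    "\<And>p. p \<in> P \<Longrightarrow> (\<Sum>F\<in>A. m p F * c F) = 0"
proof -
  have "\<exists>c. (\<forall>F. F \<notin> A \<longrightarrow> c F = 0) \<and> (\<exists>F\<in>A. c F \<noteq> 0) \<and> (\<forall>p\<in>P. (\<Sum>F\<in>A. m p F * c F) = 0)"
    using assms(2,1,3)
  proof (induction P arbitrary: A m rule: finite_induct)
    case empty
    then obtain F0 where "F0 \<in> A" by fastforce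
    then show ?case by (intro exI[of _ "\<lambda>F. if F = F0 then 1 else 0"]) auto
  next
    case (insert p P)
    show ?case
    proof (cases "\<forall>F\<in>A. m p F = 0")
      case True
      have "card P < card A" using insert by simp
      from insert.IH[OF insert.prems(1) this, of m] obtain c where
        "\<forall>F. F \<notin> A \<longrightarrow> c F = 0" "\<exists>F\<in>A. c F \<noteq> 0" "\<forall>p\<in>P. (\<Sum>F\<in>A. m p F * c F) = 0"
        by blast
      with True show ?thesis by (intro exI[of _ c]) auto
    next
      case False
      then obtain F0 where F0: "F0 \<in> A" "m p F0 \<noteq> 0" by blast
      \<comment> \<open>The equation \<open>p\<close> is solved for the unknown \<open>F0\<close>;
        \<open>m'\<close> is the system after this elimination.\<close>
      define m' where "m' q F = m q F - m q F0 * m p F / m p F0" for q F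
      have "card P < card (A - {F0})" using insert F0 by simp
      from insert.IH[OF _ this, of m'] insert.prems(1) obtain c where
        c: "\<forall>F. F \<notin> A - {F0} \<longrightarrow> c F = 0" "\<exists>F\<in>A - {F0}. c F \<noteq> 0"
        "\<forall>p\<in>P. (\<Sum>F\<in>A - {F0}. m' p F * c F) = 0" by auto
      define x where "x = - (\<Sum>F\<in>A - {F0}. m p F * c F) / m p F0"
      define c' where "c' = c(F0 := x)"
      have split: "(\<Sum>F\<in>A. m q F * c' F) = m q F0 * x + (\<Sum>F\<in>A - {F0}. m q F * c F)" for q
      proof -
        have "(\<Sum>F\<in>A. m q F * c' F) = m q F0 * c' F0 + (\<Sum>F\<in>A - {F0}. m q F * c' F)"
          using insert.prems(1) F0 by (simp add: sum.remove)
        also have "(\<Sum>F\<in>A - {F0}. m q F * c' F) = (\<Sum>F\<in>A - {F0}. m q F * c F)"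
          by (rule sum.cong) (auto simp: c'_def)
        finally show ?thesis by (simp add: c'_def)
      qed
      have "(\<Sum>F\<in>A. m q F * c' F) = 0" if "q \<in> insert p P" for q
      proof (cases "q = p")
        case True
        then show ?thesis using F0 by (simp add: split x_def)
      next
        case False
        then have "(\<Sum>F\<in>A - {F0}. m' q F * c F) = 0" using c(3) that by blast
        moreover have "(\<Sum>F\<in>A - {F0}. m' q F * c F)
            = (\<Sum>F\<in>A - {F0}. m q F * c F) - m q F0 / m p F0 * (\<Sum>F\<in>A - {F0}. m p F * c F)"
          by (simp add: m'_def algebra_simps sum_subtractf sum_distrib_left)
        ultimately show ?thesis by (simp add: split x_def)
      qed
      moreover have "\<forall>F. F \<notin> A \<longrightarrow> c' F = 0" using c(1) F0 by (auto simp: c'_def)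
      moreover have "\<exists>F\<in>A. c' F \<noteq> 0" using c(2) by (auto simp: c'_def)
      ultimately show ?thesis by blast
    qed
  qed
  then show thesis using that by blast
qed

text \<open>Injectivity of a linear map is an open condition along a line of maps; the vectors witnessing
  failure for different parameters are independent, like eigenvectors.\<close>

lemma finite_singular_parameters:
  fixes m0 m1 :: "'p \<Rightarrow> 'b \<Rightarrow> 'k::field"
  assumes "finite I"
    and inj: "\<And>x. \<lbrakk>\<And>F. F \<notin> I \<Longrightarrow> x F = 0; \<And>p. p \<in> P \<Longrightarrow> (\<Sum>F\<in>I. m0 p F * x F) = 0\<rbrakk> \<Longrightarrow> \<forall>F\<in>I. x F = 0"
  shows "finite {l. \<exists>x. (\<exists>F\<in>I. x F \<noteq> 0) \<and> (\<forall>p\<in>P. (\<Sum>F\<in>I. (m0 p F + l * m1 p F) * x F) = 0)}"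
    (is "finite ?S")
proof (rule ccontr)
  assume "infinite ?S"
  \<comment> \<open>Zero is left out because the coefficients of a relation will be divided by the
    parameters.\<close>
  then have "infinite (?S - {0})" by simp
  then obtain S where S: "S \<subseteq> ?S - {0}" "finite S" "card S = card I + 1"
    using infinite_arbitrarily_large[of "?S - {0}" "card I + 1"] by blast
  have "\<forall>l\<in>S. \<exists>x. (\<exists>F\<in>I. x F \<noteq> 0) \<and> (\<forall>p\<in>P. (\<Sum>F\<in>I. (m0 p F + l * m1 p F) * x F) = 0)"
    using S by blast
  then obtain xv where xv: "\<And>l. l \<in> S \<Longrightarrow> \<exists>F\<in>I. xv l F \<noteq> 0"
    "\<And>l p. \<lbrakk>l \<in> S; p \<in> P\<rbrakk> \<Longrightarrow> (\<Sum>F\<in>I. (m0 p F + l * m1 p F) * xv l F) = 0"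
    by metis
  define rel where "rel c \<longleftrightarrow> (\<forall>F\<in>I. (\<Sum>l\<in>S. c l * xv l F) = 0)" for c :: "'k \<Rightarrow> 'k"
  define supp where "supp c = {l\<in>S. c l \<noteq> 0}" for c :: "'k \<Rightarrow> 'k"
  have fin_supp: "finite (supp c)" for c using S by (simp add: supp_def)
  obtain c0 where "rel c0" "supp c0 \<noteq> {}"
  proof -
    have "card I < card S" using S by simp
    from homogeneous_system_nontrivial[OF S(2) assms(1) this, of "\<lambda>F l. xv l F"]
    obtain c where "\<exists>F\<in>S. c F \<noteq> 0" "\<And>p. p \<in> I \<Longrightarrow> (\<Sum>F\<in>S. xv F p * c F) = 0" by metis
    then show thesis by (intro that[of c]) (auto simp: rel_def supp_def mult.commute)
  qed
  \<comment> \<open>A relation of minimal support among the witnesses; a shorter one will be derived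
    from it.\<close>
  then obtain c where c: "rel c" "supp c \<noteq> {}"
    and cmin: "\<And>c'. rel c' \<Longrightarrow> supp c' \<noteq> {} \<Longrightarrow> card (supp c) \<le> card (supp c')"
    using ex_has_least_nat[of "\<lambda>c. rel c \<and> supp c \<noteq> {}" c0 "\<lambda>c. card (supp c)"] by blast
  obtain \<mu> where mu: "\<mu> \<in> supp c" using c by blast
  \<comment> \<open>Since \<open>m0\<close> sends \<open>xv l\<close> to \<open>- l\<close> times
    its image under \<open>m1\<close>, dividing the coefficients by \<open>l\<close> turns the
    relation into a vector killed by \<open>m0\<close>. Hence \<open>y\<close> vanishes, which is a
    second relation.\<close>
  define y where "y F = (if F \<in> I then (\<Sum>l\<in>S. c l / l * xv l F) else 0)" for F
  have "\<forall>F\<in>I. y F = 0"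
  proof (rule inj)
    fix p assume p: "p \<in> P"
    have eq: "(\<Sum>F\<in>I. m0 p F * xv l F) = - l * (\<Sum>F\<in>I. m1 p F * xv l F)" if "l \<in> S" for l
      using xv(2)[OF that p]
      by (simp add: algebra_simps sum.distrib sum_distrib_left sum_negf add_eq_0_iff2)
    have "(\<Sum>F\<in>I. m0 p F * y F) = (\<Sum>F\<in>I. \<Sum>l\<in>S. c l / l * (m0 p F * xv l F))"
      by (intro sum.cong refl) (simp add: y_def sum_distrib_left algebra_simps)
    also have "\<dots> = (\<Sum>l\<in>S. c l / l * (\<Sum>F\<in>I. m0 p F * xv l F))"
      by (subst sum.swap) (simp add: sum_distrib_left)
    also have "\<dots> = (\<Sum>l\<in>S. - (c l * (\<Sum>F\<in>I. m1 p F * xv l F)))"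
    proof (rule sum.cong[OF refl])
      fix l assume "l \<in> S"
      then show "c l / l * (\<Sum>F\<in>I. m0 p F * xv l F) = - (c l * (\<Sum>F\<in>I. m1 p F * xv l F))"
        using S(1) by (subst eq) auto
    qed
    also have "\<dots> = - (\<Sum>F\<in>I. m1 p F * (\<Sum>l\<in>S. c l * xv l F))"
      by (simp add: sum_negf sum_distrib_left, subst sum.swap) (simp add: algebra_simps)
    also have "\<dots> = 0" using c(1) by (simp add: rel_def)
    finally show "(\<Sum>F\<in>I. m0 p F * y F) = 0" .
  qed (simp add: y_def)
  then have y0: "(\<Sum>l\<in>S. c l / l * xv l F) = 0" if "F \<in> I" for F using that by (auto simp: y_def)
  \<comment> \<open>The combination of the two relations that cancels at \<mu> has smaller support,
    so it is trivial; this leaves \<mu> as the only index in the support of \<open>c\<close>, and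
    \<open>xv \<mu>\<close> would be zero.\<close>
  define c' where "c' l = c l - \<mu> * (c l / l)" for l
  have "(\<Sum>l\<in>S. c' l * xv l F) = (\<Sum>l\<in>S. c l * xv l F) - \<mu> * (\<Sum>l\<in>S. c l / l * xv l F)" for F
    unfolding c'_def left_diff_distrib sum_subtractf sum_distrib_left mult.assoc ..
  then have "rel c'"
    using c(1) y0 by (simp add: rel_def)
  moreover have "supp c' \<subseteq> supp c - {\<mu>}"
  proof -
    have "\<mu> \<noteq> 0" using S(1) mu by (auto simp: supp_def)
    then show ?thesis by (auto simp: supp_def c'_def)
  qed
  then have "card (supp c') < card (supp c)"
    using mu fin_supp by (intro psubset_card_mono) auto
  ultimately have "supp c' = {}" using cmin by fastforce
  then have "c l = 0" if "l \<in> S" "l \<noteq> \<mu>" for l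
  proof -
    have "c l - \<mu> * (c l / l) = 0" using \<open>supp c' = {}\<close> that by (auto simp: supp_def c'_def)
    moreover have "l \<noteq> 0" using that S by auto
    ultimately have "c l * (l - \<mu>) = 0" by (simp add: field_simps)
    then show ?thesis using that by simp
  qed
  then have "(\<Sum>l\<in>S. c l * xv l F) = c \<mu> * xv \<mu> F" for F
    using mu S(2) by (subst sum.remove[of S \<mu>]) (auto simp: supp_def)
  then have "\<forall>F\<in>I. xv \<mu> F = 0" using c(1) mu by (auto simp: rel_def supp_def)
  then show False using xv(1)[of \<mu>] mu by (auto simp: supp_def)
qed

section \<open>Function spaces as vector spaces, and products of linear factors of an
  operator\<close>

definition sc :: "'k::field \<Rightarrow> ('b \<Rightarrow> 'k) \<Rightarrow> 'b \<Rightarrow> 'k" where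
  "sc a f = (\<lambda>x. a * f x)"

lemma sc_apply [simp]: "sc a f x = a * f x"
  by (simp add: sc_def)

interpretation fs: vector_space "sc :: 'k::field \<Rightarrow> ('b \<Rightarrow> 'k) \<Rightarrow> _"
  by unfold_locales (auto simp: fun_eq_iff algebra_simps)

interpretation fsp: vector_space_pair "sc :: 'k::field \<Rightarrow> ('b \<Rightarrow> 'k) \<Rightarrow> _" "sc :: 'k \<Rightarrow> ('b \<Rightarrow> 'k) \<Rightarrow> _"
  by unfold_locales

lemma fs_linearI:
  assumes "\<And>x y. T (x + y) = T x + T y" "\<And>a x. T (sc a x) = sc a (T x)"
  shows "Vector_Spaces.linear sc sc T"
  using assms by (auto simp: Vector_Spaces.linear_def module_hom_def module_hom_axioms_def
      fs.module_axioms fs.vector_space_axioms)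

lemma fs_linearD:
  assumes "Vector_Spaces.linear sc sc T"
  shows "T (x + y) = T x + T y" "T (sc a x) = sc a (T x)" "T 0 = 0" "T (x - y) = T x - T y"
proof -
  interpret T: Vector_Spaces.linear sc sc T by fact
  show "T (x + y) = T x + T y" "T (sc a x) = sc a (T x)" "T 0 = 0" "T (x - y) = T x - T y"
    by (simp_all add: T.add T.scale T.diff)
qed

lemma zero_fun_lambda [simp]: "(\<lambda>_. 0) = 0"
  by (simp add: fun_eq_iff)

lemma fun_sum_apply: "(\<Sum>i\<in>I. f i) x = (\<Sum>i\<in>I. f i x)"
  by (induction I rule: infinite_finite_induct) auto

fun linear_factors :: "(('b \<Rightarrow> 'k::field) \<Rightarrow> 'b \<Rightarrow> 'k) \<Rightarrow> 'k list \<Rightarrow> ('b \<Rightarrow> 'k) \<Rightarrow> 'b \<Rightarrow> 'k" where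
  "linear_factors T [] z = z"
| "linear_factors T (\<mu> # \<mu>s) z = linear_factors T \<mu>s (T z - sc \<mu> z)"

lemma linear_factors_append:
  "linear_factors T (xs @ ys) z = linear_factors T ys (linear_factors T xs z)"
  by (induction xs arbitrary: z) auto

lemma linear_factors_linear:
  assumes "Vector_Spaces.linear sc sc T"
  shows "Vector_Spaces.linear sc sc (linear_factors T \<mu>s)"
proof (induction \<mu>s)
  case Nil
  show ?case by (rule fs_linearI) auto
next
  case (Cons \<mu> \<mu>s)
  show ?case
  proof (rule fs_linearI)
    fix x y
    have "T (x + y) - sc \<mu> (x + y) = (T x - sc \<mu> x) + (T y - sc \<mu> y)"
      unfolding fs_linearD(1)[OF assms] by (auto simp: fun_eq_iff algebra_simps)
    then show "linear_factors T (\<mu> # \<mu>s) (x + y) = linear_factors T (\<mu> # \<mu>s) x + linear_factors T (\<mu> # \<mu>s) y"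
      by (simp only: linear_factors.simps fs_linearD(1)[OF Cons])
  next
    fix a x
    have "T (sc a x) - sc \<mu> (sc a x) = sc a (T x - sc \<mu> x)"
      unfolding fs_linearD(2)[OF assms] by (auto simp: fun_eq_iff algebra_simps)
    then show "linear_factors T (\<mu> # \<mu>s) (sc a x) = sc a (linear_factors T (\<mu> # \<mu>s) x)"
      by (simp only: linear_factors.simps fs_linearD(2)[OF Cons])
  qed
qed

text \<open>Writing the composite as a polynomial in \<open>T\<close> shows that the order of the
  factors does not matter.\<close>

lemma linear_factors_poly:
  fixes T :: "('b \<Rightarrow> 'k::field) \<Rightarrow> 'b \<Rightarrow> 'k"
  assumes T: "Vector_Spaces.linear sc sc T"
  shows "linear_factors T \<mu>s z
    = (\<Sum>i\<le>length \<mu>s. sc (coeff (\<Prod>\<mu>\<leftarrow>\<mu>s. [:-\<mu>, 1:]) i) ((T ^^ i) z))"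
proof (induction \<mu>s arbitrary: z)
  case Nil
  show ?case by (auto simp: fun_eq_iff)
next
  case (Cons \<mu> \<mu>s)
  define p where "p = (\<Prod>\<mu>\<leftarrow>\<mu>s. [:-\<mu>, 1:])"
  define n where "n = length \<mu>s"
  have deg: "degree p \<le> n" unfolding p_def n_def
  proof (induction \<mu>s)
    case (Cons \<nu> \<nu>s)
    have "degree ([:-\<nu>, 1:] * (\<Prod>\<mu>\<leftarrow>\<nu>s. [:-\<mu>, 1:]))
        \<le> degree [:-\<nu>, 1:] + degree (\<Prod>\<mu>\<leftarrow>\<nu>s. [:-\<mu>, 1:])"
      by (rule degree_mult_le)
    then show ?case using Cons by (simp only: list.map prod_list.Cons list.size) simp
  qed simp
  have pow: "(T ^^ i) (T z - sc \<mu> z) = (T ^^ Suc i) z - sc \<mu> ((T ^^ i) z)" for i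
  proof (induction i)
    case (Suc i)
    have "(T ^^ Suc i) (T z - sc \<mu> z) = T ((T ^^ Suc i) z - sc \<mu> ((T ^^ i) z))"
      by (simp only: Suc funpow.simps o_apply)
    also have "\<dots> = (T ^^ Suc (Suc i)) z - sc \<mu> ((T ^^ Suc i) z)"
      by (simp only: fs_linearD(2,4)[OF T] funpow.simps o_apply)
    finally show ?case .
  qed simp
  have coeff: "coeff ([:-\<mu>, 1:] * p) i = (case i of 0 \<Rightarrow> 0 | Suc j \<Rightarrow> coeff p j) - \<mu> * coeff p i" for i
    by (cases i) (auto simp: mult_pCons_left coeff_pCons)
  show ?case
  proof
    fix x
    define t where "t i = (T ^^ i) z x" for i
    have "linear_factors T (\<mu> # \<mu>s) z = (\<Sum>i\<le>n. sc (coeff p i) ((T ^^ Suc i) z - sc \<mu> ((T ^^ i) z)))"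
      by (simp only: linear_factors.simps Cons[of "T z - sc \<mu> z"] pow p_def n_def)
    then have "linear_factors T (\<mu> # \<mu>s) z x = (\<Sum>i\<le>n. coeff p i * (t (Suc i) - \<mu> * t i))"
      by (simp add: fun_sum_apply t_def)
    also have "\<dots> = (\<Sum>i\<le>n. coeff p i * t (Suc i)) - (\<Sum>i\<le>n. \<mu> * coeff p i * t i)"
      by (simp add: sum_subtractf algebra_simps)
    also have "(\<Sum>i\<le>n. coeff p i * t (Suc i)) = (\<Sum>i\<le>Suc n. (case i of 0 \<Rightarrow> 0 | Suc j \<Rightarrow> coeff p j) * t i)"
      by (subst sum.atMost_Suc_shift) simp
    also have "(\<Sum>i\<le>n. \<mu> * coeff p i * t i) = (\<Sum>i\<le>Suc n. \<mu> * coeff p i * t i)"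
      using deg by (simp add: coeff_eq_0)
    also have "(\<Sum>i\<le>Suc n. (case i of 0 \<Rightarrow> 0 | Suc j \<Rightarrow> coeff p j) * t i) - (\<Sum>i\<le>Suc n. \<mu> * coeff p i * t i)
        = (\<Sum>i\<le>Suc n. coeff ([:-\<mu>, 1:] * p) i * t i)"
      unfolding coeff by (simp add: sum_subtractf left_diff_distrib)
    finally show "linear_factors T (\<mu> # \<mu>s) z x
      = (\<Sum>i\<le>length (\<mu> # \<mu>s). sc (coeff (\<Prod>\<mu>\<leftarrow>\<mu> # \<mu>s. [:- \<mu>, 1:]) i) ((T ^^ i) z)) x"
      by (simp add: fun_sum_apply t_def p_def n_def)
  qed
qed

text \<open>The iterates of \<open>z\<close> up to exponent \<open>card \<Phi>\<close> are
  determined by their values on \<Phi>, and there is one more of them than values, so they are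
  dependent. The dependence is a polynomial in \<open>T\<close>, which splits over an algebraically
  closed field.\<close>

lemma annihilating_linear_factors:
  fixes T :: "('b \<Rightarrow> 'k::alg_closed_field) \<Rightarrow> 'b \<Rightarrow> 'k"
  assumes T: "Vector_Spaces.linear sc sc T" and fin: "finite \<Phi>"
    and supp: "\<And>z x. z \<in> Z \<Longrightarrow> x \<notin> \<Phi> \<Longrightarrow> z x = 0"
    and TZ: "\<And>z. z \<in> Z \<Longrightarrow> T z \<in> Z" and z: "z \<in> Z"
  obtains \<mu>s where "linear_factors T \<mu>s z = 0"
proof -
  have pow: "(T ^^ i) z \<in> Z" for i by (induction i) (use z TZ in auto)
  have "card \<Phi> < card {..card \<Phi>}" by simp
  then obtain c where c: "\<And>i. i \<notin> {..card \<Phi>} \<Longrightarrow> c i = 0" "\<exists>i\<in>{..card \<Phi>}. c i \<noteq> 0"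
    "\<And>x. x \<in> \<Phi> \<Longrightarrow> (\<Sum>i\<le>card \<Phi>. (T ^^ i) z x * c i) = 0"
    by (rule homogeneous_system_nontrivial[OF finite_atMost fin, where m = "\<lambda>x i. (T ^^ i) z x"]) blast
  define p where "p = (\<Sum>i\<le>card \<Phi>. monom (c i) i)"
  have cp: "coeff p i = c i" for i
    using c(1) by (auto simp: p_def coeff_sum coeff_monom if_distrib sum.delta cong: if_cong)
  have p0: "p \<noteq> 0" using c(2) cp by (metis coeff_0)
  obtain A where A: "size A = degree p" "p = smult (lead_coeff p) (\<Prod>x\<in>#A. [:-x, 1:])"
    using alg_closed_imp_factorization[OF p0] by blast
  obtain \<mu>s where ms: "mset \<mu>s = A" using ex_mset by blast
  have prod: "(\<Prod>x\<in>#A. [:-x, 1:]) = (\<Prod>x\<leftarrow>\<mu>s. [:-x, 1:])"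
    by (simp add: ms[symmetric] prod_mset_prod_list flip: mset_map)
  have len: "length \<mu>s = degree p" using A(1) ms by auto
  have degp: "degree p \<le> card \<Phi>" by (rule degree_le) (use c(1) cp in auto)
  have "linear_factors T \<mu>s z x = 0" for x
  proof (cases "x \<in> \<Phi>")
    case False
    have "(\<Sum>i\<in>I. sc (a i) ((T ^^ i) z)) x = 0" for I a
      using supp[OF pow False] by (simp add: fun_sum_apply)
    then show ?thesis unfolding linear_factors_poly[OF T] .
  next
    case True
    define q lc where "q = (\<Prod>x\<leftarrow>\<mu>s. [:-x, 1:])" and "lc = lead_coeff p"
    have cf: "coeff p i = lc * coeff q i" for i
      using A(2) prod unfolding q_def lc_def by (metis coeff_smult)
    have "linear_factors T \<mu>s z x = (\<Sum>i\<le>degree p. coeff q i * (T ^^ i) z x)"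
      by (simp add: linear_factors_poly[OF T] fun_sum_apply len q_def)
    then have "lc * linear_factors T \<mu>s z x = (\<Sum>i\<le>degree p. coeff p i * (T ^^ i) z x)"
      unfolding cf by (simp add: sum_distrib_left mult.assoc)
    also have "\<dots> = (\<Sum>i\<le>card \<Phi>. coeff p i * (T ^^ i) z x)"
      by (rule sum.mono_neutral_left) (use degp in \<open>auto simp: coeff_eq_0\<close>)
    also have "\<dots> = 0" using c(3)[OF True] by (simp add: cp mult.commute)
    finally show ?thesis using p0 by (simp add: lc_def)
  qed
  then show thesis by (intro that[of \<mu>s]) (auto simp: fun_eq_iff)
qed

lemma subspace_finite_spanning:
  fixes Z :: "('b \<Rightarrow> 'k::field) set"
  assumes fin: "finite \<Phi>" and supp: "\<And>z x. z \<in> Z \<Longrightarrow> x \<notin> \<Phi> \<Longrightarrow> z x = 0"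
  obtains S where "finite S" "S \<subseteq> Z" "Z \<subseteq> fs.span S"
proof -
  obtain S where S: "S \<subseteq> Z" "fs.independent S" "Z \<subseteq> fs.span S"
    using fs.maximal_independent_subset .
  define D :: "('b \<Rightarrow> 'k) set" where "D = (\<lambda>a x. if x = a then 1 else 0) ` \<Phi>"
  have "z \<in> fs.span D" if "z \<in> Z" for z
  proof -
    have "z = (\<Sum>a\<in>\<Phi>. sc (z a) (\<lambda>x. if x = a then 1 else 0))"
    proof
      fix x
      show "z x = (\<Sum>a\<in>\<Phi>. sc (z a) (\<lambda>x. if x = a then 1 else 0)) x"
        using supp[OF that, of x] fin by (cases "x \<in> \<Phi>") (auto simp: fun_sum_apply if_distrib cong: if_cong)
    qed
    moreover have "(\<Sum>a\<in>\<Phi>. sc (z a) (\<lambda>x. if x = a then 1 else 0)) \<in> fs.span D"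
      by (intro fs.span_sum fs.span_scale fs.span_base) (auto simp: D_def)
    ultimately show ?thesis by simp
  qed
  then have "S \<subseteq> fs.span D" using S by blast
  then have "finite S" using fs.independent_span_bound[of D S] S fin by (auto simp: D_def)
  then show thesis using that S by blast
qed

text \<open>Over an algebraically closed field an operator on a nonzero finite-dimensional quotient
  \<open>Z / B\<close> has an eigenvalue \<open>\<mu>\<close>, so \<open>T - \<mu>\<close> cannot always be onto.\<close>

lemma surjective_shifts_imp_trivial_quotient:
  fixes T :: "('b \<Rightarrow> 'k::alg_closed_field) \<Rightarrow> 'b \<Rightarrow> 'k"
  assumes T: "Vector_Spaces.linear sc sc T" and fin: "finite \<Phi>"
    and supp: "\<And>z x. z \<in> Z \<Longrightarrow> x \<notin> \<Phi> \<Longrightarrow> z x = 0"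
    and B: "fs.subspace B"
    and TZ: "\<And>z. z \<in> Z \<Longrightarrow> T z \<in> Z" and TB: "\<And>z. z \<in> B \<Longrightarrow> T z \<in> B"
    and surj: "\<And>\<mu> w. w \<in> Z \<Longrightarrow> \<exists>z\<in>Z. w - (T z - sc \<mu> z) \<in> B"
  shows "Z \<subseteq> B"
proof -
  obtain S where S: "finite S" "S \<subseteq> Z" "Z \<subseteq> fs.span S"
    using subspace_finite_spanning[of \<Phi> Z, OF fin] supp by blast
  \<comment> \<open>Concatenating the lists found for single generators gives one list that works
    for all, because the factors commute.\<close>
  have "\<exists>\<mu>s. \<forall>z\<in>S'. linear_factors T \<mu>s z = 0" if "finite S'" "S' \<subseteq> Z" for S'
    using that
  proof (induction S' rule: finite_induct)
    case (insert z S')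
    then obtain \<mu>s where ms: "\<forall>z\<in>S'. linear_factors T \<mu>s z = 0" by blast
    obtain \<nu>s where ns: "linear_factors T \<nu>s z = 0"
      using annihilating_linear_factors[of T \<Phi> Z z, OF T fin] supp TZ insert.prems by blast
    have "linear_factors T (\<mu>s @ \<nu>s) y = 0" if "y \<in> insert z S'" for y
    proof (cases "y = z")
      case True
      have "linear_factors T (\<mu>s @ \<nu>s) z = linear_factors T (\<nu>s @ \<mu>s) z"
        unfolding linear_factors_poly[OF T] by (simp add: mult.commute add.commute)
      also have "\<dots> = 0" by (simp add: linear_factors_append ns fs_linearD(3)[OF linear_factors_linear[OF T]])
      finally show ?thesis using True by simp
    next
      case False
      then have "linear_factors T \<mu>s y = 0" using ms that by blast
      then show ?thesis by (simp add: linear_factors_append fs_linearD(3)[OF linear_factors_linear[OF T]])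
    qed
    then show ?case by blast
  qed simp
  then obtain \<mu>s where ms: "\<forall>z\<in>S. linear_factors T \<mu>s z = 0" using S by blast
  interpret L: Vector_Spaces.linear sc sc "linear_factors T \<mu>s" by (rule linear_factors_linear[OF T])
  have "linear_factors T \<mu>s z = 0" if "z \<in> fs.span S" for z
    using L.eq_0_on_span ms that by blast
  then have "\<forall>z\<in>Z. linear_factors T \<mu>s z \<in> B" using S(3) fs.subspace_0[OF B] by auto
  \<comment> \<open>The factors are stripped one at a time: every \<open>w\<close> is
    \<open>T z - sc \<mu> z\<close> modulo \<open>B\<close>, so the remaining factors still send
    \<open>Z\<close> into \<open>B\<close>. The empty list gives the claim.\<close>
  then show ?thesis
  proof (induction \<mu>s)
    case (Cons \<mu> \<mu>s)
    have BB: "linear_factors T \<mu>s b \<in> B" if "b \<in> B" for b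
      using that
    proof (induction \<mu>s arbitrary: b)
      case (Cons \<nu> \<mu>s)
      have "T b - sc \<nu> b \<in> B"
        by (intro fs.subspace_diff[OF B] TB fs.subspace_scale[OF B] Cons.prems)
      then show ?case using Cons.IH by simp
    qed simp
    have "linear_factors T \<mu>s w \<in> B" if w: "w \<in> Z" for w
    proof -
      obtain z where z: "z \<in> Z" "w - (T z - sc \<mu> z) \<in> B" using surj[OF w] by blast
      have "linear_factors T \<mu>s w - linear_factors T (\<mu> # \<mu>s) z = linear_factors T \<mu>s (w - (T z - sc \<mu> z))"
        by (simp only: linear_factors.simps fs_linearD(4)[OF linear_factors_linear[OF T]])
      also have "\<dots> \<in> B" using BB z by blast
      finally have "linear_factors T \<mu>s w - linear_factors T (\<mu> # \<mu>s) z \<in> B" .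
      moreover have "linear_factors T (\<mu> # \<mu>s) z \<in> B" using Cons.prems z by blast
      ultimately have "(linear_factors T \<mu>s w - linear_factors T (\<mu> # \<mu>s) z) + linear_factors T (\<mu> # \<mu>s) z \<in> B"
        by (rule fs.subspace_add[OF B])
      then show ?thesis by simp
    qed
    then show ?case using Cons.IH by blast
  qed auto
qed

section \<open>Contraction operators on simplicial chains\<close>

definition vsign :: "'a::linorder \<Rightarrow> 'a set \<Rightarrow> 'k::field" where
  "vsign v G = (- 1) ^ card {u \<in> G. u < v}"

text \<open>The guard \<open>finite G\<close> is needed because the signs of infinite sets are meaningless.\<close>

definition vcontr :: "'a::linorder \<Rightarrow> ('a set \<Rightarrow> 'k::field) \<Rightarrow> 'a set \<Rightarrow> 'k" where
  "vcontr v c G = (if v \<notin> G \<and> finite G then vsign v G * c (insert v G) else 0)"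

text \<open>The interior product of a chain with the functional \<open>f\<close>; the constant
  functional 1 gives the simplicial boundary map.\<close>

definition contr :: "'a::linorder set \<Rightarrow> ('a \<Rightarrow> 'k::field) \<Rightarrow> ('a set \<Rightarrow> 'k) \<Rightarrow> 'a set \<Rightarrow> 'k" where
  "contr V f c G = (\<Sum>v\<in>V. f v * vcontr v c G)"

lemma vsign_square [simp]: "vsign v G * (vsign v G * x) = (x::'k::field)"
  by (simp add: vsign_def flip: mult.assoc power_add)

lemma vsign_nonzero [simp]: "vsign v G \<noteq> 0"
  by (simp add: vsign_def)

lemma vsign_insert:
  assumes "finite G" "u \<notin> G"
  shows "vsign v (insert u G) = (if u < v then - vsign v G else (vsign v G :: 'k::field))"
proof -
  have "{w \<in> insert u G. w < v} = (if u < v then insert u {w \<in> G. w < v} else {w \<in> G. w < v})" by auto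
  then show ?thesis using assms by (simp add: vsign_def)
qed

lemma vcontr_swap: "vcontr u (vcontr v c) G = - vcontr v (vcontr u c) G"
  by (cases u v rule: linorder_cases) (auto simp: vcontr_def vsign_insert insert_commute)

lemma vcontr_same [simp]: "vcontr v (vcontr v c) G = 0"
  by (simp add: vcontr_def)

lemma vcontr_linear:
  "vcontr v (c + c') = vcontr v c + vcontr v c'" "vcontr v (sc a c) = sc a (vcontr v c)"
  by (auto simp: vcontr_def fun_eq_iff algebra_simps)

lemma contr_linear: "Vector_Spaces.linear sc sc (contr V f)"
  by (rule fs_linearI)
    (auto simp: contr_def vcontr_linear fun_eq_iff algebra_simps sum.distrib sum_distrib_left)

lemmas contr_add = fs_linearD(1)[OF contr_linear]
  and contr_sc = fs_linearD(2)[OF contr_linear]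
  and contr_zero [simp] = fs_linearD(3)[OF contr_linear]
  and contr_diff = fs_linearD(4)[OF contr_linear]

lemma contr_functional_add: "contr V (\<lambda>v. f v + a * g v) c = contr V f c + sc a (contr V g c)"
  by (auto simp: contr_def fun_eq_iff algebra_simps sum.distrib sum_distrib_left)

lemma vcontr_sum: "vcontr v (\<lambda>G. \<Sum>i\<in>I. a i * c i G) G = (\<Sum>i\<in>I. a i * vcontr v (c i) G)"
  by (auto simp: vcontr_def sum_distrib_left algebra_simps)

lemma contr_contr: "contr V f (contr V g c) G = (\<Sum>u\<in>V. \<Sum>v\<in>V. f u * g v * vcontr u (vcontr v c) G)"
proof -
  have "vcontr u (contr V g c) G = (\<Sum>v\<in>V. g v * vcontr u (vcontr v c) G)" for u
    using vcontr_sum[of u g "\<lambda>v. vcontr v c" V G] by (simp add: contr_def[abs_def])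
  then show ?thesis by (simp add: contr_def[of V f] sum_distrib_left mult.assoc)
qed

lemma contr_swap: "contr V f (contr V g c) = - contr V g (contr V f c)"
proof
  fix G
  have "contr V f (contr V g c) G = (\<Sum>u\<in>V. \<Sum>v\<in>V. - (g v * f u * vcontr v (vcontr u c) G))"
    unfolding contr_contr by (subst vcontr_swap) (simp add: algebra_simps)
  also have "\<dots> = - contr V g (contr V f c) G"
    unfolding contr_contr by (subst sum.swap) (simp add: sum_negf)
  finally show "contr V f (contr V g c) G = (- contr V g (contr V f c)) G" by simp
qed

text \<open>Antisymmetry alone would only give that twice the sum is zero; the condition on the
  diagonal and the splitting by the order make the conclusion valid in characteristic two.\<close>

lemma antisymmetric_sum_zero:
  fixes h :: "'a::linorder \<Rightarrow> 'a \<Rightarrow> 'k::ab_group_add"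
  assumes "\<And>u v. u \<in> V \<Longrightarrow> v \<in> V \<Longrightarrow> h u v = - h v u" "\<And>v. v \<in> V \<Longrightarrow> h v v = 0"
  shows "(\<Sum>u\<in>V. \<Sum>v\<in>V. h u v) = 0"
proof (cases "finite V")
  case True
  have "(\<Sum>u\<in>V. \<Sum>v\<in>V. h u v) = (\<Sum>u\<in>V. \<Sum>v\<in>V. (if u < v then h u v else 0) + (if v < u then h u v else 0))"
    by (intro sum.cong refl) (auto simp: assms(2))
  also have "\<dots> = (\<Sum>u\<in>V. \<Sum>v\<in>V. if u < v then h u v else 0) + (\<Sum>u\<in>V. \<Sum>v\<in>V. if v < u then h u v else 0)"
    by (simp add: sum.distrib)
  also have "(\<Sum>u\<in>V. \<Sum>v\<in>V. if v < u then h u v else 0) = (\<Sum>v\<in>V. \<Sum>u\<in>V. - (if v < u then h v u else 0))"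
  proof (subst sum.swap, intro sum.cong refl)
    fix u v assume "u \<in> V" "v \<in> V"
    then have "h u v = - h v u" by (rule assms(1))
    then show "(if v < u then h u v else 0) = - (if v < u then h v u else 0)" by (simp only: if_False if_True split: if_splits) simp
  qed
  finally show ?thesis by (simp add: sum_negf)
qed simp

lemma contr_same [simp]: "contr V f (contr V f c) = 0"
proof
  fix G
  have "(\<Sum>u\<in>V. \<Sum>v\<in>V. f u * f v * vcontr u (vcontr v c) G) = 0"
  proof (rule antisymmetric_sum_zero)
    fix u v show "f u * f v * vcontr u (vcontr v c) G = - (f v * f u * vcontr v (vcontr u c) G)"
      by (subst vcontr_swap) simp
  qed simp
  then show "contr V f (contr V f c) G = 0 G" by (simp add: contr_contr)
qed

definition chain_space :: "'a set set \<Rightarrow> nat \<Rightarrow> ('a set \<Rightarrow> 'k::field) set" where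
  "chain_space \<Gamma> n = {c. is_chain \<Gamma> n c}"

lemma in_chains_iff: "c \<in> chain_space \<Gamma> n \<longleftrightarrow> (\<forall>F. c F \<noteq> 0 \<longrightarrow> F \<in> \<Gamma> \<and> card F = n)"
  by (simp add: chain_space_def is_chain_def)

lemma chains_outside: "c \<in> chain_space \<Gamma> n \<Longrightarrow> F \<notin> \<Gamma> \<Longrightarrow> c F = 0"
  by (auto simp: in_chains_iff)

lemma chains_subspace: "fs.subspace (chain_space \<Gamma> n)"
  by (auto simp: fs.subspace_def in_chains_iff) (metis add.right_neutral)+

lemmas chains_add = fs.subspace_add[OF chains_subspace]
  and chains_sc = fs.subspace_scale[OF chains_subspace]
  and chains_diff = fs.subspace_diff[OF chains_subspace]
  and chains_zero [simp] = fs.subspace_0[OF chains_subspace]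

lemma chains_mono: "c \<in> chain_space \<Gamma> n \<Longrightarrow> \<Gamma> \<subseteq> \<Gamma>' \<Longrightarrow> c \<in> chain_space \<Gamma>' n"
  by (auto simp: in_chains_iff)

lemma simplicial_complex_subset: "simplicial_complex \<Gamma> \<Longrightarrow> F \<in> \<Gamma> \<Longrightarrow> G \<subseteq> F \<Longrightarrow> G \<in> \<Gamma>"
  by (auto simp: simplicial_complex_def)

lemma simplicial_complex_empty: "simplicial_complex \<Gamma> \<Longrightarrow> {} \<in> \<Gamma>"
  by (auto simp: simplicial_complex_def)

lemma simplicial_complex_finite: "simplicial_complex \<Gamma> \<Longrightarrow> finite \<Gamma>"
  by (auto simp: simplicial_complex_def)

lemma simplicial_complex_finite_face:
  assumes "simplicial_complex \<Gamma>" "F \<in> \<Gamma>"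
  shows "finite F"
proof -
  have "Pow F \<subseteq> \<Gamma>" using assms by (auto simp: simplicial_complex_def)
  then show ?thesis using assms by (meson finite_Pow_iff finite_subset simplicial_complex_finite)
qed

lemma vcontr_chains:
  assumes "simplicial_complex \<Gamma>" "c \<in> chain_space \<Gamma> (Suc n)"
  shows "vcontr v c \<in> chain_space \<Gamma> n"
  unfolding in_chains_iff
proof (intro allI impI)
  fix F assume "vcontr v c F \<noteq> 0"
  then have F: "v \<notin> F" "finite F" "insert v F \<in> \<Gamma>" "card (insert v F) = Suc n" using assms(2)
    by (auto simp: vcontr_def in_chains_iff split: if_splits)
  then show "F \<in> \<Gamma> \<and> card F = n"
    using simplicial_complex_subset[OF assms(1) F(3) subset_insertI] by simp
qed

lemma contr_chains:
  assumes "simplicial_complex \<Gamma>" "c \<in> chain_space \<Gamma> (Suc n)"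
  shows "contr V f c \<in> chain_space \<Gamma> n"
proof -
  have "contr V f c = (\<Sum>v\<in>V. sc (f v) (vcontr v c))" by (auto simp: contr_def fun_eq_iff fun_sum_apply)
  also have "\<dots> \<in> chain_space \<Gamma> n"
    by (intro fs.subspace_sum[OF chains_subspace] chains_sc vcontr_chains assms)
  finally show ?thesis .
qed

lemma contr_chains_0: "c \<in> chain_space \<Gamma> 0 \<Longrightarrow> contr V f c = 0"
  by (auto simp: contr_def fun_eq_iff in_chains_iff vcontr_def intro!: sum.neutral)
     (metis card_0_eq finite_insert insert_not_empty)

section \<open>Links, deletions and cones\<close>

lemma link_simplicial_complex:
  assumes "simplicial_complex \<Gamma>" "A \<in> \<Gamma>"
  shows "simplicial_complex (link \<Gamma> A)"
proof -
  have "{} \<in> link \<Gamma> A" using assms simplicial_complex_empty by (auto simp: link_def)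
  moreover have "finite (link \<Gamma> A)"
    using simplicial_complex_finite[OF assms(1)] by (auto simp: link_def)
  moreover have "G \<in> link \<Gamma> A" if "F \<in> link \<Gamma> A" "G \<subseteq> F" for F G
    using that simplicial_complex_subset[OF assms(1), of "A \<union> F" "A \<union> G"]
      simplicial_complex_subset[OF assms(1), of F G]
    by (auto simp: link_def)
  ultimately show ?thesis unfolding simplicial_complex_def by blast
qed

lemma link_empty [simp]: "link \<Gamma> {} = \<Gamma>"
  by (auto simp: link_def)

lemma link_link:
  assumes "simplicial_complex \<Gamma>" "A \<inter> B = {}"
  shows "link (link \<Gamma> A) B = link \<Gamma> (A \<union> B)"
proof -
  have "A \<union> C \<in> \<Gamma>" if "A \<union> B \<union> C \<in> \<Gamma>" for C
    using simplicial_complex_subset[OF assms(1) that, of "A \<union> C"] by blast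
  moreover have "B \<union> C \<in> \<Gamma>" if "A \<union> B \<union> C \<in> \<Gamma>" for C
    using simplicial_complex_subset[OF assms(1) that, of "B \<union> C"] by blast
  moreover have "A \<union> (B \<union> C) = A \<union> B \<union> C" for C by blast
  ultimately show ?thesis using assms(2) unfolding link_def by auto
qed

definition deletion :: "'a set set \<Rightarrow> 'a \<Rightarrow> 'a set set" where
  "deletion \<Gamma> v = {F \<in> \<Gamma>. v \<notin> F}"

lemma deletion_simplicial_complex:
  "simplicial_complex \<Gamma> \<Longrightarrow> simplicial_complex (deletion \<Gamma> v)"
  using simplicial_complex_empty[of \<Gamma>] unfolding simplicial_complex_def deletion_def by auto

text \<open>The sign is chosen so that \<open>vcontr v\<close> undoes \<open>cone v\<close> on
  chains of finite faces avoiding \<open>v\<close>.\<close>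

definition cone :: "'a::linorder \<Rightarrow> ('a set \<Rightarrow> 'k::field) \<Rightarrow> 'a set \<Rightarrow> 'k" where
  "cone v c F = (if v \<in> F then vsign v (F - {v}) * c (F - {v}) else 0)"

lemma cone_chains:
  assumes "simplicial_complex \<Gamma>" "c \<in> chain_space (link \<Gamma> {v}) n"
  shows "cone v c \<in> chain_space \<Gamma> (Suc n)"
  unfolding in_chains_iff
proof (intro allI impI)
  fix F assume "cone v c F \<noteq> 0"
  then have F: "v \<in> F" "F - {v} \<in> link \<Gamma> {v}" "card (F - {v}) = n"
    using assms(2) by (auto simp: cone_def in_chains_iff split: if_splits)
  then have "insert v (F - {v}) \<in> \<Gamma>" by (auto simp: link_def)
  then have "F \<in> \<Gamma>" using F(1) by (simp add: insert_absorb)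
  moreover have "card F = Suc n"
    using F simplicial_complex_finite_face[OF assms(1) \<open>F \<in> \<Gamma>\<close>] by (metis card.remove)
  ultimately show "F \<in> \<Gamma> \<and> card F = Suc n" by simp
qed

definition avoiding :: "'a \<Rightarrow> ('a set \<Rightarrow> 'k::field) \<Rightarrow> 'a set \<Rightarrow> 'k" where
  "avoiding v c F = (if v \<in> F then 0 else c F)"

lemma chain_decompose:
  assumes "simplicial_complex \<Gamma>" "c \<in> chain_space \<Gamma> n"
  shows "c = avoiding v c + cone v (vcontr v c)"
proof
  fix F
  show "c F = (avoiding v c + cone v (vcontr v c)) F"
  proof (cases "c F = 0")
    case False
    then have "finite F" using assms simplicial_complex_finite_face by (auto simp: in_chains_iff)
    then show ?thesis by (auto simp: avoiding_def cone_def vcontr_def insert_absorb)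
  next
    case True
    then show ?thesis by (auto simp: avoiding_def cone_def vcontr_def insert_absorb)
  qed
qed

lemma avoiding_chains:
  "c \<in> chain_space \<Gamma> n \<Longrightarrow> avoiding v c \<in> chain_space (deletion \<Gamma> v) n"
  by (auto simp: in_chains_iff avoiding_def deletion_def)

lemma vcontr_chains_link:
  assumes "simplicial_complex \<Gamma>" "c \<in> chain_space \<Gamma> (Suc n)"
  shows "vcontr v c \<in> chain_space (link \<Gamma> {v}) n"
  unfolding in_chains_iff
proof (intro allI impI)
  fix F assume F: "vcontr v c F \<noteq> 0"
  then have "insert v F \<in> \<Gamma>" "v \<notin> F" using assms(2)
    by (auto simp: vcontr_def in_chains_iff split: if_splits)
  moreover have "F \<in> \<Gamma> \<and> card F = n"
    using vcontr_chains[OF assms, of v] F by (auto simp: in_chains_iff)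
  ultimately show "F \<in> link \<Gamma> {v} \<and> card F = n" by (auto simp: link_def)
qed

text \<open>A contraction of a cone either removes the apex, which leaves \<open>f v\<close> times
  the base, or removes a vertex of the base, and then passing the apex costs a sign.\<close>

lemma contr_cone:
  assumes "finite V" "v \<in> V" "simplicial_complex \<Gamma>" "c \<in> chain_space (link \<Gamma> {v}) n"
  shows "contr V f (cone v c) = sc (f v) c - cone v (contr V f c)"
proof
  fix G
  have c0: "c H = 0" if "v \<in> H \<or> infinite H" for H
    using that assms(3,4) simplicial_complex_finite_face[OF assms(3), of H]
    by (auto simp: in_chains_iff link_def)
  show "contr V f (cone v c) G = (sc (f v) c - cone v (contr V f c)) G"
  proof (cases "v \<in> G \<and> finite G")
    case False
    have "vcontr u (cone v c) G = (if u = v then c G else 0)" for u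
      using False c0[of G] c0[of "insert u G - {v}"]
      by (auto simp: vcontr_def cone_def vsign_insert)
    moreover have "cone v (contr V f c) G = 0"
      using False by (auto simp: cone_def contr_def vcontr_def)
    ultimately have "contr V f (cone v c) G = (\<Sum>u\<in>V. if u = v then f v * c G else 0)"
      unfolding contr_def by (intro sum.cong refl) simp
    then show ?thesis using assms(1,2) \<open>cone v (contr V f c) G = 0\<close> by simp
  next
    case True
    then have G: "v \<in> G" "finite G" by auto
    define H where "H = G - {v}"
    have H: "G = insert v H" "v \<notin> H" "finite H" using G by (auto simp: H_def)
    have "vcontr u (cone v c) G = - (vsign v H * vcontr u c H)" for u
    proof (cases "u \<in> G")
      case True
      then show ?thesis using c0[of "insert u H"] H by (auto simp: vcontr_def)
    next
      case False
      then have "insert u G - {v} = insert u H" using H by auto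
      then show ?thesis using False H
        by (cases u v rule: linorder_cases) (auto simp: vcontr_def cone_def vsign_insert)
    qed
    then have "contr V f (cone v c) G = - (vsign v H * contr V f c H)"
      by (simp add: contr_def sum_distrib_left sum_negf algebra_simps)
    moreover have "cone v (contr V f c) G = vsign v H * contr V f c H"
      using H by (simp add: cone_def)
    ultimately show ?thesis using c0[of G] G by simp
  qed
qed

section \<open>Exactness of generic contractions\<close>

text \<open>The degree \<open>k\<close> counts vertices: for a complex with vertices in
  \<open>V\<close> and the functional 1, this is the vanishing of reduced homology in dimension
  \<open>k - 1\<close>.\<close>

definition exact_at :: "'a::linorder set \<Rightarrow> ('a \<Rightarrow> 'k::field) \<Rightarrow> 'a set set \<Rightarrow> nat \<Rightarrow> bool" where
  "exact_at V f \<Gamma> k \<longleftrightarrow>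
    (\<forall>z\<in>chain_space \<Gamma> k. contr V f z = 0 \<longrightarrow> (\<exists>c\<in>chain_space \<Gamma> (Suc k). contr V f c = z))"

lemma exact_atD:
  assumes "exact_at V f \<Gamma> k" "z \<in> chain_space \<Gamma> k" "contr V f z = 0"
  obtains c where "c \<in> chain_space \<Gamma> (Suc k)" "contr V f c = z"
  using assms unfolding exact_at_def by blast

text \<open>This is the part of the Cohen-Macaulay property that vertex links and deletions inherit, with
  \<open>d - 1\<close> in place of \<open>d\<close>.\<close>

definition deep :: "'k::field itself \<Rightarrow> 'a::linorder set \<Rightarrow> nat \<Rightarrow> 'a set set \<Rightarrow> bool" where
  "deep T V d \<Gamma> \<longleftrightarrow> simplicial_complex \<Gamma> \<and> \<Union>\<Gamma> \<subseteq> V \<and>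
    (\<forall>\<tau>\<in>\<Gamma>. \<forall>k. k + card \<tau> < d \<longrightarrow> exact_at V (\<lambda>_. 1 :: 'k) (link \<Gamma> \<tau>) k)"

lemma deepD:
  assumes "deep TYPE('k::field) V d \<Gamma>"
  shows "simplicial_complex \<Gamma>" "\<Union>\<Gamma> \<subseteq> V"
    "\<And>\<tau> k. \<tau> \<in> \<Gamma> \<Longrightarrow> k + card \<tau> < d \<Longrightarrow> exact_at V (\<lambda>_. 1 :: 'k) (link \<Gamma> \<tau>) k"
  using assms by (auto simp: deep_def)

lemma deep_mono: "deep T V d \<Gamma> \<Longrightarrow> d' \<le> d \<Longrightarrow> deep T V d' \<Gamma>"
  by (auto simp: deep_def)

lemma contr_avoiding:
  assumes "\<And>G. v \<in> G \<Longrightarrow> c G = 0" "v \<in> G"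
  shows "contr V f c G = 0"
  using assms by (auto simp: contr_def vcontr_def intro!: sum.neutral)

lemma avoiding_add_cone_zero:
  assumes "x + cone v y = 0" "\<And>G. v \<in> G \<Longrightarrow> x G = 0" "\<And>G. v \<in> G \<Longrightarrow> y G = 0"
  shows "x = 0" "y = 0"
proof -
  have eq: "x G + cone v y G = 0" for G using assms(1) by (metis plus_fun_apply zero_fun_apply)
  show "x = 0"
  proof
    fix G show "x G = 0 G" using eq[of G] assms(2)[of G] by (cases "v \<in> G") (auto simp: cone_def)
  qed
  show "y = 0"
  proof
    fix G show "y G = 0 G"
      using eq[of "insert v G"] assms(2)[of "insert v G"] assms(3)[of G]
      by (cases "v \<in> G") (auto simp: cone_def)
  qed
qed

lemma deep_link:
  assumes "deep TYPE('k::field) V d \<Gamma>" "{v} \<in> \<Gamma>"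
  shows "deep TYPE('k) V (d - 1) (link \<Gamma> {v})"
  unfolding deep_def
proof (intro conjI ballI allI impI)
  have sc: "simplicial_complex \<Gamma>" using assms by (simp add: deep_def)
  show "simplicial_complex (link \<Gamma> {v})" using link_simplicial_complex[OF sc assms(2)] .
  show "\<Union> (link \<Gamma> {v}) \<subseteq> V" using assms by (auto simp: deep_def link_def)
  fix \<tau> k assume \<tau>: "\<tau> \<in> link \<Gamma> {v}" and k: "k + card \<tau> < d - 1"
  have "card ({v} \<union> \<tau>) = Suc (card \<tau>)"
    using \<tau> simplicial_complex_finite_face[OF sc, of \<tau>] by (auto simp: link_def)
  then have "exact_at V (\<lambda>_. 1 :: 'k) (link \<Gamma> ({v} \<union> \<tau>)) k"
    using assms(1) \<tau> k unfolding deep_def by (auto simp: link_def)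
  then show "exact_at V (\<lambda>_. 1 :: 'k) (link (link \<Gamma> {v}) \<tau>) k"
    using \<tau> by (subst link_link[OF sc]) (auto simp: link_def)
qed

lemma link_deletion:
  "v \<notin> \<tau> \<Longrightarrow> link (deletion \<Gamma> v) \<tau> = deletion (link \<Gamma> \<tau>) v"
  by (auto simp: link_def deletion_def)

lemma link_vertex_subset_deletion: "link \<Gamma> {v} \<subseteq> deletion \<Gamma> v"
  by (auto simp: link_def deletion_def)

text \<open>A cycle avoiding \<open>v\<close> bounds some \<open>c0 + cone v c1\<close>. Then
  \<open>c1\<close> is a cycle of the link; if \<open>b\<close> fills it there, the cone and
  \<open>b\<close> have the same boundary, and replacing one by the other gives a filling that
  avoids \<open>v\<close>.\<close>

lemma exact_at_deletion:
  assumes fin: "finite V" "v \<in> V" and sc: "simplicial_complex \<Gamma>"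
    and ex: "exact_at V (\<lambda>_. 1 :: 'k::field) \<Gamma> k"
    and exl: "{v} \<in> \<Gamma> \<Longrightarrow> exact_at V (\<lambda>_. 1 :: 'k) (link \<Gamma> {v}) k"
  shows "exact_at V (\<lambda>_. 1 :: 'k) (deletion \<Gamma> v) k"
  unfolding exact_at_def
proof (intro ballI impI)
  fix z :: "'a set \<Rightarrow> 'k"
  define bd where "bd = contr V (\<lambda>_. 1 :: 'k)"
  assume z0: "z \<in> chain_space (deletion \<Gamma> v) k" "contr V (\<lambda>_. 1) z = 0"
  then have z: "z \<in> chain_space (deletion \<Gamma> v) k" "bd z = 0" by (simp_all only: bd_def)
  then have "z \<in> chain_space \<Gamma> k" by (auto intro: chains_mono simp: deletion_def)
  then obtain c where c: "c \<in> chain_space \<Gamma> (Suc k)" "bd c = z"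
    using exact_atD[OF ex _ z0(2)] unfolding bd_def by blast
  define c0 c1 where "c0 = avoiding v c" and "c1 = vcontr v c"
  have dec: "c = c0 + cone v c1" unfolding c0_def c1_def by (rule chain_decompose[OF sc c(1)])
  have c1: "c1 \<in> chain_space (link \<Gamma> {v}) k" unfolding c1_def by (rule vcontr_chains_link[OF sc c(1)])
  have z_eq: "z = bd c0 + (c1 - cone v (bd c1))"
    using c(2) contr_cone[OF fin sc c1, of "\<lambda>_. 1"] unfolding dec bd_def contr_add by (auto simp: fun_eq_iff)
  have av: "c1 G = 0" "c0 G = 0" "z G = 0" if "v \<in> G" for G
    using that c1 z(1) by (auto simp: in_chains_iff link_def c0_def avoiding_def deletion_def)
  have "(bd c0 + c1 - z) + cone v (- bd c1) = 0"
  proof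
    fix G show "((bd c0 + c1 - z) + cone v (- bd c1)) G = 0 G"
      using fun_cong[OF z_eq, of G] by (cases "v \<in> G") (simp_all add: cone_def)
  qed
  then have "- bd c1 = 0"
    by (rule avoiding_add_cone_zero) (simp_all add: av bd_def contr_avoiding[of v c0] contr_avoiding[of v c1])
  then have cyc: "bd c1 = 0" by simp
  obtain b where b: "b \<in> chain_space (link \<Gamma> {v}) (Suc k)" "bd b = c1"
  proof (cases "{v} \<in> \<Gamma>")
    case True
    then show ?thesis using exact_atD[OF exl c1] cyc that unfolding bd_def by blast
  next
    case False
    then have "link \<Gamma> {v} = {}"
      using simplicial_complex_subset[OF sc, of _ "{v}"] by (auto simp: link_def)
    then have "c1 = 0" using c1 by (auto simp: in_chains_iff fun_eq_iff)
    then show ?thesis using that[of 0] by (simp add: bd_def)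
  qed
  have "bd (c0 + b) = z" using z_eq cyc b by (simp add: bd_def contr_add cone_def fun_eq_iff)
  moreover have "c0 + b \<in> chain_space (deletion \<Gamma> v) (Suc k)"
    using avoiding_chains[OF c(1), of v] chains_mono[OF b(1) link_vertex_subset_deletion]
    unfolding c0_def by (rule chains_add)
  ultimately show "\<exists>c\<in>chain_space (deletion \<Gamma> v) (Suc k). contr V (\<lambda>_. 1) c = z"
    unfolding bd_def by blast
qed

text \<open>Filling inside the link of \<tau> and \<open>v\<close> together uses a face one larger
  than \<tau>, which is why one unit of depth is given up.\<close>

lemma deep_deletion:
  assumes "finite V" "deep TYPE('k::field) V d \<Gamma>"
  shows "deep TYPE('k) V (d - 1) (deletion \<Gamma> v)"
proof (cases "v \<in> V")
  case False
  then have "deletion \<Gamma> v = \<Gamma>" using assms by (auto simp: deep_def deletion_def)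
  then show ?thesis using deep_mono[OF assms(2)] by simp
next
  case True
  have sc: "simplicial_complex \<Gamma>" using assms by (simp add: deep_def)
  show ?thesis unfolding deep_def
  proof (intro conjI ballI allI impI)
    show "simplicial_complex (deletion \<Gamma> v)" using deletion_simplicial_complex[OF sc] .
    show "\<Union> (deletion \<Gamma> v) \<subseteq> V" using assms by (auto simp: deep_def deletion_def)
    fix \<tau> k assume \<tau>: "\<tau> \<in> deletion \<Gamma> v" and k: "k + card \<tau> < d - 1"
    have t: "\<tau> \<in> \<Gamma>" "v \<notin> \<tau>" using \<tau> by (auto simp: deletion_def)
    have "exact_at V (\<lambda>_. 1 :: 'k) (deletion (link \<Gamma> \<tau>) v) k"
    proof (rule exact_at_deletion[OF assms(1) True link_simplicial_complex[OF sc t(1)]])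
      show "exact_at V (\<lambda>_. 1 :: 'k) (link \<Gamma> \<tau>) k" using assms(2) t k by (auto simp: deep_def)
      assume "{v} \<in> link \<Gamma> \<tau>"
      then have "\<tau> \<union> {v} \<in> \<Gamma>" by (auto simp: link_def)
      moreover have "card (\<tau> \<union> {v}) = Suc (card \<tau>)"
        using t simplicial_complex_finite_face[OF sc t(1)] by simp
      ultimately have "exact_at V (\<lambda>_. 1 :: 'k) (link \<Gamma> (\<tau> \<union> {v})) k"
        using assms(2) k unfolding deep_def by auto
      then show "exact_at V (\<lambda>_. 1 :: 'k) (link (link \<Gamma> \<tau>) {v}) k"
        using t by (subst link_link[OF sc]) auto
    qed
    then show "exact_at V (\<lambda>_. 1 :: 'k) (link (deletion \<Gamma> v) \<tau>) k"
      using t by (simp add: link_deletion)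
  qed
qed

text \<open>Multiplying the coefficient of each face by the product of \<open>g\<close> over its
  vertices intertwines contraction by \<open>g\<close> with the boundary map.\<close>

lemma exact_at_nowhere_zero:
  assumes fin: "finite V" and d: "deep TYPE('k::field) V d \<Gamma>" and k: "k < d"
    and nz: "\<And>v. {v} \<in> \<Gamma> \<Longrightarrow> g v \<noteq> (0::'k)"
  shows "exact_at V g \<Gamma> k"
  unfolding exact_at_def
proof (intro ballI impI)
  fix z :: "'a set \<Rightarrow> 'k"
  assume z: "z \<in> chain_space \<Gamma> k" "contr V g z = 0"
  note sc = deepD(1)[OF d]
  have ex: "exact_at V (\<lambda>_. 1 :: 'k) \<Gamma> k"
    using deepD(3)[OF d simplicial_complex_empty[OF sc], of k] k by simp
  define w where "w F = (\<Prod>v\<in>F. g v)" for F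
  have wnz: "w F \<noteq> 0" if "F \<in> \<Gamma>" for F
  proof -
    have "finite F" using simplicial_complex_finite_face[OF sc that] .
    moreover have "g v \<noteq> 0" if "v \<in> F" for v
      using nz simplicial_complex_subset[OF sc \<open>F \<in> \<Gamma>\<close>, of "{v}"] that by auto
    ultimately show ?thesis by (auto simp: w_def)
  qed
  define \<phi> where "\<phi> c F = w F * c F" for c :: "'a set \<Rightarrow> 'k" and F
  have comm: "contr V (\<lambda>_. 1) (\<phi> c) G = w G * contr V g c G" for c G
  proof -
    have "vcontr v (\<phi> c) G = w G * (g v * vcontr v c G)" for v
      by (auto simp: vcontr_def \<phi>_def w_def algebra_simps)
    then show ?thesis by (simp add: contr_def sum_distrib_left)
  qed
  have "contr V (\<lambda>_. 1) (\<phi> z) = 0" using z(2) by (auto simp: fun_eq_iff comm)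
  moreover have "\<phi> z \<in> chain_space \<Gamma> k" using z(1) by (auto simp: in_chains_iff \<phi>_def)
  ultimately obtain c' where c': "c' \<in> chain_space \<Gamma> (Suc k)" "contr V (\<lambda>_. 1) c' = \<phi> z"
    using ex by (auto simp: exact_at_def)
  define c where "c F = c' F / w F" for F
  have c: "c \<in> chain_space \<Gamma> (Suc k)" using c'(1) by (auto simp: in_chains_iff c_def)
  have "\<phi> c = c'"
    using c'(1) wnz by (auto simp: fun_eq_iff \<phi>_def c_def in_chains_iff)
  have "contr V g c G = z G" for G
  proof (cases "G \<in> \<Gamma>")
    case True
    have "w G * contr V g c G = w G * z G"
      unfolding comm[of c G, symmetric] \<open>\<phi> c = c'\<close> c'(2) by (simp add: \<phi>_def)
    then show ?thesis using wnz[OF True] mult_left_cancel by blast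
  next
    case False
    then show ?thesis
      using chains_outside[OF contr_chains[OF sc c, of V g]] chains_outside[OF z(1)] by simp
  qed
  then show "\<exists>c\<in>chain_space \<Gamma> (Suc k). contr V g c = z" using c by blast
qed

text \<open>At a vertex with \<open>g v = 0\<close> contraction respects the decomposition into
  deletion part and cone part, so exactness can be checked on the deletion and, one degree lower, on
  the link. Each has at least one zero of \<open>g\<close> less, in exchange for one unit of
  depth.\<close>

lemma exact_at_few_zeros:
  fixes g :: "'a::linorder \<Rightarrow> 'k::field"
  assumes fin: "finite V" and d: "deep TYPE('k) V d \<Gamma>"
    and k: "k + card {v \<in> V. {v} \<in> \<Gamma> \<and> g v = 0} < d"
  shows "exact_at V g \<Gamma> k"
  using d k
proof (induction "card {v \<in> V. {v} \<in> \<Gamma> \<and> g v = 0}" arbitrary: \<Gamma> d k rule: less_induct)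
  case (less \<Gamma> d k)
  note sc = deepD(1)[OF less.prems(1)]
  define Z where "Z \<Gamma> = {v \<in> V. {v} \<in> \<Gamma> \<and> g v = 0}" for \<Gamma>
  have finZ: "finite (Z \<Gamma>)" for \<Gamma> using fin by (auto simp: Z_def)
  show ?case
  proof (cases "Z \<Gamma> = {}")
    case True
    have "g v \<noteq> 0" if "{v} \<in> \<Gamma>" for v
      using True that deepD(2)[OF less.prems(1)] by (auto simp: Z_def)
    then show ?thesis using exact_at_nowhere_zero[OF fin less.prems(1)] less.prems(2) by simp
  next
    case False
    then obtain v where v: "v \<in> V" "{v} \<in> \<Gamma>" "g v = 0" by (auto simp: Z_def)
    have sub: "Z (deletion \<Gamma> v) \<subset> Z \<Gamma>" "Z (link \<Gamma> {v}) \<subset> Z \<Gamma>"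
      using v by (auto simp: Z_def deletion_def link_def)
    then have card: "card (Z (deletion \<Gamma> v)) < card (Z \<Gamma>)" "card (Z (link \<Gamma> {v})) < card (Z \<Gamma>)"
      using psubset_card_mono[OF finZ] by auto
    have exd: "exact_at V g (deletion \<Gamma> v) k"
      using less.hyps[OF _ deep_deletion[OF fin less.prems(1)], of v k] card(1) less.prems(2)
      by (simp add: Z_def)
    have exl: "exact_at V g (link \<Gamma> {v}) n" if "Suc n = k" for n
      using less.hyps[OF _ deep_link[OF less.prems(1) v(2)], of n] card(2) less.prems(2) that
      by (simp add: Z_def)
    show ?thesis unfolding exact_at_def
    proof (intro ballI impI)
      fix z :: "'a set \<Rightarrow> 'k"
      assume z: "z \<in> chain_space \<Gamma> k" "contr V g z = 0"
      define z0 z1 where "z0 = avoiding v z" and "z1 = vcontr v z"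
      have z0: "z0 \<in> chain_space (deletion \<Gamma> v) k" unfolding z0_def by (rule avoiding_chains[OF z(1)])
      have dec: "z = z0 + cone v z1" unfolding z0_def z1_def by (rule chain_decompose[OF sc z(1)])
      have z1: "z1 \<in> chain_space (link \<Gamma> {v}) (k - 1)" "k = 0 \<Longrightarrow> z1 = 0"
      proof -
        show z10: "z1 = 0" if "k = 0"
        proof
          fix F show "z1 F = 0 F"
            using z(1) that by (cases "finite F") (auto simp: z1_def vcontr_def in_chains_iff)
        qed
        show "z1 \<in> chain_space (link \<Gamma> {v}) (k - 1)"
          using vcontr_chains_link[OF sc, of z "k - 1" v] z(1) z10 by (cases k) (auto simp: z1_def)
      qed
      have eq0: "contr V g z0 + cone v (- contr V g z1) = 0"
        using z(2) contr_cone[OF fin v(1) sc z1(1), of g] v(3) unfolding dec contr_add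
        by (auto simp: fun_eq_iff cone_def)
      have av: "z0 G = 0" "z1 G = 0" if "v \<in> G" for G
        using that z1(1) by (auto simp: z0_def avoiding_def in_chains_iff link_def)
      have "contr V g z0 = 0"
        by (rule avoiding_add_cone_zero(1)[OF eq0]) (simp_all add: av contr_avoiding[of v])
      moreover have "- contr V g z1 = 0"
        by (rule avoiding_add_cone_zero(2)[OF eq0]) (simp_all add: av contr_avoiding[of v])
      ultimately have cyc: "contr V g z0 = 0" "contr V g z1 = 0" by simp_all
      obtain c0 where c0: "c0 \<in> chain_space (deletion \<Gamma> v) (Suc k)" "contr V g c0 = z0"
        using exact_atD[OF exd z0 cyc(1)] by blast
      obtain c1 where c1: "c1 \<in> chain_space (link \<Gamma> {v}) k" "contr V g c1 = z1"
      proof (cases k)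
        case 0
        then show ?thesis using that[of 0] z1(2) by simp
      next
        case (Suc n)
        then show ?thesis using exact_atD[OF exl[of n] _ cyc(2)] z1(1) that by auto
      qed
      have "contr V g (c0 - cone v c1) = z"
        unfolding contr_diff contr_cone[OF fin v(1) sc c1(1)] c0(2) c1(2)
        by (subst dec) (auto simp: fun_eq_iff v(3))
      moreover have "c0 - cone v c1 \<in> chain_space \<Gamma> (Suc k)"
        using chains_mono[OF c0(1), of \<Gamma>] cone_chains[OF sc c1(1)]
        by (intro chains_diff) (auto simp: deletion_def)
      ultimately show "\<exists>c\<in>chain_space \<Gamma> (Suc k). contr V g c = z" by blast
    qed
  qed
qed

text \<open>The slack \<open>s\<close> makes the condition inherited by the systems
  \<open>g\<^sub>1, \<dots>, g\<^sub>j\<^sub>-\<^sub>2, g\<^sub>j + l g\<^sub>j\<^sub>-\<^sub>1\<close> (with slack \<open>s + 1\<close>) for every scalar \<open>l\<close>.\<close>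

definition generic_flag :: "'a set \<Rightarrow> nat \<Rightarrow> ('a \<Rightarrow> 'k::field) list \<Rightarrow> bool" where
  "generic_flag V s gs \<longleftrightarrow> (\<forall>i\<le>length gs. \<forall>a. (\<exists>l<i. a l \<noteq> 0) \<longrightarrow>
     card {v \<in> V. (\<Sum>l<i. a l * (gs ! l) v) = 0} < i + s)"

lemma generic_flagD:
  assumes "generic_flag V s gs" "i \<le> length gs" "\<exists>l<i. a l \<noteq> 0"
  shows "card {v \<in> V. (\<Sum>l<i. a l * (gs ! l) v) = 0} < i + s"
  using assms unfolding generic_flag_def by blast

lemma generic_flag_take:
  assumes "generic_flag V s (gs @ hs)"
  shows "generic_flag V s gs"
proof -
  have "(\<Sum>l<i. a l * ((gs @ hs) ! l) v) = (\<Sum>l<i. a l * (gs ! l) v)" if "i \<le> length gs" for i a v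
    using that by (intro sum.cong refl) (auto simp: nth_append)
  moreover have "card {v \<in> V. (\<Sum>l<i. a l * ((gs @ hs) ! l) v) = 0} < i + s"
    if "i \<le> length gs" "\<exists>l<i. a l \<noteq> 0" for i a
    using generic_flagD[OF assms, of i a] that by simp
  ultimately show ?thesis unfolding generic_flag_def by simp
qed

text \<open>A combination that ends in \<open>g + l * f\<close> is one of the longer list, with
  coefficients in the ratio \<open>l\<close> to 1 at \<open>f\<close> and \<open>g\<close>; the
  additional position becomes additional slack.\<close>

lemma generic_flag_pencil:
  fixes f g :: "'a \<Rightarrow> 'k::field"
  assumes "generic_flag V s (hs @ [f, g])"
  shows "generic_flag V (Suc s) (hs @ [\<lambda>v. g v + l * f v])"
  unfolding generic_flag_def
proof (intro allI impI)
  fix i :: nat and a :: "nat \<Rightarrow> 'k" assume i: "i \<le> length (hs @ [\<lambda>v. g v + l * f v])" and a: "\<exists>l<i. a l \<noteq> 0"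
  show "card {v \<in> V. (\<Sum>j<i. a j * ((hs @ [\<lambda>v. g v + l * f v]) ! j) v) = 0} < i + Suc s"
  proof (cases "i \<le> length hs")
    case True
    have "(\<Sum>j<i. a j * ((hs @ xs) ! j) v) = (\<Sum>j<i. a j * (hs ! j) v)" for v xs
      using True by (intro sum.cong refl) (auto simp: nth_append)
    then have eq: "(\<Sum>j<i. a j * ((hs @ [\<lambda>v. g v + l * f v]) ! j) v) = (\<Sum>j<i. a j * ((hs @ [f, g]) ! j) v)" for v
      by simp
    show ?thesis using generic_flagD[OF assms _ a] True unfolding eq by simp
  next
    case False
    define n where "n = length hs"
    have in': "i = Suc n" using False i by (simp add: n_def)
    define b where "b = a(n := a n * l, Suc n := a n)"
    have "(\<Sum>j<i. a j * ((hs @ [\<lambda>v. g v + l * f v]) ! j) v) = (\<Sum>j<Suc i. b j * ((hs @ [f, g]) ! j) v)" for v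
    proof -
      have "(\<Sum>j<n. a j * ((hs @ [\<lambda>v. g v + l * f v]) ! j) v) = (\<Sum>j<n. b j * ((hs @ [f, g]) ! j) v)"
        by (intro sum.cong refl) (auto simp: nth_append n_def b_def)
      then show ?thesis by (simp add: in' b_def nth_append algebra_simps flip: n_def)
    qed
    moreover have "\<exists>j<Suc i. b j \<noteq> 0"
    proof -
      obtain j where j: "j < Suc n" "a j \<noteq> 0" using a in' by blast
      define j' where "j' = (if j = n then Suc n else j)"
      have "j' < Suc i" "b j' \<noteq> 0" using j by (auto simp: j'_def b_def in')
      then show ?thesis by blast
    qed
    moreover have "Suc i \<le> length (hs @ [f, g])" using in' by (simp add: n_def)
    ultimately show ?thesis using generic_flagD[OF assms, of "Suc i" b] by simp
  qed
qed

text \<open>Induction on the number of contractions.  With \<open>\<alpha>\<close>, \<open>\<beta>\<close> the last two of them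
  and \<open>L\<close> a linear section of \<open>\<alpha>\<close>, the operator \<open>\<beta> L\<close> acts on the homology to be killed, and
  exactness of \<open>\<beta> - \<mu> \<alpha>\<close> shows that \<open>\<beta> L - \<mu>\<close> is onto for every scalar \<open>\<mu>\<close>.\<close>

theorem contraction_exact:
  fixes g :: "'a::linorder \<Rightarrow> 'k::alg_closed_field"
  assumes fin: "finite V" and d: "deep TYPE('k) V d \<Gamma>"
    and "generic_flag V s (hs @ [g])" "k + Suc (length hs) + s \<le> d"
    and "z \<in> chain_space \<Gamma> k" "\<And>h. h \<in> set hs \<Longrightarrow> contr V h z = 0" "contr V g z = 0"
  shows "\<exists>c\<in>chain_space \<Gamma> (Suc k). (\<forall>h\<in>set hs. contr V h c = 0) \<and> contr V g c = z"
  using assms(3-)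
proof (induction hs arbitrary: g s k z rule: rev_induct)
  case Nil
  have "card {v \<in> V. g v = 0} < 1 + s"
    using Nil(1) unfolding generic_flag_def by (auto dest!: spec[of _ 1] spec[of _ "\<lambda>_. 1"])
  moreover have "card {v \<in> V. {v} \<in> \<Gamma> \<and> g v = 0} \<le> card {v \<in> V. g v = 0}"
    using fin by (intro card_mono) auto
  ultimately have "exact_at V g \<Gamma> k"
    using Nil(2) by (intro exact_at_few_zeros[OF fin d]) simp
  from exact_atD[OF this Nil(3) Nil(5)] show ?case by auto
next
  case (snoc f hs)
  note sc = deepD(1)[OF d]
  define M where "M n = {c \<in> chain_space \<Gamma> n. \<forall>h\<in>set hs. contr V h c = 0}" for n
  let ?\<alpha> = "contr V f" and ?\<beta> = "contr V g"
  have subM: "fs.subspace (M n)" for n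
    by (auto simp: fs.subspace_def M_def contr_add contr_sc chains_add chains_sc fun_eq_iff)
  have contrM: "contr V f' c \<in> M n" if "c \<in> M (Suc n)" for f' c n
    using that contr_chains[OF sc] contr_swap[of V _ f' c] by (auto simp: M_def)
  have fg: "generic_flag V s (hs @ [f, g])" using snoc.prems(1) by simp
  \<comment> \<open>Dropping \<open>g\<close> from the list frees one unit of the depth budget, so
    \<open>?\<alpha>\<close> is exact on the common kernel \<open>M\<close> even in degree
    \<open>Suc k\<close>.\<close>
  have \<alpha>ex: "\<exists>c\<in>M (Suc n). ?\<alpha> c = x" if "x \<in> M n" "?\<alpha> x = 0" "n \<le> Suc k" for x n
    using snoc.IH[OF generic_flag_take[of V s "hs @ [f]" "[g]"], of n x] fg that snoc.prems(2)
    by (auto simp: M_def)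
  \<comment> \<open>Here the freed unit pays for the larger slack of the pencil.\<close>
  have \<beta>ex: "\<exists>c\<in>M (Suc k). ?\<beta> c - sc \<mu> (?\<alpha> c) = x"
    if "x \<in> M k" "?\<alpha> x = 0" "?\<beta> x = 0" for x \<mu>
  proof -
    have eq: "contr V (\<lambda>v. g v + (-\<mu>) * f v) c = ?\<beta> c - sc \<mu> (?\<alpha> c)" for c
      unfolding contr_functional_add by (auto simp: fun_eq_iff)
    have "contr V (\<lambda>v. g v + (-\<mu>) * f v) x = 0" unfolding eq by (simp add: that fun_eq_iff)
    then have "\<exists>c\<in>chain_space \<Gamma> (Suc k). (\<forall>h\<in>set hs. contr V h c = 0) \<and> contr V (\<lambda>v. g v + (-\<mu>) * f v) c = x"
      using snoc.IH[OF generic_flag_pencil[OF fg], of k x "-\<mu>"] snoc.prems(2) that(1)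
      by (auto simp: M_def)
    then show ?thesis unfolding eq by (auto simp: M_def)
  qed
  obtain L where L: "L ` UNIV \<subseteq> M (Suc k)" "Vector_Spaces.linear sc sc L" "\<forall>x\<in>?\<alpha> ` M (Suc k). ?\<alpha> (L x) = x"
    using fsp.linear_exists_right_inverse_on[OF contr_linear subM] by blast
  define T where "T x = ?\<beta> (L x)" for x
  have linT: "Vector_Spaces.linear sc sc T"
    unfolding T_def by (rule fs_linearI) (simp_all add: fs_linearD[OF L(2)] contr_add contr_sc)
  define Z where "Z = {x \<in> M k. ?\<alpha> x = 0 \<and> ?\<beta> x = 0}"
  define C where "C = {c \<in> M (Suc k). ?\<alpha> c = 0}"
  define B where "B = ?\<beta> ` C"
  have subC: "fs.subspace C"
    using subM[of "Suc k"] by (auto simp: fs.subspace_def C_def contr_add contr_sc fun_eq_iff)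
  have subB: "fs.subspace B"
  proof -
    interpret \<beta>: Vector_Spaces.linear sc sc ?\<beta> by (rule contr_linear)
    show ?thesis unfolding B_def by (rule \<beta>.subspace_image[OF subC])
  qed
  have LM: "L x \<in> M (Suc k)" for x using L(1) by blast
  have \<alpha>L: "?\<alpha> (L x) = x" if "x \<in> M k" "?\<alpha> x = 0" for x
  proof -
    have "x \<in> ?\<alpha> ` M (Suc k)" using \<alpha>ex[OF that] by force
    then show ?thesis using L(3) by blast
  qed
  have "Z \<subseteq> B"
  proof (rule surjective_shifts_imp_trivial_quotient[OF linT simplicial_complex_finite[OF sc] _ subB])
    show "z x = 0" if "z \<in> Z" "x \<notin> \<Gamma>" for z x
      using that by (auto simp: Z_def M_def in_chains_iff)
    show "T z \<in> Z" if "z \<in> Z" for z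
    proof -
      have "?\<alpha> (T z) = - ?\<beta> (?\<alpha> (L z))" unfolding T_def by (rule contr_swap)
      also have "?\<alpha> (L z) = z" using that by (intro \<alpha>L) (auto simp: Z_def)
      finally show ?thesis using that contrM[OF LM] by (simp add: Z_def T_def)
    qed
    show "T z \<in> B" if zB: "z \<in> B" for z
    proof -
      obtain b where b: "b \<in> M (Suc k)" "?\<alpha> b = 0" "z = ?\<beta> b"
        using zB unfolding B_def C_def by blast
      \<comment> \<open>Adding \<open>?\<beta> b'\<close> moves \<open>L z\<close> into
        \<open>C\<close> without changing its image under \<open>?\<beta>\<close>.\<close>
      obtain b' where b': "b' \<in> M (Suc (Suc k))" "?\<alpha> b' = b" using \<alpha>ex[OF b(1,2)] by blast
      have za: "?\<alpha> z = 0" unfolding b(3) by (subst contr_swap) (simp add: b(2))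
      have "?\<alpha> (L z) = z" using contrM[OF b(1), of g] za b(3) by (intro \<alpha>L) simp_all
      moreover have "?\<alpha> (?\<beta> b') = - z" unfolding contr_swap[of V f g] b'(2) b(3) ..
      ultimately have "L z + ?\<beta> b' \<in> C"
        using fs.subspace_add[OF subM LM contrM[OF b'(1)]] by (simp add: C_def contr_add)
      moreover have "?\<beta> (L z + ?\<beta> b') = T z" by (simp add: contr_add T_def)
      ultimately show ?thesis unfolding B_def by (metis imageI)
    qed
    show "\<exists>z\<in>Z. w - (T z - sc \<mu> z) \<in> B" if w: "w \<in> Z" for \<mu> w
    proof -
      obtain c where c: "c \<in> M (Suc k)" "?\<beta> c - sc \<mu> (?\<alpha> c) = w"
        using \<beta>ex[of w \<mu>] w by (auto simp: Z_def)
      \<comment> \<open>\<open>c\<close> and \<open>L z\<close> have the same image under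
        \<open>?\<alpha>\<close>, so their difference lies in \<open>C\<close>; its image under
        \<open>?\<beta>\<close> is the required difference of \<open>w\<close> and the shifted value
        at \<open>z\<close>.\<close>
      define z where "z = ?\<alpha> c"
      have "?\<beta> c = w + sc \<mu> z" using c(2) by (auto simp: z_def fun_eq_iff algebra_simps)
      then have "?\<beta> z = - ?\<alpha> (w + sc \<mu> z)" unfolding z_def by (subst contr_swap) simp
      also have "\<dots> = 0" using w by (simp add: contr_add contr_sc Z_def z_def fun_eq_iff)
      finally have z: "z \<in> Z" using contrM[OF c(1)] by (simp add: Z_def z_def)
      have "?\<alpha> (c - L z) = 0"
        using \<alpha>L[of z] z by (simp add: contr_diff Z_def) (simp add: z_def)
      then have "c - L z \<in> C" using fs.subspace_diff[OF subM c(1) LM] by (simp add: C_def)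
      moreover have "?\<beta> (c - L z) = w - (T z - sc \<mu> z)"
        using c(2) by (auto simp: contr_diff T_def z_def fun_eq_iff algebra_simps)
      ultimately show ?thesis using z unfolding B_def by (metis imageI)
    qed
  qed
  moreover have "z \<in> Z" using snoc.prems by (auto simp: Z_def M_def)
  ultimately show ?case by (auto simp: B_def C_def M_def)
qed

section \<open>Coordinates with respect to a generic frame\<close>

fun contrs :: "'a::linorder set \<Rightarrow> (nat \<Rightarrow> 'a \<Rightarrow> 'k::field) \<Rightarrow> nat list \<Rightarrow> ('a set \<Rightarrow> 'k) \<Rightarrow> 'a set \<Rightarrow> 'k" where
  "contrs V f [] c = c"
| "contrs V f (i # is) c = contrs V f is (contr V (f i) c)"

lemma contrs_append: "contrs V f (is @ js) c = contrs V f js (contrs V f is c)"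
  by (induction "is" arbitrary: c) auto

lemma contrs_linear: "Vector_Spaces.linear sc sc (contrs V f is)"
proof (induction "is")
  case Nil
  show ?case by (rule fs_linearI) auto
next
  case (Cons i "is")
  show ?case by (rule fs_linearI) (simp_all only: contrs.simps contr_add contr_sc fs_linearD[OF Cons])
qed

lemmas contrs_add = fs_linearD(1)[OF contrs_linear]
  and contrs_sc = fs_linearD(2)[OF contrs_linear]
  and contrs_zero [simp] = fs_linearD(3)[OF contrs_linear]
  and contrs_diff = fs_linearD(4)[OF contrs_linear]

lemma contrs_uminus: "contrs V f is (- c) = - contrs V f is c"
  using contrs_diff[of V f "is" 0 c] by simp

lemma contrs_chains:
  assumes "simplicial_complex \<Gamma>" "c \<in> chain_space \<Gamma> (length is + n)"
  shows "contrs V f is c \<in> chain_space \<Gamma> n"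
  using assms(2) by (induction "is" arbitrary: c) (auto intro: contr_chains[OF assms(1)])

text \<open>The sign is left undetermined here and in the following lemmas, since later arguments
  only ask whether a coordinate vanishes.\<close>

lemma contr_contrs:
  "contr V (f j) (contrs V f is c) = contrs V f is (contr V (f j) c)
   \<or> contr V (f j) (contrs V f is c) = - contrs V f is (contr V (f j) c)"
proof (induction "is" arbitrary: c)
  case (Cons i "is")
  have "contrs V f is (contr V (f j) (contr V (f i) c)) = - contrs V f is (contr V (f i) (contr V (f j) c))"
    by (subst contr_swap) (rule contrs_uminus)
  then show ?case using Cons[of "contr V (f i) c"] by auto
qed simp

lemma contrs_permute:
  "mset is = mset js \<Longrightarrow> contrs V f is c = contrs V f js c \<or> contrs V f is c = - contrs V f js c"
proof (induction js arbitrary: "is" c)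
  case (Cons j js)
  then obtain a b where ab: "is = a @ j # b"
    by (metis list.set_intros(1) mset_eq_setD split_list)
  then have m: "mset (a @ b) = mset js" using Cons.prems by simp
  have e1: "contrs V f is c = contrs V f b (contr V (f j) (contrs V f a c))"
    by (simp add: ab contrs_append)
  have e2: "contrs V f b (contr V (f j) (contrs V f a c)) = contrs V f (a @ b) (contr V (f j) c)
    \<or> contrs V f b (contr V (f j) (contrs V f a c)) = - contrs V f (a @ b) (contr V (f j) c)"
    using contr_contrs[of V f j a c] by (metis contrs_append contrs_uminus)
  show ?case using e2 Cons.IH[OF m, of "contr V (f j) c"] unfolding e1 contrs.simps
    by (elim disjE) (simp_all only: minus_minus simp_thms)
qed simp

lemma contrs_not_distinct:
  assumes "\<not> distinct is"
  shows "contrs V f is c = 0"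
proof -
  obtain xs ys zs y where "is = xs @ [y] @ ys @ [y] @ zs" using not_distinct_decomp[OF assms] by blast
  then have "mset is = mset (y # y # xs @ ys @ zs)" by simp
  from contrs_permute[OF this, of V f c] show ?thesis by auto
qed

text \<open>The value of a contraction at \<open>G\<close> only reads faces containing
  \<open>G\<close>, so a chain may be altered freely on faces that do not contain
  \<open>S\<close>.\<close>

lemma contrs_cong_above:
  assumes "\<And>G. S \<subseteq> G \<Longrightarrow> c G = c' G" "S \<subseteq> G"
  shows "contrs V f is c G = contrs V f is c' G"
  using assms
proof (induction "is" arbitrary: c c' G)
  case (Cons i "is")
  have "contr V (f i) c G = contr V (f i) c' G" if "S \<subseteq> G" for G
  proof -
    have eq: "c (insert v G) = c' (insert v G)" for v using that by (intro Cons.prems(1)) auto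
    show ?thesis by (simp only: contr_def vcontr_def eq)
  qed
  then show ?case using Cons.IH[of "contr V (f i) c" "contr V (f i) c'" G] Cons.prems(2) by simp
qed simp

text \<open>For finite \<open>T\<close>, on a face inside \<open>V\<close> with as many vertices as
  \<open>T\<close> this is, up to sign, the determinant of the values \<open>f i v\<close> with
  \<open>i\<close> in \<open>T\<close> and \<open>v\<close> in the face. These are the coordinates
  of a chain as an element of the exterior algebra, read in the frame \<open>f\<close>.\<close>

definition coord :: "'a::linorder set \<Rightarrow> (nat \<Rightarrow> 'a \<Rightarrow> 'k::field) \<Rightarrow> nat set \<Rightarrow> ('a set \<Rightarrow> 'k) \<Rightarrow> 'k" where
  "coord V f T c = contrs V f (sorted_list_of_set T) c {}"

lemma coord_linear:
  "coord V f T (c + c') = coord V f T c + coord V f T c'"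
  "coord V f T (sc a c) = a * coord V f T c"
  "coord V f T 0 = 0"
  by (simp_all only: coord_def contrs_add contrs_sc contrs_zero plus_fun_apply sc_apply zero_fun_apply)

lemma coord_sum: "coord V f T (\<Sum>i\<in>I. c i) = (\<Sum>i\<in>I. coord V f T (c i))"
  by (induction I rule: infinite_finite_induct)
    (simp_all only: sum.infinite sum.empty sum.insert coord_linear not_False_eq_True)

lemma coord_list:
  assumes "distinct is" "set is = T"
  shows "coord V f T c = contrs V f is c {} \<or> coord V f T c = - contrs V f is c {}"
proof -
  have "mset (sorted_list_of_set T) = mset is"
    using assms by (metis distinct_sorted_list_of_set set_eq_iff_mset_eq_distinct set_sorted_list_of_set finite_set)
  from contrs_permute[OF this, of V f c] show ?thesis unfolding coord_def by auto
qed

lemma coord_Un: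
  assumes "finite A" "finite B" "A \<inter> B = {}"
  shows "coord V f (A \<union> B) c = coord V f B (contrs V f (sorted_list_of_set A) c)
    \<or> coord V f (A \<union> B) c = - coord V f B (contrs V f (sorted_list_of_set A) c)"
  using coord_list[of "sorted_list_of_set A @ sorted_list_of_set B" "A \<union> B" V f c] assms
  by (simp add: contrs_append coord_def)

lemma coord_insert:
  assumes "finite T" "x \<notin> T"
  shows "coord V f (insert x T) c = coord V f T (contr V (f x) c)
    \<or> coord V f (insert x T) c = - coord V f T (contr V (f x) c)"
  using coord_Un[of "{x}" T V f c] assms by simp

lemma coord_contr_same:
  assumes "finite T" "x \<in> T"
  shows "coord V f T (contr V (f x) c) = 0"
  using contrs_not_distinct[of "x # sorted_list_of_set T" V f c] assms by (simp add: coord_def)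

text \<open>A functional \<open>h\<^sub>w\<close> that is dual to \<open>w\<close> on \<open>W\<close> removes exactly the vertex \<open>w\<close> from a face above \<open>S\<close>.\<close>

lemma exists_nonzero_contrs:
  fixes f :: "nat \<Rightarrow> 'a::linorder \<Rightarrow> 'k::field"
  assumes fin: "finite V" "finite I" and VS: "W \<subseteq> V" "S \<subseteq> V" "W \<inter> S = {}"
    and dual: "\<And>w. w \<in> W \<Longrightarrow> \<exists>a. \<forall>u\<in>W. (\<Sum>i\<in>I. a i * f i u) = (if u = w then 1 else 0)"
    and c: "c \<noteq> 0" "\<And>F. c F \<noteq> 0 \<Longrightarrow> S \<subseteq> F \<and> F \<subseteq> W \<union> S \<and> card F = card S + k"
  shows "\<exists>is. set is \<subseteq> I \<and> length is = k \<and> contrs V f is c S \<noteq> 0"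
  using c
proof (induction k arbitrary: c)
  case 0
  obtain F where "c F \<noteq> 0" using 0(1) by (auto simp: fun_eq_iff)
  moreover have "F = S"
    using 0(2)[OF calculation] fin VS by (metis add_0_right card_subset_eq finite_Un finite_subset)
  ultimately show ?case by simp
next
  case (Suc k)
  obtain F where F: "c F \<noteq> 0" using Suc.prems(1) by (auto simp: fun_eq_iff)
  have FS: "S \<subseteq> F" "F \<subseteq> W \<union> S" "card F = card S + Suc k" using Suc.prems(2)[OF F] by auto
  then have "F \<noteq> S" by auto
  then obtain w where w: "w \<in> F" "w \<notin> S" "w \<in> W" using FS by blast
  have finF: "finite F" using FS fin VS by (meson finite_Un finite_subset)
  obtain a where a: "\<forall>u\<in>W. (\<Sum>i\<in>I. a i * f i u) = (if u = w then 1 else 0)" using dual[OF w(3)] by blast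
  have "(\<Sum>i\<in>I. a i * contr V (f i) c (F - {w})) = (\<Sum>i\<in>I. \<Sum>u\<in>V. a i * f i u * vcontr u c (F - {w}))"
    by (simp add: contr_def sum_distrib_left mult.assoc)
  also have "\<dots> = (\<Sum>u\<in>V. (\<Sum>i\<in>I. a i * f i u) * vcontr u c (F - {w}))"
    by (subst sum.swap) (simp add: sum_distrib_right)
  also have "\<dots> = (\<Sum>u\<in>V. if u = w then vcontr w c (F - {w}) else 0)"
  proof (rule sum.cong[OF refl])
    fix u assume u: "u \<in> V"
    show "(\<Sum>i\<in>I. a i * f i u) * vcontr u c (F - {w}) = (if u = w then vcontr w c (F - {w}) else 0)"
    proof (cases "u \<in> W")
      case True
      then show ?thesis using a by simp
    next
      case False
      then have "vcontr u c (F - {w}) = 0"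
        using Suc.prems(2)[of "insert u (F - {w})"] FS(1) w(2) by (auto simp: vcontr_def)
      then show ?thesis using False w(3) by auto
    qed
  qed
  also have "\<dots> = vcontr w c (F - {w})" using w VS fin by auto
  also have "\<dots> \<noteq> 0" using F w finF by (simp add: vcontr_def insert_absorb)
  finally obtain i where i: "i \<in> I" "contr V (f i) c (F - {w}) \<noteq> 0"
    using sum.not_neutral_contains_not_neutral by force
  \<comment> \<open>Cutting off the faces that do not contain \<open>S\<close> restores the support
    hypothesis and leaves the contractions at \<open>S\<close> unchanged.\<close>
  define c' where "c' G = (if S \<subseteq> G then contr V (f i) c G else 0)" for G
  have "c' (F - {w}) \<noteq> 0" using i(2) FS(1) w by (auto simp: c'_def)
  then have "c' \<noteq> 0" by (metis zero_fun_apply)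
  moreover have "S \<subseteq> G \<and> G \<subseteq> W \<union> S \<and> card G = card S + k" if G: "c' G \<noteq> 0" for G
  proof -
    have SG: "S \<subseteq> G" "contr V (f i) c G \<noteq> 0" using G by (auto simp: c'_def split: if_splits)
    then obtain u where u: "vcontr u c G \<noteq> 0" unfolding contr_def
      by (metis (no_types, lifting) mult_zero_right sum.neutral)
    then have u': "u \<notin> G" "finite G" "c (insert u G) \<noteq> 0" by (auto simp: vcontr_def split: if_splits)
    show ?thesis using Suc.prems(2)[OF u'(3)] u' SG by auto
  qed
  ultimately obtain "is" where is': "set is \<subseteq> I" "length is = k" "contrs V f is c' S \<noteq> 0"
    using Suc.IH by blast
  moreover have "contrs V f is c' S = contrs V f is (contr V (f i) c) S"
    by (rule contrs_cong_above[of S]) (auto simp: c'_def)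
  ultimately show ?case using i(1) by (intro exI[of _ "i # is"]) simp
qed

section \<open>The weight order on index sets\<close>

lemma exists_maximal_image:
  fixes w :: "'b \<Rightarrow> nat"
  assumes "finite S" "S \<noteq> {}"
  shows "\<exists>T\<in>S. \<forall>T'\<in>S. w T' \<le> w T"
proof -
  have "Max (w ` S) \<in> w ` S" using assms by (intro Max_in) auto
  then obtain T where "T \<in> S" "w T = Max (w ` S)" by auto
  then show ?thesis using assms by (intro bexI[of _ T]) auto
qed

text \<open>For \<open>T\<close> inside \<open>{1..N}\<close> this is a number whose binary digits
  list \<open>T\<close> with small indices most significant, so comparison is lexicographic in
  favour of small indices. As a number it is additive over disjoint unions, which the argument with
  products of chains relies on.\<close>

definition weight :: "nat \<Rightarrow> nat set \<Rightarrow> nat" where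
  "weight N T = (\<Sum>x\<in>T. 2 ^ (N - x))"

lemma weight_inj:
  assumes "T \<subseteq> {1..N}" "G \<subseteq> {1..N}" "weight N T = weight N G"
  shows "T = G"
proof -
  have inj: "inj_on (\<lambda>x. N - x) {1..N}" by (auto simp: inj_on_def)
  have eq: "weight N A = set_encode ((\<lambda>x. N - x) ` A)" if "A \<subseteq> {1..N}" for A
    using inj_on_subset[OF inj that] by (simp add: weight_def set_encode_def sum.reindex)
  have "(\<lambda>x. N - x) ` T = (\<lambda>x. N - x) ` G"
    using assms eq set_encode_eq by (metis finite_atLeastAtMost finite_imageI finite_subset)
  then show ?thesis using inj assms by (simp add: inj_on_image_eq_iff)
qed

lemma weight_Un: "finite A \<Longrightarrow> finite B \<Longrightarrow> A \<inter> B = {} \<Longrightarrow> weight N (A \<union> B) = weight N A + weight N B"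
  by (simp add: weight_def sum.union_disjoint)

lemma weight_insert: "finite T \<Longrightarrow> x \<notin> T \<Longrightarrow> weight N (insert x T) = 2 ^ (N - x) + weight N T"
  by (simp add: weight_def)

lemma weight_exchange:
  assumes "finite T" "i \<in> T" "j \<notin> T"
  shows "weight N (insert j (T - {i})) + 2 ^ (N - i) = weight N T + 2 ^ (N - j)"
proof -
  have "weight N T = 2 ^ (N - i) + weight N (T - {i})"
    using assms weight_insert[of "T - {i}" i N] by (simp add: insert_absorb)
  then show ?thesis using assms weight_insert[of "T - {i}" j N] by simp
qed

lemma weight_exchange_less:
  assumes "finite T" "i \<in> T" "j \<notin> T" "j < i" "i \<le> N"
  shows "weight N T < weight N (insert j (T - {i}))"
proof -
  have "(2::nat) ^ (N - i) < 2 ^ (N - j)" using assms by simp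
  then show ?thesis using weight_exchange[OF assms(1-3), of N] by linarith
qed

lemma weight_tail: "weight N {Suc x..N} < 2 ^ (N - x)"
proof (induction "N - x" arbitrary: x)
  case 0
  then show ?case by (simp add: weight_def)
next
  case (Suc n)
  then have x: "Suc x \<le> N" "N - x = Suc (N - Suc x)" by auto
  have "{Suc x..N} = insert (Suc x) {Suc (Suc x)..N}" using x by auto
  then have "weight N {Suc x..N} = 2 ^ (N - Suc x) + weight N {Suc (Suc x)..N}"
    by (simp add: weight_insert)
  also have "\<dots> < 2 ^ (N - Suc x) + 2 ^ (N - Suc x)" using Suc(1)[of "Suc x"] Suc(2) by simp
  also have "\<dots> = 2 ^ (N - x)" by (simp add: x(2))
  finally show ?case .
qed

text \<open>At the least \<open>x\<close> of the prefix that \<open>G\<close> misses, everything in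
  \<open>G\<close> beyond \<open>x\<close> weighs less than \<open>x\<close> alone.\<close>

lemma weight_prefix_less:
  assumes "G \<subseteq> {1..N}" "H \<subseteq> {1..N}" "{1..j} \<subseteq> H" "\<not> {1..j} \<subseteq> G"
  shows "weight N G < weight N H"
proof -
  define x where "x = (LEAST x. x \<in> {1..j} - G)"
  have ex: "\<exists>x. x \<in> {1..j} - G" using assms(4) by auto
  have x: "x \<in> {1..j} - G" unfolding x_def by (rule LeastI_ex[OF ex])
  have below: "y \<in> G" if "1 \<le> y" "y < x" for y
    using not_less_Least[of y "\<lambda>x. x \<in> {1..j} - G"] that x unfolding x_def by auto
  have fin: "finite G" "finite H" using assms finite_subset by blast+
  have sub: "G \<subseteq> {1..<x} \<union> {Suc x..N}" 
  proof
    fix y assume y: "y \<in> G"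
    then have "1 \<le> y" "y \<le> N" "y \<noteq> x" using x assms(1) by auto
    then show "y \<in> {1..<x} \<union> {Suc x..N}" by auto
  qed
  have "weight N G \<le> weight N ({1..<x} \<union> {Suc x..N})"
    unfolding weight_def by (rule sum_mono2) (use sub in auto)
  also have "\<dots> = weight N {1..<x} + weight N {Suc x..N}" by (rule weight_Un) auto
  also have "\<dots> < weight N {1..<x} + 2 ^ (N - x)" using weight_tail[of N x] by simp
  also have "\<dots> = weight N (insert x {1..<x})" by (simp add: weight_insert)
  also have "\<dots> \<le> weight N H"
    unfolding weight_def by (rule sum_mono2) (use fin assms(3) x in auto)
  finally show ?thesis .
qed

text \<open>Equivalently, for every \<open>i \<le> card V\<close> and every \<open>i\<close>-subset
  of \<open>V\<close>, the values of the first \<open>i\<close> functionals form a nonsingular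
  square matrix.\<close>

definition generic_frame :: "'a set \<Rightarrow> (nat \<Rightarrow> 'a \<Rightarrow> 'k::field) \<Rightarrow> bool" where
  "generic_frame V f \<longleftrightarrow> (\<forall>i\<le>card V. \<forall>a. (\<exists>l\<in>{1..i}. a l \<noteq> 0) \<longrightarrow>
     card {v \<in> V. (\<Sum>l=1..i. a l * f l v) = 0} < i)"

lemma generic_frame_dual:
  assumes "finite V" "generic_frame V f" "W \<subseteq> V" "w \<in> W"
  shows "\<exists>a. \<forall>u\<in>W. (\<Sum>l=1..card W. a l * f l u) = (if u = w then 1 else (0::'k::field))"
proof -
  define i where "i = card W"
  have finW: "finite W" using assms finite_subset by blast
  have iV: "i \<le> card V" unfolding i_def using assms by (intro card_mono)
  \<comment> \<open>Column 0 carries the right-hand side. There are \<open>i + 1\<close> unknowns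
    for \<open>i\<close> equations, and genericity excludes a solution with \<open>c 0 = 0\<close>,
    so the solution can be normalised.\<close>
  define m where "m u l = (if l = 0 then (if u = w then 1 else 0) else f l u)" for u l
  have "card W < card {0..i}" by (simp add: i_def)
  then obtain c where c: "\<exists>l\<in>{0..i}. c l \<noteq> 0" "\<And>u. u \<in> W \<Longrightarrow> (\<Sum>l\<in>{0..i}. m u l * c l) = 0"
    by (rule homogeneous_system_nontrivial[OF finite_atLeastAtMost finW, where m = m]) blast
  have split: "(\<Sum>l\<in>{0..i}. m u l * c l) = (if u = w then c 0 else 0) + (\<Sum>l=1..i. c l * f l u)" for u
  proof -
    have "(\<Sum>l\<in>{0..i}. m u l * c l) = m u 0 * c 0 + (\<Sum>l=1..i. m u l * c l)"
      by (simp add: sum.atLeast_Suc_atMost)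
    also have "(\<Sum>l=1..i. m u l * c l) = (\<Sum>l=1..i. c l * f l u)"
      by (intro sum.cong) (auto simp: m_def)
    finally show ?thesis by (simp add: m_def)
  qed
  have "c 0 \<noteq> 0"
  proof
    assume 0: "c 0 = 0"
    then have "\<exists>l\<in>{1..i}. c l \<noteq> 0" using c(1) by (metis atLeastAtMost_iff le_0_eq not_less_eq_eq One_nat_def)
    then have "card {v \<in> V. (\<Sum>l=1..i. c l * f l v) = 0} < i"
      using assms(2) iV unfolding generic_frame_def by blast
    moreover have "W \<subseteq> {v \<in> V. (\<Sum>l=1..i. c l * f l v) = 0}"
    proof
      fix u assume "u \<in> W"
      then show "u \<in> {v \<in> V. (\<Sum>l=1..i. c l * f l v) = 0}"
        using c(2)[of u] 0 assms(3) unfolding split by (auto split: if_splits)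
    qed
    then have "i \<le> card {v \<in> V. (\<Sum>l=1..i. c l * f l v) = 0}"
      unfolding i_def using assms(1) by (intro card_mono) auto
    ultimately show False by simp
  qed
  have "(\<Sum>l=1..i. (- c l / c 0) * f l u) = (if u = w then 1 else 0)" if "u \<in> W" for u
  proof -
    have "(\<Sum>l=1..i. (- c l / c 0) * f l u) = - (\<Sum>l=1..i. c l * f l u) / c 0"
      by (simp add: sum_divide_distrib sum_negf)
    then show ?thesis using c(2)[OF that] \<open>c 0 \<noteq> 0\<close> unfolding split
      by (auto simp: add_eq_0_iff split: if_splits)
  qed
  then show ?thesis unfolding i_def by (intro exI[of _ "\<lambda>l. - c l / c 0"]) blast
qed

lemma generic_frame_flag:
  assumes "generic_frame V f" "j \<le> card V"
  shows "generic_flag V 0 (map f [1..<Suc j])"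
  unfolding generic_flag_def
proof (intro allI impI)
  fix i a assume i: "i \<le> length (map f [1..<Suc j])" and a: "\<exists>l<i. a l \<noteq> (0::'b)"
  have ij: "i \<le> j" using i by (simp del: upt_Suc)
  have eq: "(\<Sum>l<i. a l * (map f [1..<Suc j] ! l) v) = (\<Sum>l=1..i. a (l - 1) * f l v)" for v
  proof -
    have "(\<Sum>l<i. a l * (map f [1..<Suc j] ! l) v) = (\<Sum>l<i. a l * f (Suc l) v)"
      using i by (intro sum.cong refl) (simp del: upt_Suc)
    also have "\<dots> = (\<Sum>l=1..i. a (l - 1) * f l v)"
      by (rule sum.reindex_bij_witness[of _ "\<lambda>l. l - 1" Suc]) auto
    finally show ?thesis .
  qed
  obtain l where "l < i" "a l \<noteq> 0" using a by blast
  then have "\<exists>l\<in>{1..i}. a (l - 1) \<noteq> 0" by (intro bexI[of _ "Suc l"]) auto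
  then show "card {v \<in> V. (\<Sum>l<i. a l * (map f [1..<Suc j] ! l) v) = 0} < i + 0"
    using assms ij unfolding eq generic_frame_def by simp
qed

text \<open>The leading sets of exterior algebraic shifting. Leading means of largest weight, so the
  preferred sets are those with small indices.\<close>

definition initial :: "'a::linorder set \<Rightarrow> (nat \<Rightarrow> 'a \<Rightarrow> 'k::field) \<Rightarrow> nat \<Rightarrow> 'a set set \<Rightarrow> nat set set" where
  "initial V f r A = {T. T \<subseteq> {1..card V} \<and> card T = r \<and>
     (\<exists>c. (\<forall>F. c F \<noteq> 0 \<longrightarrow> F \<in> A) \<and> coord V f T c \<noteq> 0 \<and>
       (\<forall>G. G \<subseteq> {1..card V} \<and> card G = r \<and> weight (card V) T < weight (card V) G \<longrightarrow> coord V f G c = 0))}"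

lemma initialD:
  assumes "T \<in> initial V f r A"
  obtains c where "\<And>F. c F \<noteq> 0 \<Longrightarrow> F \<in> A" "coord V f T c \<noteq> 0"
    "\<And>G. G \<subseteq> {1..card V} \<Longrightarrow> card G = r \<Longrightarrow> weight (card V) T < weight (card V) G \<Longrightarrow> coord V f G c = 0"
  using assms unfolding initial_def by blast

lemma initial_sub: "T \<in> initial V f r A \<Longrightarrow> T \<subseteq> {1..card V} \<and> card T = r"
  by (auto simp: initial_def)

lemma finite_initial [simp]: "finite (initial V f r A)"
  by (rule finite_subset[of _ "Pow {1..card V}"]) (auto simp: initial_def)

lemma initial_mono: "A \<subseteq> B \<Longrightarrow> initial V f r A \<subseteq> initial V f r B"
  unfolding initial_def by blast

text \<open>The whole frame is a basis of the functionals on \<open>V\<close>, so coordinates detect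
  every nonzero chain.\<close>

lemma exists_nonzero_coord:
  fixes f :: "nat \<Rightarrow> 'a::linorder \<Rightarrow> 'k::field"
  assumes "finite V" "generic_frame V f" "c \<noteq> 0" "\<And>F. c F \<noteq> 0 \<Longrightarrow> F \<subseteq> V \<and> card F = r"
  obtains T where "T \<subseteq> {1..card V}" "card T = r" "coord V f T c \<noteq> 0"
proof -
  have "\<exists>is. set is \<subseteq> {1..card V} \<and> length is = r \<and> contrs V f is c {} \<noteq> 0"
    by (rule exists_nonzero_contrs[where W = V])
      (use assms generic_frame_dual[OF assms(1,2) subset_refl] in auto)
  then obtain "is" where is': "set is \<subseteq> {1..card V}" "length is = r" "contrs V f is c {} \<noteq> 0" by blast
  then have "distinct is" using contrs_not_distinct[of "is" V f c] by fastforce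
  then show thesis
    using that[of "set is"] coord_list[of "is" "set is" V f c] is' distinct_card by fastforce
qed

lemma exists_leading_coord:
  fixes f :: "nat \<Rightarrow> 'a::linorder \<Rightarrow> 'k::field"
  assumes "finite V" "generic_frame V f" "\<And>F. F \<in> A \<Longrightarrow> F \<subseteq> V \<and> card F = r"
    and "\<And>F. c F \<noteq> 0 \<Longrightarrow> F \<in> A" and G: "G \<subseteq> {1..card V}" "card G = r" "coord V f G c \<noteq> 0"
  obtains T where "T \<in> initial V f r A" "coord V f T c \<noteq> 0" "weight (card V) G \<le> weight (card V) T"
proof -
  define S where "S = {T. T \<subseteq> {1..card V} \<and> card T = r \<and> coord V f T c \<noteq> 0}"
  have "finite S" by (rule finite_subset[of _ "Pow {1..card V}"]) (auto simp: S_def)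
  moreover have GS: "G \<in> S" using G by (simp add: S_def)
  ultimately obtain T where T: "T \<in> S" "\<And>T'. T' \<in> S \<Longrightarrow> weight (card V) T' \<le> weight (card V) T"
    using exists_maximal_image[of S "weight (card V)"] by blast
  have "T \<in> initial V f r A"
    using T assms(4) unfolding S_def initial_def by (auto intro!: exI[of _ c]) (metis leD)
  then show thesis using that T GS by (auto simp: S_def)
qed

definition face_chain :: "'a set \<Rightarrow> 'a set \<Rightarrow> 'k::field" where
  "face_chain F G = (if G = F then 1 else 0)"

lemma coord_expand:
  assumes "finite A" "\<And>F. c F \<noteq> 0 \<Longrightarrow> F \<in> A"
  shows "coord V f T c = (\<Sum>F\<in>A. coord V f T (face_chain F) * c F)"
proof -
  have "c = (\<Sum>F\<in>A. sc (c F) (face_chain F))"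
  proof
    fix G show "c G = (\<Sum>F\<in>A. sc (c F) (face_chain F)) G"
      using assms by (auto simp: fun_sum_apply face_chain_def if_distrib cong: if_cong)
  qed
  then have "coord V f T c = (\<Sum>F\<in>A. coord V f T (sc (c F) (face_chain F)))" by (metis coord_sum)
  then show ?thesis by (simp add: coord_linear mult.commute)
qed

text \<open>With fewer leading sets than faces, some nonzero chain on \<open>A\<close> would have
  zero coordinates at all of them, although its own leading set is among them.\<close>

lemma card_le_initial:
  fixes f :: "nat \<Rightarrow> 'a::linorder \<Rightarrow> 'k::field"
  assumes "finite V" "generic_frame V f" "finite A" "\<And>F. F \<in> A \<Longrightarrow> F \<subseteq> V \<and> card F = r"
  shows "card A \<le> card (initial V f r A)"
proof (rule ccontr)
  assume "\<not> ?thesis"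
  then have "card (initial V f r A) < card A" by simp
  then obtain c where c: "\<And>F. F \<notin> A \<Longrightarrow> c F = 0" "\<exists>F\<in>A. c F \<noteq> 0"
    "\<And>T. T \<in> initial V f r A \<Longrightarrow> (\<Sum>F\<in>A. coord V f T (face_chain F) * c F) = 0"
    by (rule homogeneous_system_nontrivial[OF assms(3) finite_initial, where m = "\<lambda>T F. coord V f T (face_chain F)"]) blast
  have cA: "F \<in> A" if "c F \<noteq> 0" for F using c(1) that by blast
  have "c \<noteq> 0" using c(2) by (metis zero_fun_apply)
  have sup: "F \<subseteq> V \<and> card F = r" if "c F \<noteq> 0" for F using assms(4)[OF cA[OF that]] .
  obtain G where G: "G \<subseteq> {1..card V}" "card G = r" "coord V f G c \<noteq> 0"
    by (rule exists_nonzero_coord[OF assms(1,2) \<open>c \<noteq> 0\<close> sup])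
  obtain T where "T \<in> initial V f r A" "coord V f T c \<noteq> 0"
    by (rule exists_leading_coord[OF assms(1,2,4) cA G])
  then show False using c(3)[of T] coord_expand[OF assms(3) cA, where V = V and f = f and T = T] by simp
qed

text \<open>The matrix of coordinates of the witnesses is triangular in the weight order.\<close>

lemma leading_coords_independent:
  fixes f :: "nat \<Rightarrow> 'a::linorder \<Rightarrow> 'k::field"
  assumes I: "finite I" "I \<subseteq> initial V f r A"
    and lead: "\<And>T G. T \<in> I \<Longrightarrow> G \<subseteq> {1..card V} \<Longrightarrow> card G = r \<Longrightarrow> weight (card V) T < weight (card V) G \<Longrightarrow> coord V f G (cc T) = 0"
    and nz: "\<And>T. T \<in> I \<Longrightarrow> coord V f T (cc T) \<noteq> 0"
    and x: "\<And>G. G \<in> I \<Longrightarrow> (\<Sum>T\<in>I. coord V f G (cc T) * x T) = 0"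
  shows "\<forall>T\<in>I. x T = 0"
proof (rule ccontr)
  assume nt: "\<not> (\<forall>T\<in>I. x T = 0)"
  define S where "S = {T\<in>I. x T \<noteq> 0}"
  have "finite S" "S \<noteq> {}" using I nt by (auto simp: S_def)
  then obtain T where T: "T \<in> S" "\<And>T'. T' \<in> S \<Longrightarrow> weight (card V) T' \<le> weight (card V) T"
    using exists_maximal_image[of S "weight (card V)"] by blast
  have TI: "T \<in> I" using T by (simp add: S_def)
  have "(\<Sum>T'\<in>I. coord V f T (cc T') * x T') = (\<Sum>T'\<in>I. if T' = T then coord V f T (cc T) * x T else 0)"
  proof (rule sum.cong[OF refl])
    fix T' assume T': "T' \<in> I"
    show "coord V f T (cc T') * x T' = (if T' = T then coord V f T (cc T) * x T else 0)"
    proof (cases "T' = T \<or> x T' = 0")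
      case False
      then have "weight (card V) T' \<le> weight (card V) T" using T(2)[of T'] T' by (simp add: S_def)
      moreover have "weight (card V) T' \<noteq> weight (card V) T"
        using weight_inj[of T' "card V" T] False I(2) T' TI initial_sub by blast
      ultimately have "coord V f T (cc T') = 0"
        using I(2) TI initial_sub[of T V f r A] by (intro lead[OF T']) auto
      then show ?thesis using False by simp
    qed auto
  qed
  also have "\<dots> = coord V f T (cc T) * x T" using I TI by simp
  finally have "x T = 0" using x[OF TI] nz[OF TI] by simp
  then show False using T by (simp add: S_def)
qed

lemma initial_witnesses:
  obtains cc where
    "\<And>T F. T \<in> initial V f r A \<Longrightarrow> cc T F \<noteq> 0 \<Longrightarrow> F \<in> A"
    "\<And>T. T \<in> initial V f r A \<Longrightarrow> coord V f T (cc T) \<noteq> 0"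
    "\<And>T G. T \<in> initial V f r A \<Longrightarrow> G \<subseteq> {1..card V} \<Longrightarrow> card G = r \<Longrightarrow>
       weight (card V) T < weight (card V) G \<Longrightarrow> coord V f G (cc T) = 0"
proof -
  have "\<forall>T\<in>initial V f r A. \<exists>c. (\<forall>F. c F \<noteq> 0 \<longrightarrow> F \<in> A) \<and> coord V f T c \<noteq> 0 \<and>
       (\<forall>G. G \<subseteq> {1..card V} \<and> card G = r \<and> weight (card V) T < weight (card V) G \<longrightarrow> coord V f G c = 0)"
    by (auto simp: initial_def)
  then obtain cc where "\<forall>T\<in>initial V f r A. (\<forall>F. cc T F \<noteq> 0 \<longrightarrow> F \<in> A) \<and> coord V f T (cc T) \<noteq> 0 \<and>
       (\<forall>G. G \<subseteq> {1..card V} \<and> card G = r \<and> weight (card V) T < weight (card V) G \<longrightarrow> coord V f G (cc T) = 0)"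
    by metis
  then show thesis using that[of cc] by blast
qed

text \<open>The witnesses are chains on \<open>A\<close>; more of them than faces would be
  dependent, against triangularity.\<close>

lemma initial_le_card:
  fixes f :: "nat \<Rightarrow> 'a::linorder \<Rightarrow> 'k::field"
  assumes "finite A"
  shows "card (initial V f r A) \<le> card A"
proof (rule ccontr)
  assume "\<not> ?thesis"
  then have less: "card A < card (initial V f r A)" by simp
  obtain cc where cc: "\<And>T F. T \<in> initial V f r A \<Longrightarrow> cc T F \<noteq> 0 \<Longrightarrow> F \<in> A"
    "\<And>T. T \<in> initial V f r A \<Longrightarrow> coord V f T (cc T) \<noteq> 0"
    "\<And>T G. T \<in> initial V f r A \<Longrightarrow> G \<subseteq> {1..card V} \<Longrightarrow> card G = r \<Longrightarrow>
       weight (card V) T < weight (card V) G \<Longrightarrow> coord V f G (cc T) = 0"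
    using initial_witnesses[of V f r A] by metis
  from less obtain x where x: "\<exists>T\<in>initial V f r A. x T \<noteq> 0"
    "\<And>F. F \<in> A \<Longrightarrow> (\<Sum>T\<in>initial V f r A. cc T F * x T) = 0"
    by (rule homogeneous_system_nontrivial[OF finite_initial assms, where m = "\<lambda>F T. cc T F"]) blast
  define c where "c = (\<Sum>T\<in>initial V f r A. sc (x T) (cc T))"
  have "c = 0"
  proof
    fix F show "c F = 0 F"
    proof (cases "F \<in> A")
      case True
      then show ?thesis using x(2)[OF True] by (simp add: c_def fun_sum_apply mult.commute)
    next
      case False
      then have "cc T F = 0" if "T \<in> initial V f r A" for T using cc(1)[OF that] by blast
      then show ?thesis by (simp add: c_def fun_sum_apply)
    qed
  qed
  then have "(\<Sum>T\<in>initial V f r A. coord V f G (cc T) * x T) = 0" for G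
    using coord_sum[of V f G "\<lambda>T. sc (x T) (cc T)" "initial V f r A"]
    by (simp add: coord_linear mult.commute flip: c_def)
  then have "\<forall>T\<in>initial V f r A. x T = 0"
    using leading_coords_independent[OF finite_initial subset_refl, of V f r A cc x] cc by blast
  then show False using x(1) by blast
qed

section \<open>Existence of frames with shifted leading monomials\<close>

text \<open>Over a finite field the product of all linear factors, plus one, would have no
  root.\<close>

lemma infinite_UNIV_alg_closed: "infinite (UNIV :: 'k::alg_closed_field set)"
proof
  assume fin: "finite (UNIV :: 'k set)"
  define q :: "'k poly" where "q = (\<Prod>a\<in>UNIV. [:-a, 1:])"
  have q0: "q \<noteq> 0" by (simp add: q_def fin)
  have degree_q: "degree q = card (UNIV :: 'k set)"
    unfolding q_def by (subst degree_prod_eq_sum_degree) auto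
  have "0 < card (UNIV :: 'k set)" using fin by (simp add: card_gt_0_iff)
  then have "degree (q + 1) > 0" using degree_q by (simp add: degree_add_eq_left)
  then obtain x where "poly (q + 1) x = 0" using alg_closed_imp_poly_has_root by blast
  moreover have "poly q x = 0" unfolding q_def poly_prod using fin by (intro prod_zero) auto
  ultimately show False by simp
qed

text \<open>A Vandermonde frame: a nontrivial combination of the first \<open>i\<close> functionals
  evaluates a nonzero polynomial of degree below \<open>i\<close> at distinct points.\<close>

lemma exists_generic_frame:
  assumes "finite (V :: 'a set)"
  shows "\<exists>f :: nat \<Rightarrow> 'a \<Rightarrow> 'k::alg_closed_field. generic_frame V f"
proof -
  obtain S :: "'k set" where S: "finite S" "card S = card V"
    using infinite_arbitrarily_large[OF infinite_UNIV_alg_closed] by blast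
  then obtain t where t: "bij_betw t V S" using assms finite_same_card_bij by metis
  define f where "f l v = t v ^ (l - 1)" for l :: nat and v
  have "card {v \<in> V. (\<Sum>l=1..i. a l * f l v) = 0} < i"
    if i: "i \<le> card V" and a: "\<exists>l\<in>{1..i}. a l \<noteq> (0::'k)" for i a
  proof -
    obtain l where l: "l \<in> {1..i}" "a l \<noteq> 0" using a by blast
    define p where "p = (\<Sum>l<i. monom (a (Suc l)) l)"
    have cp: "coeff p n = (if n < i then a (Suc n) else 0)" for n
      by (simp add: p_def coeff_sum coeff_monom if_distrib cong: if_cong)
    have "coeff p (l - 1) \<noteq> 0" using l by (auto simp: cp)
    then have p0: "p \<noteq> 0" by auto
    have "degree p \<le> i - 1" by (rule degree_le) (use cp in auto)
    then have deg: "degree p < i" using l by auto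
    have ev: "(\<Sum>l=1..i. a l * f l v) = poly p (t v)" for v
    proof -
      have "(\<Sum>l=1..i. a l * f l v) = (\<Sum>l<i. a (Suc l) * t v ^ l)"
        unfolding f_def by (rule sum.reindex_bij_witness[of _ Suc "\<lambda>l. l - 1"]) auto
      also have "\<dots> = poly p (t v)" by (simp add: p_def poly_sum poly_monom)
      finally show ?thesis .
    qed
    have "card {v \<in> V. poly p (t v) = 0} = card (t ` {v \<in> V. poly p (t v) = 0})"
      using t by (intro card_image[symmetric]) (auto simp: bij_betw_def inj_on_def)
    also have "\<dots> \<le> card {x. poly p x = 0}"
      using poly_roots_finite[OF p0] by (intro card_mono) auto
    also have "\<dots> \<le> degree p" by (rule card_poly_roots_bound[OF p0])
    finally show ?thesis using deg unfolding ev by simp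
  qed
  then have "generic_frame V f" unfolding generic_frame_def by blast
  then show ?thesis by blast
qed

section \<open>Shears of a frame\<close>

definition frame_shear :: "nat \<Rightarrow> nat \<Rightarrow> 'k::field \<Rightarrow> (nat \<Rightarrow> 'a \<Rightarrow> 'k) \<Rightarrow> nat \<Rightarrow> 'a \<Rightarrow> 'k" where
  "frame_shear j i l f = f(j := \<lambda>v. f j v + l * f i v)"

text \<open>A sequence of contractions is linear in each functional, so the shear adds a multiple of
  the sequence in which \<open>f j\<close> is replaced by \<open>f i\<close>.\<close>

lemma contrs_frame_shear:
  assumes "distinct is"
  shows "contrs V (frame_shear j i l f) is c
    = contrs V f is c + (if j \<in> set is then sc l (contrs V (f(j := f i)) is c) else 0)"
  using assms
proof (induction "is" arbitrary: c)
  case (Cons x "is")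
  show ?case
  proof (cases "x = j")
    case True
    then have j: "j \<notin> set is" using Cons.prems by simp
    have eq: "contrs V (frame_shear j i l f) is c = contrs V f is c" for c
      using Cons.IH[of c] Cons.prems j by simp
    have eq2: "contrs V (f(j := f i)) is c = contrs V f is c" for c
      using j by (induction "is" arbitrary: c) auto
    have "contrs V (frame_shear j i l f) (x # is) c = contrs V f is (contr V (f j) c + sc l (contr V (f i) c))"
      by (simp only: contrs.simps eq) (simp add: True frame_shear_def contr_functional_add)
    also have "\<dots> = contrs V f is (contr V (f j) c) + sc l (contrs V f is (contr V (f i) c))"
      by (simp only: contrs_add contrs_sc)
    finally show ?thesis by (simp add: True eq2)
  next
    case False
    then have "frame_shear j i l f x = f x" "(f(j := f i)) x = f x" by (auto simp: frame_shear_def)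
    then show ?thesis using Cons.IH[of "contr V (f x) c"] Cons.prems False by simp
  qed
qed simp

lemma coord_frame_shear:
  "coord V (frame_shear j i l f) T c = coord V f T c + l * (if finite T \<and> j \<in> T then coord V (f(j := f i)) T c else 0)"
  using contrs_frame_shear[of "sorted_list_of_set T" V j i l f c]
  by (cases "finite T") (auto simp: coord_def)

lemma coord_replaced:
  assumes "finite T" "j \<in> T"
  shows "i \<in> T \<Longrightarrow> i \<noteq> j \<Longrightarrow> coord V (f(j := f i)) T c = 0"
    and "i \<notin> T \<Longrightarrow> coord V (f(j := f i)) T c = coord V f (insert i (T - {j})) c
      \<or> coord V (f(j := f i)) T c = - coord V f (insert i (T - {j})) c"
proof -
  have eq: "coord V (f(j := f i)) T c = contr_list \<or> coord V (f(j := f i)) T c = - contr_list"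
    if "contr_list = coord V (f(j := f i)) (T - {j}) (contr V (f i) c)" for contr_list
    using coord_insert[of "T - {j}" j V "f(j := f i)" c] assms that by (simp add: insert_absorb)
  have "contrs V (f(j := f i)) is c = contrs V f is c" if "j \<notin> set is" for "is" c
    using that by (induction "is" arbitrary: c) auto
  then have eq2: "coord V (f(j := f i)) (T - {j}) c = coord V f (T - {j}) c" for c
    using assms by (simp add: coord_def)
  show "coord V (f(j := f i)) T c = 0" if "i \<in> T" "i \<noteq> j"
    using eq[OF refl] coord_contr_same[of "T - {j}" i V f c] assms that by (simp add: eq2)
  show "coord V (f(j := f i)) T c = coord V f (insert i (T - {j})) c
      \<or> coord V (f(j := f i)) T c = - coord V f (insert i (T - {j})) c" if "i \<notin> T"
    using eq[OF refl] coord_insert[of "T - {j}" i V f c] assms that unfolding eq2 by auto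
qed

text \<open>Genericity amounts to nonsingularity of finitely many square matrices. Along the shear
  each depends affinely on \<open>l\<close> and is nonsingular at \<open>l = 0\<close>.\<close>

lemma finite_nongeneric_shears:
  fixes f :: "nat \<Rightarrow> 'a \<Rightarrow> 'k::field"
  assumes fin: "finite V" and gen: "generic_frame V f" and ij: "j < i"
  shows "finite {l. \<not> generic_frame V (frame_shear j i l f)}"
proof -
  define m1 where "m1 v x = (if x = j then f i v else 0)" for v x
  define bad where "bad R = {l. \<exists>a. (\<exists>x\<in>{1..card R}. a x \<noteq> 0) \<and>
    (\<forall>v\<in>R. (\<Sum>x\<in>{1..card R}. (f x v + l * m1 v x) * a x) = 0)}" for R
  have "finite (bad R)" if R: "R \<subseteq> V" for R
    unfolding bad_def
  proof (rule finite_singular_parameters)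
    fix a assume a: "\<And>v. v \<in> R \<Longrightarrow> (\<Sum>x\<in>{1..card R}. f x v * a x) = 0"
    show "\<forall>x\<in>{1..card R}. a x = 0"
    proof (rule ccontr)
      assume "\<not> (\<forall>x\<in>{1..card R}. a x = 0)"
      moreover have "card R \<le> card V" using R fin by (rule card_mono[rotated])
      ultimately have "card {v \<in> V. (\<Sum>x=1..card R. a x * f x v) = 0} < card R"
        using gen unfolding generic_frame_def by blast
      moreover have "R \<subseteq> {v \<in> V. (\<Sum>x=1..card R. a x * f x v) = 0}"
        using a R by (auto simp: mult.commute)
      then have "card R \<le> card {v \<in> V. (\<Sum>x=1..card R. a x * f x v) = 0}"
        using fin by (intro card_mono) auto
      ultimately show False by simp
    qed
  qed simp
  then have finbad: "finite (\<Union>R\<in>Pow V. bad R)" using fin by blast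
  have mem: "l \<in> (\<Union>R\<in>Pow V. bad R)" if l: "\<not> generic_frame V (frame_shear j i l f)" for l
  proof -
    obtain k a where ka: "k \<le> card V" "\<exists>x\<in>{1..k}. a x \<noteq> 0"
      "k \<le> card {v \<in> V. (\<Sum>x=1..k. a x * frame_shear j i l f x v) = 0}"
      using l unfolding generic_frame_def by (auto simp: not_less)
    obtain R where R: "R \<subseteq> {v \<in> V. (\<Sum>x=1..k. a x * frame_shear j i l f x v) = 0}" "card R = k"
      using ka(3) by (meson obtain_subset_with_card_n)
    have eq: "frame_shear j i l f x v = f x v + l * m1 v x" for x v
      by (simp add: frame_shear_def m1_def)
    have "\<forall>v\<in>R. (\<Sum>x\<in>{1..card R}. (f x v + l * m1 v x) * a x) = 0"
      using R by (auto simp: eq mult.commute)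
    then have "l \<in> bad R" using ka(2) R(2) unfolding bad_def by blast
    then show ?thesis using R(1) by blast
  qed
  show ?thesis by (rule finite_subset[OF _ finbad]) (use mem in blast)
qed

text \<open>For a generic frame and faces of size \<open>r\<close> in \<open>V\<close>,
  triangularity makes this the rank of the coordinates of weight at least \<open>n\<close> on the
  chains supported on \<open>A\<close>. Being a rank, it drops only for exceptional
  parameters.\<close>

definition initial_rank :: "'a::linorder set \<Rightarrow> (nat \<Rightarrow> 'a \<Rightarrow> 'k::field) \<Rightarrow> nat \<Rightarrow> 'a set set \<Rightarrow> nat \<Rightarrow> nat" where
  "initial_rank V f r A n = card {T \<in> initial V f r A. n \<le> weight (card V) T}"

lemma finite_rank_drops:
  fixes f :: "nat \<Rightarrow> 'a::linorder \<Rightarrow> 'k::field"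
  assumes fin: "finite V" and gen: "generic_frame V f"
    and A: "\<And>F. F \<in> A \<Longrightarrow> F \<subseteq> V \<and> card F = r"
  shows "finite {l. generic_frame V (frame_shear j i l f) \<and>
    initial_rank V (frame_shear j i l f) r A n < initial_rank V f r A n}"
proof -
  define I where "I = {T \<in> initial V f r A. n \<le> weight (card V) T}"
  have finI: "finite I" by (simp add: I_def)
  obtain cc where cc: "\<And>T F. T \<in> initial V f r A \<Longrightarrow> cc T F \<noteq> 0 \<Longrightarrow> F \<in> A"
    "\<And>T. T \<in> initial V f r A \<Longrightarrow> coord V f T (cc T) \<noteq> 0"
    "\<And>T G. T \<in> initial V f r A \<Longrightarrow> G \<subseteq> {1..card V} \<Longrightarrow> card G = r \<Longrightarrow>
       weight (card V) T < weight (card V) G \<Longrightarrow> coord V f G (cc T) = 0"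
    using initial_witnesses[of V f r A] by metis
  define m1 where "m1 G T = (if finite G \<and> j \<in> G then coord V (f(j := f i)) G (cc T) else 0)" for G T
  have coord_shear: "coord V (frame_shear j i l f) G (cc T) = coord V f G (cc T) + l * m1 G T" for l G T
    by (simp add: coord_frame_shear m1_def)
  define bad where "bad = {l. \<exists>x. (\<exists>T\<in>I. x T \<noteq> 0) \<and> (\<forall>G\<in>I. (\<Sum>T\<in>I. (coord V f G (cc T) + l * m1 G T) * x T) = 0)}"
  have finbad: "finite bad" unfolding bad_def
  proof (rule finite_singular_parameters[OF finI])
    fix x assume "\<And>G. G \<in> I \<Longrightarrow> (\<Sum>T\<in>I. coord V f G (cc T) * x T) = 0"
    then show "\<forall>T\<in>I. x T = 0"
      using leading_coords_independent[OF finI, of V f r A cc x] cc by (auto simp: I_def)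
  qed
  have mem: "l \<in> bad"
    if gl: "generic_frame V (frame_shear j i l f)"
      and less: "initial_rank V (frame_shear j i l f) r A n < initial_rank V f r A n" for l
  proof -
    define f' where "f' = frame_shear j i l f"
    define I' where "I' = {T \<in> initial V f' r A. n \<le> weight (card V) T}"
    \<comment> \<open>If the shear leaves fewer leading sets, some nontrivial combination of the old
      witnesses has zero coordinates at all new ones of weight at least \<open>n\<close>. It then
      has no nonzero coordinate at a set in \<open>I\<close>, since its leading set would be one of
      these, and so the matrix of the old witnesses is singular for this \<open>l\<close>.\<close>
    have "card I' < card I" using less by (simp add: initial_rank_def I_def I'_def f'_def)
    then obtain x where x: "\<exists>T\<in>I. x T \<noteq> 0" "\<And>G. G \<in> I' \<Longrightarrow> (\<Sum>T\<in>I. coord V f' G (cc T) * x T) = 0"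
      by (rule homogeneous_system_nontrivial[OF finI, where m = "\<lambda>G T. coord V f' G (cc T)" and P = I', rotated])
        (auto simp: I'_def)
    define c where "c = (\<Sum>T\<in>I. sc (x T) (cc T))"
    have coord_c: "coord V f' G c = (\<Sum>T\<in>I. coord V f' G (cc T) * x T)" for G
      by (simp add: c_def coord_sum coord_linear mult.commute)
    have cA: "F \<in> A" if "c F \<noteq> 0" for F
    proof (rule ccontr)
      assume "F \<notin> A"
      then have "cc T F = 0" if "T \<in> I" for T using cc(1)[of T F] that by (auto simp: I_def)
      then show False using that by (simp add: c_def fun_sum_apply)
    qed
    have "coord V f' G c = 0" if G: "G \<in> I" for G
    proof (rule ccontr)
      assume nz: "coord V f' G c \<noteq> 0"
      have "G \<subseteq> {1..card V}" "card G = r" using G initial_sub[of G V f r A] by (auto simp: I_def)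
      then obtain T where T: "T \<in> initial V f' r A" "coord V f' T c \<noteq> 0" "weight (card V) G \<le> weight (card V) T"
        using exists_leading_coord[OF fin gl[folded f'_def] A cA _ _ nz] by blast
      then have "T \<in> I'" using G by (simp add: I_def I'_def)
      then show False using x(2) T(2) coord_c by simp
    qed
    then have "\<forall>G\<in>I. (\<Sum>T\<in>I. (coord V f G (cc T) + l * m1 G T) * x T) = 0"
      using coord_c unfolding f'_def coord_shear by simp
    then show ?thesis using x(1) unfolding bad_def by blast
  qed
  show ?thesis by (rule finite_subset[OF _ finbad]) (use mem in blast)
qed

definition index_shifted :: "nat set set \<Rightarrow> bool" where
  "index_shifted \<F> \<longleftrightarrow> (\<forall>T\<in>\<F>. \<forall>i\<in>T. \<forall>j. 1 \<le> j \<and> j < i \<and> j \<notin> T \<longrightarrow> insert j (T - {i}) \<in> \<F>)"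

lemma card_exchange:
  assumes "finite T" "i \<in> T" "j \<notin> T"
  shows "card (insert j (T - {i})) = card T"
  using assms card_Suc_Diff1[of T i] by simp

text \<open>The witness of \<open>T\<close> serves again. In the sheared frame the coordinate at a
  set containing \<open>j\<close> but not \<open>i\<close> gains \<open>l\<close> times the one at
  the set with \<open>j\<close> exchanged for \<open>i\<close>: at the new set this is the nonzero
  coordinate at \<open>T\<close>, and at heavier sets it is a coordinate heavier than
  \<open>T\<close>, hence zero.\<close>

lemma shear_gains_exchange:
  assumes T: "T \<in> initial V f r A" and ij: "i \<in> T" "j \<notin> T" "1 \<le> j" "j < i" and l: "l \<noteq> 0"
  shows "insert j (T - {i}) \<in> initial V (frame_shear j i l f) r A"
proof -
  define N where "N = card V"
  define T' where "T' = insert j (T - {i})"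
  have Ts: "T \<subseteq> {1..N}" "card T = r" using initial_sub[OF T] by (auto simp: N_def)
  have finT: "finite T" using Ts finite_subset by blast
  obtain c where c: "\<And>F. c F \<noteq> 0 \<Longrightarrow> F \<in> A" "coord V f T c \<noteq> 0"
    "\<And>G. G \<subseteq> {1..N} \<Longrightarrow> card G = r \<Longrightarrow> weight N T < weight N G \<Longrightarrow> coord V f G c = 0"
    using initialD[OF T] unfolding N_def by metis
  have iN: "i \<le> N" using Ts ij by auto
  have wT: "weight N T < weight N T'"
    unfolding T'_def by (rule weight_exchange_less[OF finT ij(1,2,4) iN])
  have T's: "T' \<subseteq> {1..N}" "card T' = r"
    using Ts ij iN card_exchange[OF finT ij(1,2)] unfolding T'_def by auto
  have swap: "insert i (T' - {j}) = T" using ij by (auto simp: T'_def)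
  have rep: "coord V (f(j := f i)) G c = 0"
    if G: "G \<subseteq> {1..N}" "card G = r" "weight N T' < weight N G" "j \<in> G" for G
  proof (cases "i \<in> G")
    case True
    have "finite G" using G finite_subset by blast
    then show ?thesis using coord_replaced(1)[of G j i V f c] G(4) True ij by simp
  next
    case False
    have finG: "finite G" using G finite_subset by blast
    define H where "H = insert i (G - {j})"
    \<comment> \<open>Exchanging \<open>j\<close> for \<open>i\<close> changes the weights of
      \<open>G\<close> and \<open>T'\<close> by the same amount, so \<open>H\<close> is still
      heavier than \<open>T\<close>.\<close>
    have "weight N H + 2 ^ (N - j) = weight N G + 2 ^ (N - i)"
      unfolding H_def by (rule weight_exchange[OF finG G(4) False])
    moreover have "weight N T + 2 ^ (N - j) = weight N T' + 2 ^ (N - i)"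
      using weight_exchange[of T' j i N] finT ij unfolding swap by (simp add: T'_def)
    ultimately have "weight N T < weight N H" using G(3) by linarith
    moreover have "H \<subseteq> {1..N}" "card H = r"
      using G(1,2) Ts ij iN card_exchange[OF finG G(4) False] unfolding H_def by auto
    ultimately have "coord V f H c = 0" by (intro c(3))
    then show ?thesis using coord_replaced(2)[OF finG G(4) False, of V f c] by (auto simp: H_def)
  qed
  have zero: "coord V (frame_shear j i l f) G c = 0"
    if G: "G \<subseteq> {1..N}" "card G = r" "weight N T' < weight N G" for G
    using rep[OF G] c(3)[OF G(1,2)] G(3) wT by (simp add: coord_frame_shear)
  have "coord V (frame_shear j i l f) T' c \<noteq> 0"
  proof -
    have "coord V f T' c = 0" using c(3)[OF T's wT] .
    moreover have "finite T'" "j \<in> T'" "i \<notin> T'" using finT ij by (auto simp: T'_def)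
    moreover have "coord V (f(j := f i)) T' c \<noteq> 0"
      using coord_replaced(2)[OF \<open>finite T'\<close> \<open>j \<in> T'\<close> \<open>i \<notin> T'\<close>, of V f c] c(2) unfolding swap by auto
    ultimately show ?thesis using l by (simp add: coord_frame_shear)
  qed
  then show ?thesis using T's zero c(1) unfolding initial_def T'_def[symmetric] N_def[symmetric] by blast
qed

text \<open>Take a generic frame whose total initial rank is maximal. A missing exchange of \<open>i\<close> for \<open>j < i\<close>
  would be gained by the shear \<open>f\<^sub>j + l f\<^sub>i\<close>, which for all but finitely many \<open>l\<close> lowers no rank.\<close>

lemma exists_shifting_frame:
  fixes A :: "nat \<Rightarrow> 'a::linorder set set"
  assumes fin: "finite V" and A: "\<And>x F. F \<in> A x \<Longrightarrow> F \<subseteq> V \<and> card F = r" and finJ: "finite J"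
  obtains f :: "nat \<Rightarrow> 'a \<Rightarrow> 'k::alg_closed_field" where
    "generic_frame V f" "\<And>x. x \<in> J \<Longrightarrow> index_shifted (initial V f r (A x))"
proof -
  define N where "N = card V"
  \<comment> \<open>One more than the largest possible weight, so that the rank at the successor of
    any weight is still among the summands.\<close>
  define M where "M = weight N {1..N} + 1"
  define \<Phi> where "\<Phi> f = (\<Sum>x\<in>J. \<Sum>n\<le>M. initial_rank V f r (A x) n)" for f :: "nat \<Rightarrow> 'a \<Rightarrow> 'k"
  have rank_le: "initial_rank V f r B n \<le> 2 ^ N" for f :: "nat \<Rightarrow> 'a \<Rightarrow> 'k" and B n
  proof -
    have "initial_rank V f r B n \<le> card (Pow {1..N})"
      unfolding initial_rank_def by (intro card_mono) (auto simp: N_def initial_def)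
    then show ?thesis by (simp add: card_Pow)
  qed
  have bound: "\<Phi> f \<le> card J * (card {..M} * 2 ^ N)" for f
  proof -
    have "(\<Sum>n\<le>M. initial_rank V f r (A x) n) \<le> card {..M} * 2 ^ N" for x
      using sum_bounded_above[of "{..M}" "initial_rank V f r (A x)" "2 ^ N"] rank_le by simp
    then show ?thesis unfolding \<Phi>_def
      using sum_bounded_above[of J "\<lambda>x. \<Sum>n\<le>M. initial_rank V f r (A x) n" "card {..M} * 2 ^ N"] by simp
  qed
  obtain f0 :: "nat \<Rightarrow> 'a \<Rightarrow> 'k" where f0: "generic_frame V f0"
    using exists_generic_frame[OF fin] by blast
  obtain f where f: "generic_frame V f" "\<And>g. generic_frame V g \<Longrightarrow> \<Phi> g \<le> \<Phi> f"
    using ex_has_greatest_nat[of "generic_frame V" f0 \<Phi> "Suc (card J * (card {..M} * 2 ^ N))"] f0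
      bound[THEN le_imp_less_Suc] by blast
  have "index_shifted (initial V f r (A x))" if x: "x \<in> J" for x
    unfolding index_shifted_def
  proof (intro ballI allI impI)
    fix T i j assume T: "T \<in> initial V f r (A x)" and i: "i \<in> T" and j: "1 \<le> j \<and> j < i \<and> j \<notin> T"
    define T' where "T' = insert j (T - {i})"
    show "insert j (T - {i}) \<in> initial V f r (A x)"
    proof (rule ccontr)
      assume nin: "insert j (T - {i}) \<notin> initial V f r (A x)"
      define bad where "bad = {l. \<not> generic_frame V (frame_shear j i l f)} \<union>
        (\<Union>y\<in>J. \<Union>n\<le>M. {l. generic_frame V (frame_shear j i l f) \<and>
          initial_rank V (frame_shear j i l f) r (A y) n < initial_rank V f r (A y) n})"
      have "finite bad" unfolding bad_def
        using finite_nongeneric_shears[OF fin f(1)] j finJ finite_rank_drops[OF fin f(1) A] by auto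
      then have "infinite (UNIV - (bad \<union> {0}))"
        using infinite_UNIV_alg_closed by (intro Diff_infinite_finite) auto
      then have "UNIV - (bad \<union> {0}) \<noteq> {}" by (rule infinite_imp_nonempty)
      then obtain l where l: "l \<notin> bad" "l \<noteq> 0" by blast
      define g where "g = frame_shear j i l f"
      have g: "generic_frame V g" using l by (simp add: bad_def g_def)
      have ge: "initial_rank V f r (A y) n \<le> initial_rank V g r (A y) n" if "y \<in> J" "n \<le> M" for y n
        using l(1) g that unfolding bad_def g_def by (auto simp: not_less)
      have T'g: "T' \<in> initial V g r (A x)"
        unfolding T'_def g_def using shear_gains_exchange[OF T i] j l by blast
      have T's: "T' \<subseteq> {1..N}" using initial_sub[OF T'g] by (simp add: N_def)
      \<comment> \<open>Only \<open>T'\<close> has this weight, so its presence is exactly the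
        difference between the ranks at \<open>n\<close> and at \<open>Suc n\<close>: zero for
        \<open>f\<close>, one for \<open>g\<close>.\<close>
      define n where "n = weight N T'"
      have "weight N T' \<le> weight N {1..N}"
        unfolding weight_def by (rule sum_mono2) (use T's in auto)
      then have nM: "Suc n \<le> M" by (simp add: n_def M_def)
      have split: "{T \<in> initial V h r (A x). n \<le> weight N T}
          = {T \<in> initial V h r (A x). Suc n \<le> weight N T} \<union> {T \<in> initial V h r (A x). T = T'}" for h :: "nat \<Rightarrow> 'a \<Rightarrow> 'k"
      proof -
        have eqT: "T = T'" if "T \<in> initial V h r (A x)" "weight N T = n" for T
          using weight_inj[of T N T'] that initial_sub[OF that(1)] T's by (simp add: n_def N_def)
        have "n \<le> weight N T \<longleftrightarrow> Suc n \<le> weight N T \<or> T = T'" if "T \<in> initial V h r (A x)" for T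
          using eqT[OF that] by (cases "weight N T = n") (auto simp: n_def)
        then show ?thesis by blast
      qed
      have empty: "{T \<in> initial V f r (A x). T = T'} = {}" using nin by (auto simp: T'_def)
      have "initial_rank V f r (A x) n = initial_rank V f r (A x) (Suc n)"
        unfolding initial_rank_def N_def[symmetric] split[of f] empty by simp
      also have "\<dots> \<le> initial_rank V g r (A x) (Suc n)" using ge[OF x nM] .
      also have "\<dots> < initial_rank V g r (A x) n"
        unfolding initial_rank_def N_def[symmetric]
      proof (rule psubset_card_mono)
        have "{T \<in> initial V g r (A x). Suc n \<le> weight N T} \<subseteq> {T \<in> initial V g r (A x). n \<le> weight N T}"
          by auto
        moreover have "T' \<in> {T \<in> initial V g r (A x). n \<le> weight N T}"
          "T' \<notin> {T \<in> initial V g r (A x). Suc n \<le> weight N T}"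
          using T'g by (auto simp: n_def)
        ultimately show "{T \<in> initial V g r (A x). Suc n \<le> weight N T} \<subset> {T \<in> initial V g r (A x). n \<le> weight N T}"
          by blast
      qed simp
      finally have "initial_rank V f r (A x) n < initial_rank V g r (A x) n" .
      moreover have "n \<in> {..M}" using nM by simp
      ultimately have "(\<Sum>n\<le>M. initial_rank V f r (A x) n) < (\<Sum>n\<le>M. initial_rank V g r (A x) n)"
        using ge[OF x] by (intro sum_strict_mono_ex1) auto
      then have "\<Phi> f < \<Phi> g" unfolding \<Phi>_def
        using ge x finJ by (intro sum_strict_mono_ex1) (auto intro!: sum_mono)
      then show False using f(2)[OF g] by simp
    qed
  qed
  then show thesis using that f(1) by blast
qed

section \<open>Products of chains\<close>

definition cross_sign :: "'a::linorder set \<Rightarrow> 'a set \<Rightarrow> 'k::field" where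
  "cross_sign F G = (\<Prod>v\<in>F. vsign v G)"

text \<open>The exterior product of two chains; \<open>cross_sign\<close> is the parity of the
  inversions between the two parts of a face.\<close>

definition chain_product :: "('a::linorder set \<Rightarrow> 'k::field) \<Rightarrow> ('a set \<Rightarrow> 'k) \<Rightarrow> 'a set \<Rightarrow> 'k" where
  "chain_product c x H = (\<Sum>F\<in>Pow H. cross_sign F (H - F) * c F * x (H - F))"

lemma vsign_Un:
  assumes "finite F" "finite G" "F \<inter> G = {}"
  shows "vsign v (F \<union> G) = vsign v F * (vsign v G :: 'k::field)"
proof -
  have "{u \<in> F \<union> G. u < v} = {u \<in> F. u < v} \<union> {u \<in> G. u < v}" by auto
  then have "card {u \<in> F \<union> G. u < v} = card {u \<in> F. u < v} + card {u \<in> G. u < v}"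
    using assms by (simp add: card_Un_disjoint disjoint_iff)
  then show ?thesis by (simp add: vsign_def power_add)
qed

lemma cross_sign_insert_right:
  assumes "finite F" "finite G" "v \<notin> F" "v \<notin> G"
  shows "cross_sign F (insert v G) = (-1) ^ card F * vsign v F * (cross_sign F G :: 'k::field)"
  using assms(1,3)
proof (induction F rule: finite_induct)
  case empty
  show ?case by (simp add: cross_sign_def vsign_def)
next
  case (insert u F)
  have "vsign u (insert v G) = (if v < u then - vsign u G else (vsign u G :: 'k))"
    by (rule vsign_insert[OF assms(2,4)])
  moreover have "vsign v (insert u F) = (if u < v then - vsign v F else (vsign v F :: 'k))"
    by (rule vsign_insert[OF insert.hyps])
  ultimately show ?case using insert by (cases u v rule: linorder_cases) (auto simp: cross_sign_def algebra_simps)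
qed

text \<open>The Leibniz rule. When \<open>v\<close> lies in \<open>H\<close> the left side is zero
  and the two sums on the right cancel termwise: each term is a signed product of coefficients at
  two faces that both contain \<open>v\<close>.\<close>

lemma vcontr_product:
  fixes c x :: "'a::linorder set \<Rightarrow> 'k::field"
  assumes c: "\<And>F. c F \<noteq> 0 \<Longrightarrow> card F = k"
  shows "vcontr v (chain_product c x) H
    = chain_product (vcontr v c) x H + (-1) ^ k * chain_product c (vcontr v x) H"
proof (cases "finite H")
  case False
  then have "\<not> finite (Pow H)" by simp
  then show ?thesis using False by (simp add: chain_product_def vcontr_def)
next
  case fin: True
  show ?thesis
  proof (cases "v \<in> H")
    case True
    have z1: "chain_product (vcontr v c) x H + (-1) ^ k * chain_product c (vcontr v x) H = 0"
    proof -
      have inj: "(\<Sum>F\<in>Pow H. cross_sign F (H - F) * vcontr v c F * x (H - F))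
        = (\<Sum>F\<in>Pow (H - {v}). cross_sign F (H - F) * vcontr v c F * x (H - F))"
        by (rule sum.mono_neutral_right) (use fin in \<open>auto simp: vcontr_def\<close>)
      have inj2: "(\<Sum>F\<in>Pow H. cross_sign F (H - F) * c F * vcontr v x (H - F))
        = (\<Sum>F\<in>insert v ` Pow (H - {v}). cross_sign F (H - F) * c F * vcontr v x (H - F))"
      proof (rule sum.mono_neutral_right)
        show "\<forall>F\<in>Pow H - insert v ` Pow (H - {v}). cross_sign F (H - F) * c F * vcontr v x (H - F) = 0"
        proof
          fix F assume F: "F \<in> Pow H - insert v ` Pow (H - {v})"
          have "v \<notin> F"
          proof
            assume "v \<in> F"
            then have "F = insert v (F - {v})" "F - {v} \<in> Pow (H - {v})" using F by auto
            then show False using F by blast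
          qed
          then show "cross_sign F (H - F) * c F * vcontr v x (H - F) = 0"
            using True by (simp add: vcontr_def)
        qed
      qed (use fin True in auto)
      have inj3: "(\<Sum>F\<in>insert v ` Pow (H - {v}). cross_sign F (H - F) * c F * vcontr v x (H - F))
        = (\<Sum>F\<in>Pow (H - {v}). cross_sign (insert v F) (H - insert v F) * c (insert v F) * vcontr v x (H - insert v F))"
        by (subst sum.reindex) (auto simp: inj_on_def)
      have "cross_sign F (H - F) * vcontr v c F * x (H - F)
        + (-1) ^ k * (cross_sign (insert v F) (H - insert v F) * c (insert v F) * vcontr v x (H - insert v F)) = 0"
        if F: "F \<in> Pow (H - {v})" for F
      proof (cases "c (insert v F) = 0")
        case True
        then show ?thesis by (simp add: vcontr_def)
      next
        case False
        have finF: "finite F" "v \<notin> F" "F \<subseteq> H" using F fin finite_subset by auto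
        have k: "k = Suc (card F)" using c[OF False] finF by simp
        define G where "G = H - insert v F"
        have G: "H - F = insert v G" "v \<notin> G" "finite G" using \<open>v \<in> H\<close> finF fin by (auto simp: G_def)
        have s1: "cross_sign F (insert v G) = (-1) ^ card F * vsign v F * (cross_sign F G :: 'k)"
          by (rule cross_sign_insert_right[OF finF(1) G(3) finF(2) G(2)])
        have s2: "cross_sign (insert v F) G = vsign v G * (cross_sign F G :: 'k)"
          using finF by (simp add: cross_sign_def)
        have x: "vcontr v c F = vsign v F * c (insert v F)" "vcontr v x G = vsign v G * x (insert v G)"
          using finF G by (auto simp: vcontr_def)
        have "(-1) ^ k * (-1) ^ card F = (-1 :: 'k)" by (simp add: k flip: power_add)
        then have kk: "(-1) ^ k = - ((-1) ^ card F :: 'k)" by (simp add: k)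
        have sq: "vsign v F * vsign v F = (1::'k)" "vsign v G * vsign v G = (1::'k)"
          using vsign_square[of v F 1] vsign_square[of v G 1] by simp_all
        have m1: "cross_sign F (H - F) * vcontr v c F * x (H - F)
          = (-1) ^ card F * cross_sign F G * c (insert v F) * x (insert v G) * (vsign v F * vsign v F)"
          unfolding G(1) s1 x by (simp add: algebra_simps)
        have m2: "cross_sign (insert v F) G * c (insert v F) * vcontr v x G
          = cross_sign F G * c (insert v F) * x (insert v G) * (vsign v G * vsign v G)"
          unfolding s2 x by (simp add: algebra_simps)
        show ?thesis unfolding G_def[symmetric] m1 m2 kk sq by (simp add: algebra_simps)
      qed
      then have "(\<Sum>F\<in>Pow (H - {v}). cross_sign F (H - F) * vcontr v c F * x (H - F)
        + (-1) ^ k * (cross_sign (insert v F) (H - insert v F) * c (insert v F) * vcontr v x (H - insert v F))) = 0"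
        by (intro sum.neutral) blast
      then show ?thesis unfolding chain_product_def inj inj2 inj3 by (simp add: sum.distrib sum_distrib_left)
    qed
    then show ?thesis using True by (simp add: vcontr_def)
  next
    case False
    define t where "t F = cross_sign F (insert v H - F) * c F * x (insert v H - F)" for F
    have Pow_eq: "Pow (insert v H) = Pow H \<union> insert v ` Pow H" by (rule Pow_insert)
    have disj: "Pow H \<inter> insert v ` Pow H = {}" using False by auto
    have "chain_product c x (insert v H) = (\<Sum>F\<in>Pow H. t F) + (\<Sum>F\<in>insert v ` Pow H. t F)"
      unfolding chain_product_def Pow_eq t_def by (rule sum.union_disjoint) (use fin disj in auto)
    also have "(\<Sum>F\<in>insert v ` Pow H. t F) = (\<Sum>F\<in>Pow H. t (insert v F))"
    proof -
      have "inj_on (insert v) (Pow H)"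
        by (rule inj_onI) (metis PowD False insert_ident subsetD)
      then show ?thesis by (simp add: sum.reindex)
    qed
    finally have split: "vcontr v (chain_product c x) H
        = (\<Sum>F\<in>Pow H. vsign v H * t F) + (\<Sum>F\<in>Pow H. vsign v H * t (insert v F))"
      using False fin by (simp add: vcontr_def sum_distrib_left distrib_left)
    have "vsign v H * t F = (-1) ^ k * (cross_sign F (H - F) * c F * vcontr v x (H - F))"
      "vsign v H * t (insert v F) = cross_sign F (H - F) * vcontr v c F * x (H - F)" if F: "F \<in> Pow H" for F
    proof -
      have finF: "finite F" "v \<notin> F" "F \<subseteq> H" using F fin False finite_subset by auto
      define G where "G = H - F"
      have G: "insert v H - F = insert v G" "insert v H - insert v F = G" "v \<notin> G" "finite G"
        using finF False fin by (auto simp: G_def)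
      have sH: "vsign v H = vsign v F * (vsign v G :: 'k)"
        using vsign_Un[of F G v] finF G by (simp add: G_def Un_absorb1)
      have sq: "vsign v F * vsign v F = (1::'k)" "vsign v G * vsign v G = (1::'k)"
        using vsign_square[of v F 1] vsign_square[of v G 1] by simp_all
      show "vsign v H * t F = (-1) ^ k * (cross_sign F (H - F) * c F * vcontr v x (H - F))"
      proof (cases "c F = 0")
        case True
        then show ?thesis by (simp add: t_def)
      next
        case False
        have "vsign v H * t F = (-1) ^ card F * (cross_sign F G * c F * (vsign v G * x (insert v G))) * (vsign v F * vsign v F)"
          unfolding t_def G(1) sH cross_sign_insert_right[OF finF(1) G(4) finF(2) G(3)] by (simp add: algebra_simps)
        then show ?thesis using c[OF False] G unfolding sq G_def[symmetric] by (simp add: vcontr_def)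
      qed
      have "cross_sign (insert v F) G = vsign v G * (cross_sign F G :: 'k)"
        using finF by (simp add: cross_sign_def)
      then have "vsign v H * t (insert v F)
        = cross_sign F G * (vsign v F * c (insert v F)) * x G * (vsign v G * vsign v G)"
        unfolding t_def G(2) sH by (simp add: algebra_simps)
      then show "vsign v H * t (insert v F) = cross_sign F (H - F) * vcontr v c F * x (H - F)"
        using finF unfolding sq G_def[symmetric] by (simp add: vcontr_def)
    qed
    then have "vcontr v (chain_product c x) H
      = (\<Sum>F\<in>Pow H. (-1) ^ k * (cross_sign F (H - F) * c F * vcontr v x (H - F)))
        + (\<Sum>F\<in>Pow H. cross_sign F (H - F) * vcontr v c F * x (H - F))"
      unfolding split by (intro arg_cong2[where f = "(+)"] sum.cong refl) blast+
    then show ?thesis by (simp add: chain_product_def sum_distrib_left add.commute)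
  qed
qed

lemma contr_product:
  fixes c x :: "'a::linorder set \<Rightarrow> 'k::field"
  assumes c: "\<And>F. c F \<noteq> 0 \<Longrightarrow> card F = k"
  shows "contr V g (chain_product c x)
    = chain_product (contr V g c) x + sc ((-1) ^ k) (chain_product c (contr V g x))"
proof
  fix H
  have "(\<Sum>v\<in>V. g v * chain_product (vcontr v c) x H) = chain_product (contr V g c) x H"
  proof -
    have "(\<Sum>v\<in>V. g v * chain_product (vcontr v c) x H)
      = (\<Sum>v\<in>V. \<Sum>F\<in>Pow H. cross_sign F (H - F) * (g v * vcontr v c F) * x (H - F))"
      by (simp add: chain_product_def sum_distrib_left algebra_simps)
    also have "\<dots> = chain_product (contr V g c) x H"
      by (subst sum.swap) (simp add: chain_product_def contr_def sum_distrib_left sum_distrib_right)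
    finally show ?thesis .
  qed
  moreover have "(\<Sum>v\<in>V. g v * chain_product c (vcontr v x) H) = chain_product c (contr V g x) H"
  proof -
    have "(\<Sum>v\<in>V. g v * chain_product c (vcontr v x) H)
      = (\<Sum>v\<in>V. \<Sum>F\<in>Pow H. cross_sign F (H - F) * c F * (g v * vcontr v x (H - F)))"
      by (simp add: chain_product_def sum_distrib_left algebra_simps)
    also have "\<dots> = chain_product c (contr V g x) H"
      by (subst sum.swap) (simp add: chain_product_def contr_def sum_distrib_left)
    finally show ?thesis .
  qed
  moreover have "contr V g (chain_product c x) H
    = (\<Sum>v\<in>V. g v * chain_product (vcontr v c) x H) + (-1) ^ k * (\<Sum>v\<in>V. g v * chain_product c (vcontr v x) H)"
  proof -
    have "vcontr v (chain_product c x) H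
      = chain_product (vcontr v c) x H + (-1) ^ k * chain_product c (vcontr v x) H" for v
      by (rule vcontr_product) (rule c)
    then show ?thesis
      unfolding contr_def[of V g "chain_product c x"] by (simp add: algebra_simps sum.distrib sum_distrib_left)
  qed
  ultimately show "contr V g (chain_product c x) H
    = (chain_product (contr V g c) x + sc ((-1) ^ k) (chain_product c (contr V g x))) H" by simp
qed

lemma chain_product_zero [simp]: "chain_product 0 x = 0" "chain_product c 0 = 0"
  by (auto simp: chain_product_def fun_eq_iff)

lemma contr_degree:
  assumes "\<And>F. c F \<noteq> 0 \<Longrightarrow> card F = Suc k" "contr V g c G \<noteq> 0"
  shows "card G = k"
proof -
  obtain u where "vcontr u c G \<noteq> 0"
    using assms(2) unfolding contr_def by (metis (no_types, lifting) mult_zero_right sum.neutral)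
  then have "u \<notin> G" "finite G" "c (insert u G) \<noteq> 0" by (auto simp: vcontr_def split: if_splits)
  then show ?thesis using assms(1)[of "insert u G"] by simp
qed

lemma contr_degree_0:
  assumes "\<And>F. c F \<noteq> 0 \<Longrightarrow> card F = 0"
  shows "contr V g c = 0"
proof
  fix G
  have "vcontr u c G = 0" for u using assms[of "insert u G"]
    by (cases "c (insert u G) = 0") (auto simp: vcontr_def)
  then show "contr V g c G = 0 G" by (simp add: contr_def)
qed

text \<open>The iterated Leibniz rule; the signs are irrelevant below.\<close>

lemma contrs_product:
  fixes c x :: "'a::linorder set \<Rightarrow> 'k::field"
  assumes "distinct L" "\<And>F. c F \<noteq> 0 \<Longrightarrow> card F = k"
  shows "\<exists>sg. (\<forall>S. sg S \<noteq> (0::'k)) \<and> contrs V f L (chain_product c x) {}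
    = (\<Sum>S\<in>Pow (set L). sg S * contrs V f (filter (\<lambda>i. i \<in> S) L) c {} * contrs V f (filter (\<lambda>i. i \<notin> S) L) x {})"
  using assms
proof (induction L arbitrary: c x k)
  case Nil
  show ?case by (intro exI[of _ "\<lambda>_. 1"]) (simp add: chain_product_def cross_sign_def)
next
  case (Cons i L)
  have iL: "i \<notin> set L" "distinct L" using Cons.prems by auto
  let ?c' = "contr V (f i) c" and ?x' = "contr V (f i) x"
  obtain sg1 where sg1: "\<forall>S. sg1 S \<noteq> (0::'k)" "contrs V f L (chain_product ?c' x) {}
    = (\<Sum>S\<in>Pow (set L). sg1 S * contrs V f (filter (\<lambda>i. i \<in> S) L) ?c' {} * contrs V f (filter (\<lambda>i. i \<notin> S) L) x {})"
  proof (cases k)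
    case 0
    then have "?c' = 0" using Cons.prems(2) by (intro contr_degree_0) auto
    then show ?thesis using that[of "\<lambda>_. 1"] by simp
  next
    case (Suc k')
    then have "\<And>F. ?c' F \<noteq> 0 \<Longrightarrow> card F = k'" using Cons.prems(2) contr_degree[of c k'] by blast
    then show ?thesis using Cons.IH[OF iL(2), of ?c' k' x] that by blast
  qed
  obtain sg2 where sg2: "\<forall>S. sg2 S \<noteq> (0::'k)" "contrs V f L (chain_product c ?x') {}
    = (\<Sum>S\<in>Pow (set L). sg2 S * contrs V f (filter (\<lambda>i. i \<in> S) L) c {} * contrs V f (filter (\<lambda>i. i \<notin> S) L) ?x' {})"
    using Cons.IH[OF iL(2), of c k ?x'] Cons.prems(2) by blast
  define sg where "sg S = (if i \<in> S then sg1 (S - {i}) else (-1) ^ k * sg2 S)" for S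
  have sg: "\<forall>S. sg S \<noteq> 0" using sg1(1) sg2(1) by (simp add: sg_def)
  define t where "t S = sg S * contrs V f (filter (\<lambda>j. j \<in> S) (i # L)) c {} * contrs V f (filter (\<lambda>j. j \<notin> S) (i # L)) x {}" for S
  have t1: "t (insert i S) = sg1 S * contrs V f (filter (\<lambda>i. i \<in> S) L) ?c' {} * contrs V f (filter (\<lambda>i. i \<notin> S) L) x {}"
    and t2: "t S = (-1) ^ k * (sg2 S * contrs V f (filter (\<lambda>i. i \<in> S) L) c {} * contrs V f (filter (\<lambda>i. i \<notin> S) L) ?x' {})"
    if S: "S \<in> Pow (set L)" for S
  proof -
    have iS: "i \<notin> S" using S iL by auto
    have "filter (\<lambda>j. j \<in> insert i S) L = filter (\<lambda>j. j \<in> S) L" "filter (\<lambda>j. j \<notin> insert i S) L = filter (\<lambda>j. j \<notin> S) L"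
      using iL by (auto intro!: filter_cong)
    then show "t (insert i S) = sg1 S * contrs V f (filter (\<lambda>i. i \<in> S) L) ?c' {} * contrs V f (filter (\<lambda>i. i \<notin> S) L) x {}"
      using iS by (simp add: t_def sg_def)
    show "t S = (-1) ^ k * (sg2 S * contrs V f (filter (\<lambda>i. i \<in> S) L) c {} * contrs V f (filter (\<lambda>i. i \<notin> S) L) ?x' {})"
      using iS by (simp add: t_def sg_def)
  qed
  have "contrs V f (i # L) (chain_product c x) {}
    = contrs V f L (chain_product ?c' x) {} + (-1) ^ k * contrs V f L (chain_product c ?x') {}"
  proof -
    have "contr V (f i) (chain_product c x) = chain_product ?c' x + sc ((-1) ^ k) (chain_product c ?x')"
      by (rule contr_product) (rule Cons.prems(2))
    then show ?thesis by (simp only: contrs.simps contrs_add contrs_sc plus_fun_apply sc_apply)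
  qed
  also have "\<dots> = (\<Sum>S\<in>Pow (set L). t (insert i S)) + (\<Sum>S\<in>Pow (set L). t S)"
    unfolding sg1(2) sg2(2) sum_distrib_left using t1 t2 by simp
  also have "\<dots> = (\<Sum>S\<in>insert i ` Pow (set L). t S) + (\<Sum>S\<in>Pow (set L). t S)"
  proof -
    have "inj_on (insert i) (Pow (set L))"
      by (rule inj_onI) (metis PowD iL(1) insert_ident subsetD)
    then show ?thesis by (simp add: sum.reindex)
  qed
  also have "\<dots> = (\<Sum>S\<in>Pow (set (i # L)). t S)"
    unfolding list.set Pow_insert using iL by (subst sum.union_disjoint) auto
  finally show ?case using sg unfolding t_def by blast
qed

text \<open>Faces of the two families are never disjoint, so the product of two witnesses is zero.
  Its coordinate at a disjoint union of leading sets is a signed sum over the splittings of this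
  union, and additivity of the weight leaves only the splitting into the two leading sets, whose
  term is nonzero.\<close>

lemma initial_cross_intersecting:
  fixes f :: "nat \<Rightarrow> 'a::linorder \<Rightarrow> 'k::field"
  assumes A: "\<And>F. F \<in> A \<Longrightarrow> card F = r" and B: "\<And>F. F \<in> B \<Longrightarrow> card F = r"
    and cross: "cross_intersecting A B"
    and T: "T \<in> initial V f r A" and T': "T' \<in> initial V f r B"
  shows "T \<inter> T' \<noteq> {}"
proof
  assume disj: "T \<inter> T' = {}"
  define N where "N = card V"
  obtain c where c: "\<And>F. c F \<noteq> 0 \<Longrightarrow> F \<in> A" "coord V f T c \<noteq> 0"
    "\<And>G. G \<subseteq> {1..N} \<Longrightarrow> card G = r \<Longrightarrow> weight N T < weight N G \<Longrightarrow> coord V f G c = 0"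
    using initialD[OF T] unfolding N_def by metis
  obtain x where x: "\<And>F. x F \<noteq> 0 \<Longrightarrow> F \<in> B" "coord V f T' x \<noteq> 0"
    "\<And>G. G \<subseteq> {1..N} \<Longrightarrow> card G = r \<Longrightarrow> weight N T' < weight N G \<Longrightarrow> coord V f G x = 0"
    using initialD[OF T'] unfolding N_def by metis
  have sub: "T \<subseteq> {1..N}" "card T = r" "T' \<subseteq> {1..N}" "card T' = r"
    using initial_sub[OF T] initial_sub[OF T'] by (auto simp: N_def)
  have fin: "finite T" "finite T'" using sub finite_subset by blast+
  have "chain_product c x = 0"
  proof
    fix H
    have eq: "c F * x (H - F) = 0" for F
    proof (rule ccontr)
      assume "c F * x (H - F) \<noteq> 0"
      then have "F \<in> A" "H - F \<in> B" using c(1) x(1) by auto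
      then show False using cross by (auto simp: cross_intersecting_def)
    qed
    show "chain_product c x H = 0 H"
      by (simp only: chain_product_def mult.assoc eq mult_zero_right sum.neutral_const zero_fun_apply)
  qed
  define L where "L = sorted_list_of_set (T \<union> T')"
  have L: "distinct L" "set L = T \<union> T'" using fin by (auto simp: L_def)
  obtain sg where sg: "\<forall>S. sg S \<noteq> (0::'k)" "contrs V f L (chain_product c x) {}
    = (\<Sum>S\<in>Pow (set L). sg S * contrs V f (filter (\<lambda>i. i \<in> S) L) c {} * contrs V f (filter (\<lambda>i. i \<notin> S) L) x {})"
    using contrs_product[OF L(1), of c r V f x] A c(1) by blast
  have vanish: "contrs V f (filter (\<lambda>i. i \<in> S) L) c {} * contrs V f (filter (\<lambda>i. i \<notin> S) L) x {} = 0"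
    if S: "S \<subseteq> T \<union> T'" "S \<noteq> T" for S
  proof (rule ccontr)
    define G where "G = (T \<union> T') - S"
    assume "\<not> ?thesis"
    moreover have "coord V f S c = contrs V f (filter (\<lambda>i. i \<in> S) L) c {}
        \<or> coord V f S c = - contrs V f (filter (\<lambda>i. i \<in> S) L) c {}"
      by (rule coord_list) (use L S in auto)
    moreover have "coord V f G x = contrs V f (filter (\<lambda>i. i \<notin> S) L) x {}
        \<or> coord V f G x = - contrs V f (filter (\<lambda>i. i \<notin> S) L) x {}"
      by (rule coord_list) (use L S in \<open>auto simp: G_def\<close>)
    ultimately have nz: "coord V f S c \<noteq> 0" "coord V f G x \<noteq> 0" by auto
    have finS: "finite S" "finite G" using S fin finite_subset by (auto simp: G_def)
    \<comment> \<open>Coordinates at sets of the wrong size vanish, so both parts of a surviving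
      splitting have size \<open>r\<close>.\<close>
    have deg: "coord V f S c = 0" if "card S \<noteq> r" "finite S" "\<And>F. c F \<noteq> 0 \<Longrightarrow> card F = r" for S and c :: "'a set \<Rightarrow> 'k"
    proof -
      have "contrs V f L c {} = 0" if "length L \<noteq> r" "\<And>F. c F \<noteq> 0 \<Longrightarrow> card F = r" for L r and c :: "'a set \<Rightarrow> 'k"
        using that
      proof (induction L arbitrary: c r)
        case Nil
        then show ?case by fastforce
      next
        case (Cons i L)
        show ?case
        proof (cases r)
          case 0
          then have "contr V (f i) c = 0" using Cons.prems(2) by (intro contr_degree_0) auto
          then show ?thesis by simp
        next
          case (Suc r')
          have "\<And>F. contr V (f i) c F \<noteq> 0 \<Longrightarrow> card F = r'" using Cons.prems(2) Suc contr_degree[of c r'] by blast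
          then show ?thesis using Cons.IH[of r' "contr V (f i) c"] Cons.prems(1) Suc by simp
        qed
      qed
      then show ?thesis using that unfolding coord_def by simp
    qed
    have cr: "card S = r" "card G = r"
      using deg[of S c] deg[of G x] nz finS A B c(1) x(1) by blast+
    have sub': "S \<subseteq> {1..N}" "G \<subseteq> {1..N}" using S sub by (auto simp: G_def)
    have le: "weight N S \<le> weight N T" "weight N G \<le> weight N T'"
      using c(3)[OF sub'(1) cr(1)] x(3)[OF sub'(2) cr(2)] nz by (auto simp: not_less[symmetric])
    have "weight N S + weight N G = weight N (S \<union> G)"
      by (rule weight_Un[symmetric]) (use finS in \<open>auto simp: G_def\<close>)
    also have "S \<union> G = T \<union> T'" using S by (auto simp: G_def)
    also have "weight N (T \<union> T') = weight N T + weight N T'" by (rule weight_Un[OF fin disj])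
    finally have "weight N S = weight N T" using le by linarith
    then show False using weight_inj[OF sub'(1) sub(1)] S by blast
  qed
  have "contrs V f L (chain_product c x) {}
    = (\<Sum>S\<in>Pow (set L). if S = T then sg T * contrs V f (filter (\<lambda>i. i \<in> T) L) c {} * contrs V f (filter (\<lambda>i. i \<notin> T) L) x {} else 0)"
    unfolding sg(2) by (rule sum.cong[OF refl]) (use vanish L in \<open>auto simp: mult.assoc\<close>)
  also have "\<dots> = sg T * contrs V f (filter (\<lambda>i. i \<in> T) L) c {} * contrs V f (filter (\<lambda>i. i \<notin> T) L) x {}"
    using L(2) fin by simp
  finally have "sg T * contrs V f (filter (\<lambda>i. i \<in> T) L) c {} * contrs V f (filter (\<lambda>i. i \<notin> T) L) x {} = 0"
    using \<open>chain_product c x = 0\<close> by simp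
  moreover have "coord V f T c = contrs V f (filter (\<lambda>i. i \<in> T) L) c {}
      \<or> coord V f T c = - contrs V f (filter (\<lambda>i. i \<in> T) L) c {}"
    by (rule coord_list) (use L in auto)
  moreover have "coord V f T' x = contrs V f (filter (\<lambda>i. i \<notin> T) L) x {}
      \<or> coord V f T' x = - contrs V f (filter (\<lambda>i. i \<notin> T) L) x {}"
    by (rule coord_list) (use L disj in auto)
  ultimately show False using sg(1) c(2) x(2) by auto
qed

section \<open>Leading monomials of deep complexes\<close>

definition faces :: "'a set set \<Rightarrow> nat \<Rightarrow> 'a set set" where
  "faces \<Gamma> k = {F \<in> \<Gamma>. card F = k}"

lemma in_chain_space_faces: "c \<in> chain_space \<Gamma> k \<longleftrightarrow> (\<forall>F. c F \<noteq> 0 \<longrightarrow> F \<in> faces \<Gamma> k)"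
  by (simp add: in_chains_iff faces_def)

lemma initial_facesD:
  assumes "T \<in> initial V f k (faces \<Gamma> k)"
  obtains c where "c \<in> chain_space \<Gamma> k" "coord V f T c \<noteq> 0"
    "\<And>G. G \<subseteq> {1..card V} \<Longrightarrow> card G = k \<Longrightarrow> weight (card V) T < weight (card V) G \<Longrightarrow> coord V f G c = 0"
  using initialD[OF assms] unfolding in_chain_space_faces by metis

lemma initial_facesI:
  assumes "T \<subseteq> {1..card V}" "card T = k" "c \<in> chain_space \<Gamma> k" "coord V f T c \<noteq> 0"
    "\<And>G. G \<subseteq> {1..card V} \<Longrightarrow> card G = k \<Longrightarrow> weight (card V) T < weight (card V) G \<Longrightarrow> coord V f G c = 0"
  shows "T \<in> initial V f k (faces \<Gamma> k)"
  using assms unfolding initial_def in_chain_space_faces by blast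

lemma contr_contrs_member:
  assumes "i \<in> set L"
  shows "contr V (f i) (contrs V f L c) = 0"
proof -
  have "contrs V f L (contr V (f i) c) = 0"
    using contrs_not_distinct[of "i # L" V f c] assms by simp
  then show ?thesis using contr_contrs[of V f i L c] by (metis minus_zero)
qed

lemma coord_zero_of_contr_zero:
  assumes "contr V (f i) c = 0" "i \<in> T" "finite T"
  shows "coord V f T c = 0"
  using coord_insert[of "T - {i}" i V f c] assms by (simp add: insert_absorb coord_linear)

text \<open>Contract a witness by \<open>f 1, ..., f (j - 1)\<close>. The result \<open>c0\<close>
  is also killed by \<open>f j\<close>, since otherwise the witness would have a nonzero coordinate
  at a heavier set containing \<open>{1..j}\<close>. Exactness then lifts \<open>c0\<close> through
  \<open>j\<close> contractions instead of \<open>j - 1\<close>, to a chain one degree higher whose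
  coordinates at sets containing \<open>{1..j}\<close> are, up to sign, those of the witness with
  \<open>j\<close> removed.\<close>

lemma initial_insert_prefix:
  fixes f :: "nat \<Rightarrow> 'a::linorder \<Rightarrow> 'k::alg_closed_field"
  assumes fin: "finite V" and d: "deep TYPE('k) V d \<Gamma>" and gen: "generic_frame V f"
    and T: "T \<in> initial V f k (faces \<Gamma> k)" and j: "{1..<j} \<subseteq> T" "j \<notin> T" "1 \<le> j" "j \<le> card V"
    and kd: "k < d"
  shows "insert j T \<in> initial V f (Suc k) (faces \<Gamma> (Suc k))"
proof -
  define N where "N = card V"
  note sc = deepD(1)[OF d]
  have \<Gamma>V: "F \<subseteq> V" if "F \<in> \<Gamma>" for F using deepD(2)[OF d] that by blast
  have Ts: "T \<subseteq> {1..N}" "card T = k" using initial_sub[OF T] by (auto simp: N_def)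
  have finT: "finite T" using Ts finite_subset by blast
  obtain c where c: "c \<in> chain_space \<Gamma> k" "coord V f T c \<noteq> 0"
    "\<And>G. G \<subseteq> {1..N} \<Longrightarrow> card G = k \<Longrightarrow> weight N T < weight N G \<Longrightarrow> coord V f G c = 0"
    using initial_facesD[OF T] unfolding N_def by metis
  have "card {1..<j} \<le> k" using card_mono[OF finT j(1)] Ts(2) by simp
  then obtain m where m: "k = (j - 1) + m" using le_iff_add by auto
  define c0 where "c0 = contrs V f [1..<j] c"
  have c0: "c0 \<in> chain_space \<Gamma> m"
    unfolding c0_def using c(1) m by (intro contrs_chains[OF sc]) simp
  have kill: "contr V (f i) c0 = 0" if "i \<in> {1..<j}" for i
    unfolding c0_def by (rule contr_contrs_member) (use that in auto)
  have killj: "contr V (f j) c0 = 0"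
  proof (rule ccontr)
    assume nz: "contr V (f j) c0 \<noteq> 0"
    obtain m' where m': "m = Suc m'"
      using nz c0 contr_chains_0[of c0 \<Gamma> V "f j"] by (cases m) auto
    have "contr V (f j) c0 \<in> chain_space \<Gamma> m'" using c0 m' by (intro contr_chains[OF sc]) simp
    then have sup: "F \<subseteq> V \<and> card F = m'" if "contr V (f j) c0 F \<noteq> 0" for F
      using that \<Gamma>V by (auto simp: in_chains_iff)
    obtain G where G: "G \<subseteq> {1..card V}" "card G = m'" "coord V f G (contr V (f j) c0) \<noteq> 0"
      by (rule exists_nonzero_coord[OF fin gen nz sup])
    have finG: "finite G" using G finite_subset by blast
    have jG: "j \<notin> G" using coord_contr_same[OF finG, of j V f c0] G(3) by auto
    have disj: "{1..<j} \<inter> insert j G = {}"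
    proof -
      have "i \<notin> G" if i: "i \<in> {1..<j}" for i
      proof
        assume "i \<in> G"
        moreover have "contr V (f i) (contr V (f j) c0) = 0"
          by (subst contr_swap) (simp add: kill[OF i])
        ultimately show False using coord_zero_of_contr_zero[of V f i "contr V (f j) c0" G] finG G(3) by blast
      qed
      then show ?thesis by auto
    qed
    define H where "H = {1..<j} \<union> insert j G"
    have "coord V f H c \<noteq> 0"
      using coord_Un[of "{1..<j}" "insert j G" V f c] disj finG coord_insert[OF finG jG, of V f c0] G(3)
      unfolding H_def c0_def by auto
    moreover have "H \<subseteq> {1..N}" using G(1) j by (auto simp: H_def N_def)
    moreover have "card H = k"
      unfolding H_def using disj finG jG G(2) m m' by (subst card_Un_disjoint) auto
    moreover have "weight N T < weight N H"
      by (rule weight_prefix_less[of _ _ _ j]) (use Ts \<open>H \<subseteq> {1..N}\<close> j in \<open>auto simp: H_def\<close>)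
    ultimately show False using c(3) by blast
  qed
  \<comment> \<open>The contractions are undone from \<open>f j\<close> down to \<open>f 1\<close>,
    and each lift stays in the kernel of those still to be undone. Degree plus number of functionals
    is always \<open>m + j = Suc k\<close>, so \<open>k < d\<close> is exactly the budget
    required.\<close>
  have lift: "\<exists>c'\<in>chain_space \<Gamma> (m + n). (\<forall>i\<in>{1..j - n}. contr V (f i) c' = 0)
      \<and> contrs V f [Suc (j - n)..<Suc j] c' = c0" if "n \<le> j" for n
    using that
  proof (induction n)
    case 0
    have "contr V (f i) c0 = 0" if "i \<in> {1..j}" for i
      using kill[of i] killj that by (cases "i = j") auto
    then show ?case using c0 by auto
  next
    case (Suc n)
    then obtain c1 where c1: "c1 \<in> chain_space \<Gamma> (m + n)" "\<forall>i\<in>{1..j - n}. contr V (f i) c1 = 0"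
      "contrs V f [Suc (j - n)..<Suc j] c1 = c0" by auto
    define p where "p = j - Suc n"
    have p: "j - n = Suc p" "p < j" using Suc.prems by (auto simp: p_def)
    have "generic_flag V 0 (map f [1..<Suc (Suc p)])"
      by (rule generic_frame_flag[OF gen]) (use p j in simp)
    then have fl: "generic_flag V 0 (map f [1..<Suc p] @ [f (Suc p)])" by simp
    have "\<exists>c'\<in>chain_space \<Gamma> (Suc (m + n)). (\<forall>h\<in>set (map f [1..<Suc p]). contr V h c' = 0)
        \<and> contr V (f (Suc p)) c' = c1"
    proof (rule contraction_exact[OF fin d fl _ c1(1)])
      show "m + n + Suc (length (map f [1..<Suc p])) + 0 \<le> d"
      proof -
        have "n + Suc p = j" using p Suc.prems by simp
        moreover have "length (map f [1..<Suc p]) = p" by (simp del: upt_Suc)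
        ultimately show ?thesis using m kd j(3) by linarith
      qed
      show "contr V h c1 = 0" if "h \<in> set (map f [1..<Suc p])" for h using that c1(2) p by auto
      show "contr V (f (Suc p)) c1 = 0" using c1(2) p by auto
    qed
    then obtain c' where c': "c' \<in> chain_space \<Gamma> (Suc (m + n))"
      "\<forall>h\<in>set (map f [1..<Suc p]). contr V h c' = 0" "contr V (f (Suc p)) c' = c1" by blast
    have "[Suc p..<Suc j] = Suc p # [Suc (Suc p)..<Suc j]" using p by (subst upt_conv_Cons) auto
    then have "contrs V f [Suc p..<Suc j] c' = c0" using c1(3) p c'(3) by simp
    moreover have "\<forall>i\<in>{1..p}. contr V (f i) c' = 0" using c'(2) by auto
    ultimately show ?case using c'(1) unfolding p_def[symmetric] by (intro bexI[of _ c']) auto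
  qed
  from lift[of j] obtain c' where c': "c' \<in> chain_space \<Gamma> (m + j)" "contrs V f [1..<Suc j] c' = c0"
    by auto
  have Sk: "m + j = Suc k" using m j by simp
  have coord': "coord V f G c' = coord V f (G - {j}) c \<or> coord V f G c' = - coord V f (G - {j}) c"
    if G: "{1..j} \<subseteq> G" "finite G" for G
  proof -
    define R where "R = G - {1..<Suc j}"
    have R: "finite R" "{1..<Suc j} \<union> R = G" "{1..<Suc j} \<inter> R = {}" "{1..<j} \<union> R = G - {j}" "{1..<j} \<inter> R = {}"
      using G j by (auto simp: R_def)
    have "coord V f G c' = coord V f R c0 \<or> coord V f G c' = - coord V f R c0"
      using coord_Un[of "{1..<Suc j}" R V f c'] R c'(2) by (simp del: upt_Suc)
    moreover have "coord V f (G - {j}) c = coord V f R c0 \<or> coord V f (G - {j}) c = - coord V f R c0"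
      using coord_Un[of "{1..<j}" R V f c] R by (simp add: c0_def)
    ultimately show ?thesis by auto
  qed
  have jT: "{1..j} \<subseteq> insert j T" using j by (auto simp: subset_iff)
  show ?thesis
  proof (rule initial_facesI)
    show "insert j T \<subseteq> {1..card V}" "card (insert j T) = Suc k" using Ts j finT by (auto simp: N_def)
    show "c' \<in> chain_space \<Gamma> (Suc k)" using c' Sk by simp
    have eqT: "insert j T - {j} = T" using j by auto
    have "coord V f (insert j T) c' = coord V f T c \<or> coord V f (insert j T) c' = - coord V f T c"
      using coord'[OF jT] finT unfolding eqT by simp
    then show "coord V f (insert j T) c' \<noteq> 0" using c(2) by (metis neg_equal_0_iff_equal)
    fix G assume G: "G \<subseteq> {1..card V}" "card G = Suc k" "weight (card V) (insert j T) < weight (card V) G"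
    have finG: "finite G" using G finite_subset by blast
    have jG: "{1..j} \<subseteq> G"
    proof (rule ccontr)
      assume "\<not> {1..j} \<subseteq> G"
      then have "weight N G < weight N (insert j T)"
        using G(1) Ts j jT by (intro weight_prefix_less[of _ _ _ j]) (auto simp: N_def)
      then show False using G(3) by (simp add: N_def)
    qed
    then have "j \<in> G" using j by auto
    then have "weight N G = 2 ^ (N - j) + weight N (G - {j})"
      using weight_insert[of "G - {j}" j N] finG by (simp add: insert_absorb)
    moreover have "weight N (insert j T) = 2 ^ (N - j) + weight N T" using finT j by (simp add: weight_insert)
    ultimately have "weight N T < weight N (G - {j})" using G(3) by (simp add: N_def)
    then have "coord V f (G - {j}) c = 0"
      using G finG \<open>j \<in> G\<close> by (intro c(3)) (auto simp: N_def)
    then show "coord V f G c' = 0" using coord'[OF jG finG] by auto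
  qed
qed

lemma initial_union_prefix:
  fixes f :: "nat \<Rightarrow> 'a::linorder \<Rightarrow> 'k::alg_closed_field"
  assumes fin: "finite V" and d: "deep TYPE('k) V d \<Gamma>" and gen: "generic_frame V f"
    and T: "T \<in> initial V f k (faces \<Gamma> k)"
  shows "t \<le> card V \<Longrightarrow> card (T \<union> {1..t}) \<le> d \<Longrightarrow>
    T \<union> {1..t} \<in> initial V f (card (T \<union> {1..t})) (faces \<Gamma> (card (T \<union> {1..t})))"
proof (induction t)
  case 0
  then show ?case using T initial_sub[OF T] by simp
next
  case (Suc t)
  define U where "U = T \<union> {1..t}"
  have finT: "finite T" using initial_sub[OF T] finite_subset by blast
  then have finU: "finite U" by (simp add: U_def)
  have eq: "T \<union> {1..Suc t} = insert (Suc t) U" by (auto simp: U_def)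
  have "card U \<le> card (insert (Suc t) U)" using finU by (intro card_mono) auto
  then have IH: "U \<in> initial V f (card U) (faces \<Gamma> (card U))"
    using Suc eq unfolding U_def by simp
  show ?case
  proof (cases "Suc t \<in> U")
    case True
    then show ?thesis using IH unfolding eq by (simp add: insert_absorb)
  next
    case False
    have "insert (Suc t) U \<in> initial V f (Suc (card U)) (faces \<Gamma> (Suc (card U)))"
      using False Suc.prems finU unfolding eq
      by (intro initial_insert_prefix[OF fin d gen IH]) (auto simp: U_def)
    then show ?thesis using False finU unfolding eq by simp
  qed
qed

text \<open>Contract a witness by \<open>f x\<close>: coordinates at sets containing
  \<open>x\<close> vanish, and the others are, up to sign, those of the witness at the set with
  \<open>x\<close> added.\<close>

lemma initial_remove:
  assumes sc: "simplicial_complex \<Gamma>" and T: "T \<in> initial V f k (faces \<Gamma> k)" and x: "x \<in> T"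
  shows "T - {x} \<in> initial V f (k - 1) (faces \<Gamma> (k - 1))"
proof -
  have Ts: "T \<subseteq> {1..card V}" "card T = k" using initial_sub[OF T] by auto
  have finT: "finite T" using Ts finite_subset by blast
  obtain k' where k': "k = Suc k'" using Ts finT x by (metis card_0_eq empty_iff not0_implies_Suc)
  obtain c where c: "c \<in> chain_space \<Gamma> k" "coord V f T c \<noteq> 0"
    "\<And>G. G \<subseteq> {1..card V} \<Longrightarrow> card G = k \<Longrightarrow> weight (card V) T < weight (card V) G \<Longrightarrow> coord V f G c = 0"
    using initial_facesD[OF T] by metis
  show ?thesis
  proof (rule initial_facesI)
    show "T - {x} \<subseteq> {1..card V}" "card (T - {x}) = k - 1" using Ts x finT by auto
    show "contr V (f x) c \<in> chain_space \<Gamma> (k - 1)" using contr_chains[OF sc] c(1) k' by simp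
    show "coord V f (T - {x}) (contr V (f x) c) \<noteq> 0"
      using coord_insert[of "T - {x}" x V f c] finT x c(2) by (auto simp: insert_absorb)
    fix G assume G: "G \<subseteq> {1..card V}" "card G = k - 1" "weight (card V) (T - {x}) < weight (card V) G"
    have finG: "finite G" using G finite_subset by blast
    show "coord V f G (contr V (f x) c) = 0"
    proof (cases "x \<in> G")
      case True
      then show ?thesis using coord_contr_same[OF finG] by blast
    next
      case False
      have "weight (card V) T = 2 ^ (card V - x) + weight (card V) (T - {x})"
        using weight_insert[of "T - {x}" x "card V"] finT x by (simp add: insert_absorb)
      then have "weight (card V) T < weight (card V) (insert x G)"
        using G(3) finG False by (simp add: weight_insert)
      then have "coord V f (insert x G) c = 0"
        using G finG False Ts x k' by (intro c(3)) auto
      then show ?thesis using coord_insert[OF finG False, of V f c] by auto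
    qed
  qed
qed

lemma initial_subset:
  assumes sc: "simplicial_complex \<Gamma>" and T: "T \<in> initial V f k (faces \<Gamma> k)" and S: "S \<subseteq> T"
  shows "S \<in> initial V f (card S) (faces \<Gamma> (card S))"
  using assms(2,3)
proof (induction "card (T - S)" arbitrary: T k)
  case 0
  have "finite T" using initial_sub[OF 0(2)] finite_subset by blast
  then have "T = S" using 0 by (metis Diff_eq_empty_iff card_0_eq finite_Diff subset_antisym)
  then show ?case using 0 initial_sub[OF 0(2)] by simp
next
  case (Suc n)
  have finT: "finite T" using initial_sub[OF Suc(3)] finite_subset by blast
  have "T - S \<noteq> {}" using Suc(2) by force
  then obtain x where x: "x \<in> T" "x \<notin> S" by blast
  have "card (T - {x} - S) = n"
    using Suc(2) x finT by (metis Diff_iff Diff_insert Diff_insert2 card_Diff_singleton diff_Suc_1 insert_is_Un)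
  then show ?case using Suc(1)[of "T - {x}" "k - 1"] initial_remove[OF sc Suc(3) x(1)] x Suc(4) by auto
qed

text \<open>Contracting the face \<open>W \<union> S\<close> by \<open>f 1, ..., f r\<close> gives
  an \<open>r\<close>-chain killed by all of these functionals, so nonzero combinations of such
  chains have leading sets disjoint from \<open>{1..r}\<close>. The chains are independent, because
  the coefficient at \<open>S\<close> is, up to sign, the nonzero determinant of the first
  \<open>r\<close> functionals on \<open>W\<close>.\<close>

lemma card_avoiding_prefix:
  fixes f :: "nat \<Rightarrow> 'a::linorder \<Rightarrow> 'k::field"
  assumes fin: "finite V" and gen: "generic_frame V f"
    and sc: "simplicial_complex \<Gamma>" and \<Gamma>V: "\<Union>\<Gamma> \<subseteq> V" and W: "W \<subseteq> V" "card W = r"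
  shows "card {S. card S = r \<and> S \<inter> W = {} \<and> W \<union> S \<in> \<Gamma>}
    \<le> card {T \<in> initial V f r (faces \<Gamma> r). T \<inter> {1..r} = {}}"
proof (rule ccontr)
  define L where "L = {S. card S = r \<and> S \<inter> W = {} \<and> W \<union> S \<in> \<Gamma>}"
  define D where "D = {T \<in> initial V f r (faces \<Gamma> r). T \<inter> {1..r} = {}}"
  assume "\<not> ?thesis"
  then have less: "card D < card L" by (simp add: L_def D_def)
  have LV: "S \<subseteq> V" if "S \<in> L" for S using that \<Gamma>V by (auto simp: L_def)
  have finL: "finite L" by (rule finite_subset[of _ "Pow V"]) (use LV fin in auto)
  have finD: "finite D" by (simp add: D_def)
  have finW: "finite W" using W fin finite_subset by blast
  define z where "z S = contrs V f [1..<Suc r] (face_chain (W \<union> S))" for S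
  have cardWS: "card (W \<union> S) = r + r" if "S \<in> L" for S
  proof -
    have "finite S" using LV[OF that] fin finite_subset by blast
    then have "card (W \<union> S) = card W + card S" using that finW by (intro card_Un_disjoint) (auto simp: L_def)
    then show ?thesis using that W by (simp add: L_def)
  qed
  have z\<Gamma>: "z S \<in> chain_space \<Gamma> r" if "S \<in> L" for S
  proof -
    have "face_chain (W \<union> S) \<in> chain_space \<Gamma> (length [1..<Suc r] + r)"
      using that cardWS[OF that] by (auto simp: in_chains_iff face_chain_def L_def)
    then show ?thesis unfolding z_def by (rule contrs_chains[OF sc])
  qed
  have zsub: "z S F = 0" if "S \<in> L" "\<not> F \<subseteq> W \<union> S" for S F
  proof -
    have fin': "finite (W \<union> S)" using LV[OF that(1)] fin finW finite_subset by blast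
    have "simplicial_complex (Pow (W \<union> S))" using fin' by (auto simp: simplicial_complex_def)
    moreover have "face_chain (W \<union> S) \<in> chain_space (Pow (W \<union> S)) (length [1..<Suc r] + r)"
      using cardWS[OF that(1)] by (auto simp: in_chains_iff face_chain_def)
    ultimately have "z S \<in> chain_space (Pow (W \<union> S)) r" unfolding z_def by (rule contrs_chains)
    then show ?thesis using that(2) by (auto simp: in_chains_iff)
  qed
  have zkill: "contr V (f i) (z S) = 0" if "i \<in> {1..r}" for i S
    unfolding z_def by (rule contr_contrs_member) (use that in auto)
  have zdiag: "z S S \<noteq> 0" if S: "S \<in> L" for S
  proof -
    have "\<exists>is. set is \<subseteq> {1..r} \<and> length is = r \<and> contrs V f is (face_chain (W \<union> S)) S \<noteq> 0"
    proof (rule exists_nonzero_contrs[OF fin _ W(1) LV[OF S]])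
      show "W \<inter> S = {}" using S by (auto simp: L_def)
      show "\<exists>a. \<forall>u\<in>W. (\<Sum>i\<in>{1..r}. a i * f i u) = (if u = w then 1 else 0)" if "w \<in> W" for w
        using generic_frame_dual[OF fin gen W(1) that] W(2) by simp
      show "face_chain (W \<union> S) \<noteq> (0 :: 'a set \<Rightarrow> 'k)"
        by (auto simp: fun_eq_iff face_chain_def)
      show "S \<subseteq> F \<and> F \<subseteq> W \<union> S \<and> card F = card S + r" if "face_chain (W \<union> S) F \<noteq> (0::'k)" for F
        using that cardWS[OF S] S by (auto simp: face_chain_def L_def split: if_splits)
    qed simp
    then obtain "is" where is': "set is \<subseteq> {1..r}" "length is = r" "contrs V f is (face_chain (W \<union> S)) S \<noteq> 0"
      by blast
    then have dis: "distinct is" using contrs_not_distinct[of "is" V f] by fastforce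
    then have "card (set is) = card {1..r}" using is' by (simp add: distinct_card)
    then have "set is = {1..r}" using is'(1) by (intro card_subset_eq) auto
    then have "set is = set [1..<Suc r]" by (simp only: set_upt atLeastLessThanSuc_atLeastAtMost)
    then have "mset is = mset [1..<Suc r]"
      using set_eq_iff_mset_eq_distinct[OF dis distinct_upt] by blast
    from contrs_permute[OF this, of V f "face_chain (W \<union> S)"] show ?thesis
      using is'(3) unfolding z_def by auto
  qed
  obtain x where x: "\<exists>S\<in>L. x S \<noteq> 0" "\<And>T. T \<in> D \<Longrightarrow> (\<Sum>S\<in>L. coord V f T (z S) * x S) = 0"
    by (rule homogeneous_system_nontrivial[OF finL finD less, where m = "\<lambda>T S. coord V f T (z S)"]) blast
  define y where "y = (\<Sum>S\<in>L. sc (x S) (z S))"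
  obtain S where S: "S \<in> L" "x S \<noteq> 0" using x(1) by blast
  have "y S = (\<Sum>S'\<in>L. if S' = S then x S * z S S else 0)"
    unfolding y_def fun_sum_apply
  proof (rule sum.cong[OF refl])
    fix S' assume S': "S' \<in> L"
    show "sc (x S') (z S') S = (if S' = S then x S * z S S else 0)"
    proof (cases "S' = S")
      case False
      \<comment> \<open>Both \<open>S\<close> and \<open>S'\<close> are \<open>r\<close>-sets
        outside \<open>W\<close>, so inclusion would force equality; restricted to faces in
        \<open>L\<close>, the family \<open>z\<close> is diagonal.\<close>
      have "\<not> S \<subseteq> W \<union> S'"
      proof
        assume "S \<subseteq> W \<union> S'"
        then have "S \<subseteq> S'" using S by (auto simp: L_def)
        moreover have "finite S'" using LV[OF S'] fin finite_subset by blast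
        ultimately show False using False S S' card_subset_eq[of S' S] by (auto simp: L_def)
      qed
      then show ?thesis using False zsub[OF S'] by simp
    qed simp
  qed
  then have "y S \<noteq> 0" using S finL zdiag[OF S(1)] by simp
  then have y0: "y \<noteq> 0" by (metis zero_fun_apply)
  have y\<Gamma>: "y \<in> chain_space \<Gamma> r"
    unfolding y_def by (intro fs.subspace_sum[OF chains_subspace] chains_sc z\<Gamma>)
  have ysup: "F \<subseteq> V \<and> card F = r" if "y F \<noteq> 0" for F using y\<Gamma> that \<Gamma>V by (auto simp: in_chains_iff)
  have ykill: "contr V (f i) y = 0" if "i \<in> {1..r}" for i
  proof -
    interpret K: Vector_Spaces.linear sc sc "contr V (f i)" by (rule contr_linear)
    show ?thesis unfolding y_def K.sum by (intro sum.neutral) (simp only: contr_sc zkill[OF that], simp add: fun_eq_iff)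
  qed
  obtain G where G: "G \<subseteq> {1..card V}" "card G = r" "coord V f G y \<noteq> 0"
    by (rule exists_nonzero_coord[OF fin gen y0 ysup])
  have fac: "F \<subseteq> V \<and> card F = r" if "F \<in> faces \<Gamma> r" for F using that \<Gamma>V by (auto simp: faces_def)
  have yfac: "F \<in> faces \<Gamma> r" if "y F \<noteq> 0" for F using y\<Gamma> that by (auto simp: in_chain_space_faces)
  obtain T where T: "T \<in> initial V f r (faces \<Gamma> r)" "coord V f T y \<noteq> 0"
    by (rule exists_leading_coord[OF fin gen fac yfac G])
  have "finite T" using initial_sub[OF T(1)] finite_subset by blast
  then have "i \<notin> T" if "i \<in> {1..r}" for i
    using coord_zero_of_contr_zero[of V f i y T, OF ykill[OF that]] T(2) by blast
  then have "T \<inter> {1..r} = {}" by blast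
  then have "T \<in> D" using T(1) by (simp add: D_def)
  then have "coord V f T y = 0" using x(2) by (simp add: y_def coord_sum coord_linear mult.commute)
  then show False using T(2) by simp
qed

section \<open>Cross-intersecting shifted families\<close>

text \<open>Suppose the two sets never overfill a prefix. Then below their least common element
  \<open>i\<close> some \<open>j\<close> belongs to neither, and exchanging \<open>i\<close> for
  \<open>j\<close> in \<open>T\<close> lowers its sum. By induction the new set overfills a prefix
  together with \<open>T'\<close>; comparing counts before \<open>j\<close>, between
  \<open>j\<close> and \<open>i\<close>, and from \<open>i\<close> on shows that \<open>T\<close>
  already did.\<close>

lemma shifted_cross_prefix:
  assumes sh: "index_shifted A" and cross: "\<And>T T'. T \<in> A \<Longrightarrow> T' \<in> B \<Longrightarrow> T \<inter> T' \<noteq> {}"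
    and sub: "\<And>T. T \<in> A \<Longrightarrow> T \<subseteq> {1..N}" and T': "T' \<in> B" "finite T'"
  shows "T \<in> A \<Longrightarrow> \<exists>l. l < card (T \<inter> {1..l}) + card (T' \<inter> {1..l})"
proof (induction "\<Sum>T" arbitrary: T rule: less_induct)
  case (less T)
  have finT: "finite T" using sub[OF less.prems] finite_subset by blast
  show ?case
  proof (rule ccontr)
    assume nex: "\<not> ?case"
    then have le: "card (T \<inter> {1..l}) + card (T' \<inter> {1..l}) \<le> l" for l by (simp add: not_less)
    have ne: "finite (T \<inter> T')" "T \<inter> T' \<noteq> {}" using finT cross[OF less.prems T'(1)] by auto
    define i where "i = Min (T \<inter> T')"
    have i: "i \<in> T" "i \<in> T'" using Min_in[OF ne] by (auto simp: i_def)
    have imin: "k \<notin> T \<inter> T'" if "k < i" for k using that Min_le[OF ne(1), of k] by (auto simp: i_def)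
    have i1: "1 \<le> i" using sub[OF less.prems] i by auto
    have "\<exists>j. 1 \<le> j \<and> j < i \<and> j \<notin> T \<union> T'"
    proof (rule ccontr)
      assume "\<not> ?thesis"
      then have all: "{1..<i} \<subseteq> T \<union> T'" unfolding subset_iff atLeastLessThan_iff by blast
      define P Q where "P = T \<inter> {1..i}" and "Q = T' \<inter> {1..i}"
      have "{1..i} \<subseteq> P \<union> Q"
      proof
        fix y assume y: "y \<in> {1..i}"
        show "y \<in> P \<union> Q"
        proof (cases "y = i")
          case False
          then have "y \<in> {1..<i}" using y by simp
          then show ?thesis using all y by (auto simp: P_def Q_def)
        qed (use i y in \<open>simp add: P_def\<close>)
      qed
      then have "i \<le> card (P \<union> Q)" using card_mono[of "P \<union> Q" "{1..i}"] by (simp add: P_def Q_def)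
      moreover have "i \<in> P \<inter> Q" using i i1 by (simp add: P_def Q_def)
      then have "0 < card (P \<inter> Q)" by (auto simp: card_gt_0_iff P_def Q_def)
      moreover have "card P + card Q = card (P \<union> Q) + card (P \<inter> Q)"
        by (rule card_Un_Int) (auto simp: P_def Q_def)
      ultimately have "i < card P + card Q" by linarith
      then show False using le[of i] by (simp add: P_def Q_def)
    qed
    then obtain j where j: "1 \<le> j" "j < i" "j \<notin> T \<union> T'" by blast
    define U where "U = insert j (T - {i})"
    have U: "U \<in> A" using sh less.prems i j unfolding index_shifted_def U_def by blast
    have "\<Sum>T = i + \<Sum>(T - {i})" using finT i by (simp add: sum.remove)
    moreover have "\<Sum>U = j + \<Sum>(T - {i})" using finT j by (simp add: U_def)
    ultimately have "\<Sum>U < \<Sum>T" using j by simp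
    then obtain l where l: "l < card (U \<inter> {1..l}) + card (T' \<inter> {1..l})" using less.hyps U by blast
    consider "l < j" | "j \<le> l" "l < i" | "i \<le> l" by linarith
    then show False
    proof cases
      case 1
      then have "U \<inter> {1..l} = T \<inter> {1..l}" using j by (auto simp: U_def)
      then show ?thesis using l le[of l] by simp
    next
      case 2
      have "(U \<inter> {1..l}) \<inter> (T' \<inter> {1..l}) = {}"
        using 2 imin j by (auto simp: U_def)
      then have "card (U \<inter> {1..l}) + card (T' \<inter> {1..l}) = card ((U \<inter> {1..l}) \<union> (T' \<inter> {1..l}))"
        by (intro card_Un_disjoint[symmetric]) auto
      also have "\<dots> \<le> card {1..l}" by (rule card_mono) auto
      finally show ?thesis using l by simp
    next
      case 3
      have "U \<inter> {1..l} = insert j (T \<inter> {1..l} - {i})" using 3 j by (auto simp: U_def)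
      moreover have "card (insert j (T \<inter> {1..l} - {i})) = card (T \<inter> {1..l})"
        using 3 i i1 j by (intro card_exchange) auto
      ultimately show ?thesis using l le[of l] by simp
    qed
  qed
qed

text \<open>A member with the largest overlap with the prefix admits no further improving
  exchange.\<close>

lemma shifted_contains_prefix:
  assumes sh: "index_shifted A" and sub: "\<And>T. T \<in> A \<Longrightarrow> T \<subseteq> {1..N} \<and> card T = r" and "A \<noteq> {}"
  shows "{1..r} \<in> A"
proof -
  have "finite A" by (rule finite_subset[of _ "Pow {1..N}"]) (use sub in auto)
  then obtain T where T: "T \<in> A" "\<And>T'. T' \<in> A \<Longrightarrow> card (T' \<inter> {1..r}) \<le> card (T \<inter> {1..r})"
    using exists_maximal_image[of A "\<lambda>T. card (T \<inter> {1..r})"] assms(3) by blast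
  have Ts: "T \<subseteq> {1..N}" "card T = r" "finite T" using sub[OF T(1)] finite_subset by auto
  have "{1..r} \<subseteq> T"
  proof (rule ccontr)
    assume "\<not> {1..r} \<subseteq> T"
    then obtain j where j: "j \<in> {1..r}" "j \<notin> T" by blast
    have "\<not> T \<subseteq> {1..r}"
    proof
      assume "T \<subseteq> {1..r}"
      then have "T = {1..r}" using Ts by (intro card_subset_eq) auto
      then show False using j by blast
    qed
    then obtain i where i: "i \<in> T" "i \<notin> {1..r}" by blast
    have "insert j (T - {i}) \<in> A"
      using sh T(1) i j Ts(1) unfolding index_shifted_def by fastforce
    moreover have "insert j (T - {i}) \<inter> {1..r} = insert j (T \<inter> {1..r})" using i j by auto
    moreover have "card (insert j (T \<inter> {1..r})) = Suc (card (T \<inter> {1..r}))" using j by simp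
    ultimately show False using T(2) by fastforce
  qed
  then have "T = {1..r}" using Ts by (intro card_subset_eq[symmetric]) auto
  then show ?thesis using T by simp
qed

section \<open>Complements inside half-filled prefixes\<close>

definition flip :: "nat \<Rightarrow> nat set \<Rightarrow> nat set" where
  "flip t T = (T - {1..t}) \<union> ({1..t} - T)"

definition balance :: "nat \<Rightarrow> nat set \<Rightarrow> nat" where
  "balance r T = Max {t. t \<le> 2 * r \<and> 2 * card (T \<inter> {1..t}) = t}"

lemma flip_flip: "flip t (flip t T) = T"
  by (auto simp: flip_def)

lemma card_flip_prefix:
  assumes "l \<le> t"
  shows "card (flip t T \<inter> {1..l}) + card (T \<inter> {1..l}) = l"
proof -
  have "flip t T \<inter> {1..l} = {1..l} - T" using assms by (auto simp: flip_def)
  moreover have "card ({1..l} - T) + card (T \<inter> {1..l}) = card ({1..l} - T \<union> (T \<inter> {1..l}))"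
    by (rule card_Un_disjoint[symmetric]) auto
  moreover have "{1..l} - T \<union> (T \<inter> {1..l}) = {1..l}" by auto
  ultimately show ?thesis by simp
qed

lemma card_split_prefix:
  assumes "finite T"
  shows "card (T \<inter> {1..t}) + card (T - {1..t}) = card T"
proof -
  have "card (T \<inter> {1..t}) + card (T - {1..t}) = card ((T \<inter> {1..t}) \<union> (T - {1..t}))"
    using assms by (intro card_Un_disjoint[symmetric]) auto
  moreover have "(T \<inter> {1..t}) \<union> (T - {1..t}) = T" by auto
  ultimately show ?thesis by simp
qed

lemma card_flip_beyond:
  assumes bal: "2 * card (T \<inter> {1..t}) = t" and "t \<le> l"
  shows "card (flip t T \<inter> {1..l}) = card (T \<inter> {1..l})"
proof -
  define P Q where "P = flip t T \<inter> {1..l}" and "Q = T \<inter> {1..l}"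
  have fin: "finite P" "finite Q" by (auto simp: P_def Q_def)
  have "P \<inter> {1..t} = flip t T \<inter> {1..t}" "Q \<inter> {1..t} = T \<inter> {1..t}"
    using assms(2) by (auto simp: P_def Q_def)
  then have "card (P \<inter> {1..t}) = card (Q \<inter> {1..t})"
    using card_flip_prefix[of t t T] bal by simp
  moreover have "P - {1..t} = Q - {1..t}" by (auto simp: P_def Q_def flip_def)
  ultimately have "card P = card Q"
    using card_split_prefix[OF fin(1), of t] card_split_prefix[OF fin(2), of t] by simp
  then show ?thesis by (simp add: P_def Q_def)
qed

lemma card_flip:
  assumes "finite T" "2 * card (T \<inter> {1..t}) = t"
  shows "card (flip t T) = card T"
proof -
  have fin: "finite (flip t T)" using assms by (simp add: flip_def)
  have "card (flip t T \<inter> {1..t}) = card (T \<inter> {1..t})" using card_flip_prefix[of t t T] assms(2) by simp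
  moreover have "flip t T - {1..t} = T - {1..t}" by (auto simp: flip_def)
  ultimately show ?thesis using card_split_prefix[OF fin, of t] card_split_prefix[OF assms(1), of t] by simp
qed

lemma balance_eqI:
  assumes "t \<le> 2 * r" "2 * card (T \<inter> {1..t}) = t" "\<And>l. t < l \<Longrightarrow> 2 * card (T \<inter> {1..l}) < l"
  shows "balance r T = t"
  unfolding balance_def
proof (rule Max_eqI)
  show "finite {t. t \<le> 2 * r \<and> 2 * card (T \<inter> {1..t}) = t}" by (rule finite_subset[of _ "{..2 * r}"]) auto
  show "y \<le> t" if "y \<in> {t. t \<le> 2 * r \<and> 2 * card (T \<inter> {1..t}) = t}" for y
    using that assms(3)[of y] by (auto simp: not_less[symmetric])
qed (use assms in auto)

text \<open>The excess of \<open>2 * card (T \<inter> {1..l})\<close> over \<open>l\<close> changes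
  by one at each step and is not positive at \<open>2 * r\<close>. A nonnegative value after the
  last zero would therefore force a later zero.\<close>

lemma balance:
  assumes "finite T" "card T = r"
  shows "balance r T \<le> 2 * r" "2 * card (T \<inter> {1..balance r T}) = balance r T"
    "\<And>l. balance r T < l \<Longrightarrow> 2 * card (T \<inter> {1..l}) < l"
proof -
  define S where "S = {t. t \<le> 2 * r \<and> 2 * card (T \<inter> {1..t}) = t}"
  have finS: "finite S" by (rule finite_subset[of _ "{..2 * r}"]) (auto simp: S_def)
  have "0 \<in> S" by (simp add: S_def)
  then have "balance r T \<in> S" unfolding balance_def S_def[symmetric] using finS by (intro Max_in) auto
  then show "balance r T \<le> 2 * r" "2 * card (T \<inter> {1..balance r T}) = balance r T" by (auto simp: S_def)
  have max: "t \<le> balance r T" if "t \<in> S" for t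
    unfolding balance_def S_def[symmetric] using finS that by (rule Max_ge)
  fix l assume l: "balance r T < l"
  show "2 * card (T \<inter> {1..l}) < l"
  proof (rule ccontr)
    assume neg: "\<not> ?thesis"
    define c where "c m = card (T \<inter> {1..m})" for m
    have cr: "c m \<le> r" for m unfolding c_def using card_mono[OF assms(1), of "T \<inter> {1..m}"] assms(2) by auto
    have l2: "l < 2 * r" "2 * c l > l"
    proof -
      have "l \<notin> S" using max l by fastforce
      then have "\<not> (l \<le> 2 * r \<and> 2 * c l = l)" by (simp add: S_def c_def)
      moreover have "l \<le> 2 * c l" using neg by (simp add: c_def)
      ultimately show "l < 2 * r" "2 * c l > l" using cr[of l] by linarith+
    qed
    \<comment> \<open>The first index after \<open>l\<close> at which the excess is not positive;
      since steps have size one, it is zero there.\<close>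
    define m where "m = (LEAST m. l < m \<and> 2 * c m \<le> m)"
    have ex: "l < 2 * r \<and> 2 * c (2 * r) \<le> 2 * r" using l2 cr[of "2 * r"] by simp
    then have m: "l < m" "2 * c m \<le> m" "m \<le> 2 * r"
      unfolding m_def by (metis (mono_tags, lifting) LeastI, metis (mono_tags, lifting) LeastI, rule Least_le)
    obtain m' where m': "m = Suc m'" using m by (cases m) auto
    have "m' < 2 * c m'"
    proof (cases "m' = l")
      case True
      then show ?thesis using l2 by simp
    next
      case False
      then have "l < m'" using m m' by simp
      then show ?thesis using not_less_Least[of m' "\<lambda>m. l < m \<and> 2 * c m \<le> m"] m' unfolding m_def[symmetric] by simp
    qed
    moreover have "c m' \<le> c m" unfolding c_def by (rule card_mono) (auto simp: m')
    ultimately have "2 * c m = m" using m m' by linarith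
    then have "m \<in> S" using m by (simp add: S_def c_def)
    then show False using max[of m] l m by simp
  qed
qed

text \<open>\<open>\<rho>\<close> complements a set inside the longest prefix that it half fills.  Two sets exchanged by \<open>\<rho>\<close>
  cannot lie in the two families.\<close>

lemma shifted_cross_intersecting_bound:
  fixes D A B :: "nat set set"
  assumes D: "\<And>T. T \<in> D \<Longrightarrow> T \<subseteq> {1..N} \<and> card T = r"
    and flip: "\<And>T t. T \<in> D \<Longrightarrow> t \<le> 2 * r \<Longrightarrow> 2 * card (T \<inter> {1..t}) = t \<Longrightarrow> flip t T \<in> D"
    and AB: "A \<subseteq> D" "B \<subseteq> D" "A \<noteq> {}" "B \<noteq> {}" and sh: "index_shifted A" "index_shifted B"
    and cross: "\<And>T T'. T \<in> A \<Longrightarrow> T' \<in> B \<Longrightarrow> T \<inter> T' \<noteq> {}"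
  shows "card A + card B + card {T \<in> D. T \<inter> {1..r} = {}} \<le> card D + 1"
proof -
  have finD: "finite D" by (rule finite_subset[of _ "Pow {1..N}"]) (use D in auto)
  have finT: "finite T" if "T \<in> D" for T using D[OF that] finite_subset by blast
  define \<rho> where "\<rho> T = flip (balance r T) T" for T
  have \<rho>D: "\<rho> T \<in> D" if "T \<in> D" for T
    unfolding \<rho>_def using D[OF that] balance(1,2)[OF finT[OF that]] by (intro flip[OF that]) auto
  have bal\<rho>: "balance r (\<rho> T) = balance r T" if "T \<in> D" for T
  proof -
    note b = balance[OF finT[OF that], of r]
    have r: "card T = r" using D[OF that] by simp
    show ?thesis
    proof (rule balance_eqI)
      show "balance r T \<le> 2 * r" using b(1) r .
      show "2 * card (\<rho> T \<inter> {1..balance r T}) = balance r T"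
        using card_flip_beyond[OF b(2)[OF r] order_refl] b(2)[OF r] by (simp add: \<rho>_def)
      show "2 * card (\<rho> T \<inter> {1..l}) < l" if "balance r T < l" for l
        using card_flip_beyond[OF b(2)[OF r], of l] b(3)[OF r that] that by (simp add: \<rho>_def)
    qed
  qed
  have \<rho>\<rho>: "\<rho> (\<rho> T) = T" if "T \<in> D" for T
    using bal\<rho>[OF that] flip_flip by (simp add: \<rho>_def[of "\<rho> T"]) (simp add: \<rho>_def flip_flip)
  have inj: "inj_on \<rho> B" by (rule inj_on_inverseI[of _ \<rho>]) (use \<rho>\<rho> AB in blast)
  \<comment> \<open>\<open>T\<close> and \<open>\<rho> T\<close> are complementary up to the
    balance, and beyond it each fills less than half of every prefix, so together they never
    overfill one.\<close>
  have disj: "A \<inter> \<rho> ` B = {}"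
  proof (rule ccontr)
    assume "A \<inter> \<rho> ` B \<noteq> {}"
    then obtain T where T: "T \<in> B" "\<rho> T \<in> A" by blast
    then have TD: "T \<in> D" using AB by blast
    note b = balance[OF finT[OF TD] conjunct2[OF D[OF TD]]]
    obtain l where l: "l < card (\<rho> T \<inter> {1..l}) + card (T \<inter> {1..l})"
      using shifted_cross_prefix[OF sh(1) cross, of B N T "\<rho> T"] T AB D finT[OF TD] by blast
    show False
    proof (cases "l \<le> balance r T")
      case True
      then show ?thesis using l card_flip_prefix[OF True, of T] by (simp add: \<rho>_def)
    next
      case False
      then show ?thesis using l card_flip_beyond[OF b(2), of l] b(3)[of l] by (simp add: \<rho>_def)
    qed
  qed
  define Fr where "Fr = {T \<in> D. T \<inter> {1..r} = {}}"
  have pre: "{1..r} \<in> A" "{1..r} \<in> B"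
    using shifted_contains_prefix[OF sh(1), of N r] shifted_contains_prefix[OF sh(2), of N r] D AB by blast+
  have Fr: "T \<notin> A" "T \<notin> B" if "T \<in> Fr" for T
    using that cross[of T "{1..r}"] cross[of "{1..r}" T] pre by (auto simp: Fr_def)
  \<comment> \<open>A set that avoids \<open>{1..r}\<close> can half fill \<open>{1..t}\<close> only
    for \<open>t = 0\<close> or \<open>t = 2 * r\<close>, and the latter only if it is
    \<open>{r+1..2*r}\<close>. This exception is the summand 1 in the bound.\<close>
  have \<rho>Fr: "\<rho> F = F" if F: "F \<in> Fr" "F \<noteq> {r+1..2*r}" for F
  proof -
    have FD: "F \<in> D" "F \<inter> {1..r} = {}" using F by (auto simp: Fr_def)
    have Fs: "finite F" "card F = r" "F \<subseteq> {1..N}" using finT[OF FD(1)] D[OF FD(1)] by auto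
    note b = balance[OF Fs(1,2)]
    define t where "t = balance r F"
    have "t = 0"
    proof (rule ccontr)
      assume "t \<noteq> 0"
      have sub: "F \<inter> {1..t} \<subseteq> {r+1..t}" using FD(2) by auto
      then have "card (F \<inter> {1..t}) \<le> t - r" using card_mono[of "{r+1..t}" "F \<inter> {1..t}"] by simp
      then have "t = 2 * r" using b(1,2) \<open>t \<noteq> 0\<close> by (simp add: t_def)
      then have "card (F \<inter> {1..t}) = r" using b(2) by (simp add: t_def)
      then have "F \<inter> {1..t} = F" using Fs by (intro card_subset_eq) auto
      then have "F \<subseteq> {r+1..2*r}" using sub \<open>t = 2 * r\<close> by auto
      then have "F = {r+1..2*r}" using Fs by (intro card_subset_eq) auto
      then show False using F by simp
    qed
    then show ?thesis by (simp add: \<rho>_def t_def[symmetric] flip_def)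
  qed
  \<comment> \<open>A fixed point of \<rho> that lies in the image of \<open>B\<close> lies in
    \<open>B\<close> itself, so these sets of \<open>Fr\<close> are missed by the image as
    well.\<close>
  have "A \<union> \<rho> ` B \<subseteq> D - (Fr - {{r+1..2*r}})"
  proof
    fix T assume T: "T \<in> A \<union> \<rho> ` B"
    have "T \<in> D" using T AB \<rho>D by blast
    moreover have "T \<notin> Fr - {{r+1..2*r}}"
    proof
      assume F: "T \<in> Fr - {{r+1..2*r}}"
      then obtain T' where T': "T' \<in> B" "T = \<rho> T'" using T Fr by blast
      have "\<rho> T = T" using \<rho>Fr F by blast
      then have "T = T'" using T' \<rho>\<rho> AB by auto
      then show False using Fr F T' by blast
    qed
    ultimately show "T \<in> D - (Fr - {{r+1..2*r}})" by blast
  qed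
  then have "card (A \<union> \<rho> ` B) \<le> card (D - (Fr - {{r+1..2*r}}))" using finD by (intro card_mono) auto
  moreover have "card (A \<union> \<rho> ` B) = card A + card B"
  proof -
    have "finite A" "finite (\<rho> ` B)" using finD AB finite_subset by blast+
    then show ?thesis using disj card_image[OF inj] by (simp add: card_Un_disjoint)
  qed
  moreover have "card (D - (Fr - {{r+1..2*r}})) = card D - card (Fr - {{r+1..2*r}})"
    by (rule card_Diff_subset) (use finD in \<open>auto simp: Fr_def\<close>)
  moreover have "card (Fr - {{r+1..2*r}}) \<le> card D" using finD by (intro card_mono) (auto simp: Fr_def)
  moreover have "card Fr \<le> card (Fr - {{r+1..2*r}}) + 1"
    by (cases "{r+1..2*r} \<in> Fr") (auto simp: card_Diff_singleton_if)
  ultimately have "card A + card B + card Fr \<le> card D + 1" by linarith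
  then show ?thesis by (simp add: Fr_def)
qed

text \<open>The flipped set is a subset of \<open>T \<union> {1..t}\<close>, whose size is
  \<open>r + t / 2\<close> and hence at most \<open>2 * r\<close>; leading sets survive adding the
  prefix and then passing to subsets.\<close>

lemma initial_flip:
  fixes f :: "nat \<Rightarrow> 'a::linorder \<Rightarrow> 'k::alg_closed_field"
  assumes fin: "finite V" and d: "deep TYPE('k) V d \<Gamma>" and gen: "generic_frame V f"
    and T: "T \<in> initial V f r (faces \<Gamma> r)" and t: "t \<le> 2 * r" "2 * card (T \<inter> {1..t}) = t"
    and rd: "2 * r \<le> d" "2 * r \<le> card V"
  shows "flip t T \<in> initial V f r (faces \<Gamma> r)"
proof -
  have Ts: "card T = r" "finite T" using initial_sub[OF T] finite_subset by auto
  have "card (T \<union> {1..t}) + card (T \<inter> {1..t}) = r + t"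
    using card_Un_Int[of T "{1..t}"] Ts by simp
  then have "card (T \<union> {1..t}) \<le> d" using t rd by linarith
  then have U: "T \<union> {1..t} \<in> initial V f (card (T \<union> {1..t})) (faces \<Gamma> (card (T \<union> {1..t})))"
    using initial_union_prefix[OF fin d gen T, of t] t rd by simp
  have "flip t T \<subseteq> T \<union> {1..t}" by (auto simp: flip_def)
  from initial_subset[OF deepD(1)[OF d] U this] show ?thesis
    using card_flip[OF Ts(2) t(2)] Ts(1) by simp
qed

theorem uniform_cross_intersecting_bound:
  fixes \<Gamma> :: "'a::linorder set set"
  assumes fin: "finite V" and d: "deep TYPE('k::alg_closed_field) V d \<Gamma>"
    and rd: "2 * r \<le> d" "2 * r \<le> card V"
    and AB: "A \<subseteq> faces \<Gamma> r" "B \<subseteq> faces \<Gamma> r" "A \<noteq> {}" "B \<noteq> {}" "cross_intersecting A B"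
    and W: "W \<subseteq> V" "card W = r"
  shows "card A + card B + card {S. card S = r \<and> S \<inter> W = {} \<and> W \<union> S \<in> \<Gamma>} \<le> card (faces \<Gamma> r) + 1"
proof -
  note sc = deepD(1)[OF d] and \<Gamma>V = deepD(2)[OF d]
  have fac: "F \<subseteq> V \<and> card F = r" if "F \<in> faces \<Gamma> r" for F using that \<Gamma>V by (auto simp: faces_def)
  \<comment> \<open>The families are indexed so that one frame makes both of them shifted.\<close>
  define C where "C x = (if x = (0::nat) then A else B)" for x
  have C: "F \<subseteq> V \<and> card F = r" if "F \<in> C x" for F x
    using that AB by (intro fac) (auto simp: C_def split: if_splits)
  have "\<exists>f :: nat \<Rightarrow> 'a \<Rightarrow> 'k. generic_frame V f \<and> (\<forall>x\<in>{0, 1}. index_shifted (initial V f r (C x)))"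
    by (rule exists_shifting_frame[where A = C and J = "{0, 1}", OF fin C]) blast+
  then obtain f :: "nat \<Rightarrow> 'a \<Rightarrow> 'k" where f: "generic_frame V f"
    "\<forall>x\<in>{0, 1}. index_shifted (initial V f r (C x))" by blast
  have sh: "index_shifted (initial V f r A)" "index_shifted (initial V f r B)"
    using f(2) by (simp_all add: C_def)
  have finf: "finite (faces \<Gamma> r)" using simplicial_complex_finite[OF sc] by (simp add: faces_def)
  have finAB: "finite A" "finite B" using AB finf finite_subset by blast+
  have le: "card A \<le> card (initial V f r A)" "card B \<le> card (initial V f r B)"
    by (rule card_le_initial[OF fin f(1)]; use AB fac finAB in blast)+
  have ne: "initial V f r A \<noteq> {}" "initial V f r B \<noteq> {}"
    using le AB finAB by (auto simp: card_gt_0_iff dest: leD)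
  have "card (initial V f r A) + card (initial V f r B)
      + card {T \<in> initial V f r (faces \<Gamma> r). T \<inter> {1..r} = {}} \<le> card (initial V f r (faces \<Gamma> r)) + 1"
  proof (rule shifted_cross_intersecting_bound[where N = "card V"])
    show "flip t T \<in> initial V f r (faces \<Gamma> r)"
      if "T \<in> initial V f r (faces \<Gamma> r)" "t \<le> 2 * r" "2 * card (T \<inter> {1..t}) = t" for T t
      using initial_flip[OF fin d f(1) that rd] .
    show "T \<inter> T' \<noteq> {}" if "T \<in> initial V f r A" "T' \<in> initial V f r B" for T T'
      using initial_cross_intersecting[OF _ _ AB(5) that] AB fac by blast
  qed (use initial_sub initial_mono AB ne sh in blast)+
  moreover have "card {S. card S = r \<and> S \<inter> W = {} \<and> W \<union> S \<in> \<Gamma>}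
    \<le> card {T \<in> initial V f r (faces \<Gamma> r). T \<inter> {1..r} = {}}"
    by (rule card_avoiding_prefix[OF fin f(1) sc \<Gamma>V W])
  moreover have "card (initial V f r (faces \<Gamma> r)) \<le> card (faces \<Gamma> r)"
    by (rule initial_le_card[OF finf])
  ultimately show ?thesis using le by linarith
qed

section \<open>Cohen-Macaulay skeleta\<close>

lemma cdim_ge:
  assumes "simplicial_complex \<Gamma>" "F \<in> \<Gamma>"
  shows "int (card F) - 1 \<le> cdim \<Gamma>"
proof -
  have "card F \<le> Max (card ` \<Gamma>)" using assms simplicial_complex_finite[OF assms(1)] by (intro Max_ge) auto
  then show ?thesis by (simp add: cdim_def)
qed

text \<open>The greatest \<open>k\<close> is attained: the skeleton for \<open>-1\<close> is
  \<open>{{}}\<close>, which is Cohen-Macaulay, and the dimension bounds \<open>k\<close> from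
  above.\<close>

lemma depth_properties:
  assumes sc: "simplicial_complex \<Delta>"
  shows "depth TYPE('k::field) \<Delta> \<le> cdim \<Delta>" "cohen_macaulay TYPE('k) (skeleton \<Delta> (depth TYPE('k) \<Delta>))"
proof -
  define P where "P k \<longleftrightarrow> -1 \<le> k \<and> k \<le> cdim \<Delta> \<and> cohen_macaulay TYPE('k) (skeleton \<Delta> k)" for k
  have "skeleton \<Delta> (-1) = {{}}"
    using simplicial_complex_empty[OF sc] simplicial_complex_finite_face[OF sc] by (auto simp: skeleton_def)
  then have "cohen_macaulay TYPE('k) (skeleton \<Delta> (-1))"
    by (simp add: cohen_macaulay_def cdim_def red_hom_vanishes_def)
  moreover have "-1 \<le> cdim \<Delta>" using cdim_ge[OF sc simplicial_complex_empty[OF sc]] by simp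
  ultimately have ne: "{k. P k} \<noteq> {}" by (auto simp: P_def)
  have fin: "finite {k. P k}" by (rule finite_subset[of _ "{-1..cdim \<Delta>}"]) (auto simp: P_def)
  have "P (Max {k. P k})" using Max_in[OF fin ne] by simp
  moreover have "(GREATEST k. P k) = Max {k. P k}"
    by (rule Greatest_equality) (use calculation fin in auto)
  ultimately have "P (depth TYPE('k) \<Delta>)" unfolding depth_def P_def by simp
  then show "depth TYPE('k) \<Delta> \<le> cdim \<Delta>" "cohen_macaulay TYPE('k) (skeleton \<Delta> (depth TYPE('k) \<Delta>))"
    by (auto simp: P_def)
qed

lemma cohen_macaulay_link:
  assumes sc: "simplicial_complex \<Gamma>" and cm: "cohen_macaulay T \<Gamma>" and A: "A \<in> \<Gamma>"
  shows "cohen_macaulay T (link \<Gamma> A)"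
  unfolding cohen_macaulay_def
proof (intro ballI allI impI)
  fix B i assume B: "B \<in> link \<Gamma> A" and i: "i < cdim (link (link \<Gamma> A) B)"
  have AB: "A \<inter> B = {}" "A \<union> B \<in> \<Gamma>" using B by (auto simp: link_def)
  show "red_hom_vanishes T (link (link \<Gamma> A) B) i"
    using cm AB(2) i unfolding link_link[OF sc AB(1)] cohen_macaulay_def by blast
qed

text \<open>If a union \<open>S\<close> of components contained \<open>a\<close> but not
  \<open>w\<close>, the cycle \<open>a - w\<close> would bound some \<open>e\<close>. Summed over
  the vertices of \<open>S\<close>, the boundary coefficients of \<open>e\<close> give zero, while
  those of the cycle give one.\<close>

lemma cohen_macaulay_connected:
  fixes \<Gamma> :: "'a::linorder set set"
  assumes sc: "simplicial_complex \<Gamma>" and h0: "red_hom_vanishes TYPE('k::field) \<Gamma> 0"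
    and closed: "\<And>u v. v \<in> S \<Longrightarrow> u \<noteq> v \<Longrightarrow> {u, v} \<in> \<Gamma> \<Longrightarrow> u \<in> S"
    and a: "a \<in> S" "{a} \<in> \<Gamma>" and w: "{w} \<in> \<Gamma>" and finS: "finite S" "\<And>v. v \<in> S \<Longrightarrow> {v} \<in> \<Gamma>"
  shows "w \<in> S"
proof (rule ccontr)
  assume wS: "w \<notin> S"
  define c :: "'a set \<Rightarrow> 'k" where "c F = (if F = {a} then 1 else if F = {w} then -1 else 0)" for F
  have aw: "a \<noteq> w" using a wS by auto
  have finV: "finite {v. {v} \<in> \<Gamma>}"
    using finite_vimageI[OF simplicial_complex_finite[OF sc], of "\<lambda>v. {v}"] by (simp add: vimage_def inj_on_def)
  have "is_chain \<Gamma> 1 c" using a w by (auto simp: is_chain_def c_def split: if_splits)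
  moreover have bd: "bdry \<Gamma> c G = 0" if "G \<in> \<Gamma>" "card G + 1 = 1" for G
  proof -
    have "G = {}" using that simplicial_complex_finite_face[OF sc] by simp
    then have "bdry \<Gamma> c G = (\<Sum>v\<in>{v. {v} \<in> \<Gamma>}. c {v})" by (simp add: bdry_def)
    also have "\<dots> = (\<Sum>v\<in>{v. {v} \<in> \<Gamma>}. (if v = a then 1 else 0) + (if v = w then -1 else 0))"
      using aw by (intro sum.cong) (auto simp: c_def)
    also have "\<dots> = 0" using finV a w by (simp add: sum.distrib)
    finally show ?thesis .
  qed
  ultimately have "\<exists>e :: 'a set \<Rightarrow> 'k. \<forall>G\<in>\<Gamma>. card G = 1 \<longrightarrow> bdry \<Gamma> e G = c G"
  proof -
    have "\<forall>G\<in>\<Gamma>. card G + 1 = 1 \<longrightarrow> bdry \<Gamma> c G = 0" using bd by blast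
    moreover have "is_chain \<Gamma> (nat (0 + 1)) c \<and> (\<forall>G\<in>\<Gamma>. card G + 1 = nat (0 + 1) \<longrightarrow> bdry \<Gamma> c G = 0) \<longrightarrow>
      (\<exists>e :: 'a set \<Rightarrow> 'k. is_chain \<Gamma> (nat (0 + 1) + 1) e \<and> (\<forall>G\<in>\<Gamma>. card G = nat (0 + 1) \<longrightarrow> bdry \<Gamma> e G = c G))"
      using h0 unfolding red_hom_vanishes_def by fastforce
    moreover have "nat (0 + 1) = 1" by simp
    ultimately show ?thesis using \<open>is_chain \<Gamma> 1 c\<close> by (simp only:) blast
  qed
  then obtain e :: "'a set \<Rightarrow> 'k" where e: "\<forall>G\<in>\<Gamma>. card G = 1 \<longrightarrow> bdry \<Gamma> e G = c G" by blast
  define h where "h v u = (if u \<noteq> v \<and> {u, v} \<in> \<Gamma> then (if v < u then - e {u, v} else e {u, v}) else 0)" for v u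
  have "bdry \<Gamma> e {v} = (\<Sum>u\<in>S. h v u)" if v: "v \<in> S" for v
  proof -
    have "bdry \<Gamma> e {v} = (\<Sum>u\<in>{u. u \<notin> {v} \<and> insert u {v} \<in> \<Gamma>}. h v u)"
      unfolding bdry_def
    proof (rule sum.cong[OF refl])
      fix u assume u: "u \<in> {u. u \<notin> {v} \<and> insert u {v} \<in> \<Gamma>}"
      have "{x \<in> {v}. x < u} = (if v < u then {v} else {})" by auto
      then show "(- 1) ^ card {x \<in> {v}. x < u} * e (insert u {v}) = h v u" using u by (simp add: h_def)
    qed
    also have "\<dots> = (\<Sum>u\<in>S. h v u)"
      by (rule sum.mono_neutral_left) (use finS(1) closed[OF v] in \<open>auto simp: h_def\<close>)
    finally show ?thesis .
  qed
  then have "(\<Sum>v\<in>S. c {v}) = (\<Sum>v\<in>S. \<Sum>u\<in>S. h v u)"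
    using e finS(2) by (intro sum.cong refl) force
  also have "\<dots> = 0"
  proof (rule antisymmetric_sum_zero)
    fix u v show "h u v = - h v u" by (auto simp: h_def insert_commute)
  qed (simp add: h_def)
  finally have "(\<Sum>v\<in>S. c {v}) = 0" .
  moreover have "(\<Sum>v\<in>S. c {v}) = (\<Sum>v\<in>S. if v = a then 1 else 0)"
    using wS by (intro sum.cong) (auto simp: c_def)
  ultimately show False using a finS(1) by simp
qed

text \<open>Induction on the dimension through links. The vertices of faces of maximal size are
  closed under edges, because the link of such a vertex is pure of dimension one less; connectedness
  then shows that every vertex is of this kind.\<close>

lemma cohen_macaulay_pure:
  fixes \<Gamma> :: "'a::linorder set set"
  assumes "simplicial_complex \<Gamma>" "cohen_macaulay TYPE('k::field) \<Gamma>" "F \<in> \<Gamma>"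
  shows "\<exists>G\<in>\<Gamma>. F \<subseteq> G \<and> card G = Max (card ` \<Gamma>)"
  using assms
proof (induction "Max (card ` \<Gamma>)" arbitrary: \<Gamma> F rule: less_induct)
  case (less \<Gamma> F)
  define D where "D = Max (card ` \<Gamma>)"
  note sc = less.prems(1)
  have fin\<Gamma>: "finite \<Gamma>" using simplicial_complex_finite[OF sc] .
  have finF: "finite G" if "G \<in> \<Gamma>" for G using simplicial_complex_finite_face[OF sc that] .
  have leD: "card G \<le> D" if "G \<in> \<Gamma>" for G unfolding D_def using fin\<Gamma> that by simp
  have "D \<in> card ` \<Gamma>" unfolding D_def using fin\<Gamma> less.prems(3) by (intro Max_in) auto
  then obtain G0 where G0: "G0 \<in> \<Gamma>" "card G0 = D" by auto
  define S where "S = {v. \<exists>G\<in>\<Gamma>. v \<in> G \<and> card G = D}"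
  have Sv: "{v} \<in> \<Gamma>" if "v \<in> S" for v
    using that simplicial_complex_subset[OF sc] unfolding S_def by blast
  have extend: "\<exists>G\<in>\<Gamma>. F \<subseteq> G \<and> card G = D" if F: "F \<in> \<Gamma>" "v \<in> F" and v: "v \<in> S" for F v
  proof -
    define \<Lambda> where "\<Lambda> = link \<Gamma> {v}"
    have sc\<Lambda>: "simplicial_complex \<Lambda>" unfolding \<Lambda>_def by (rule link_simplicial_complex[OF sc Sv[OF v]])
    obtain H where H: "H \<in> \<Gamma>" "v \<in> H" "card H = D" using v by (auto simp: S_def)
    have mem: "G - {v} \<in> \<Lambda>" if "G \<in> \<Gamma>" "v \<in> G" for G
      using that simplicial_complex_subset[OF sc that(1), of "G - {v}"] by (auto simp: \<Lambda>_def link_def insert_absorb)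
    have D1: "1 \<le> D" using H finF[OF H(1)] by (metis One_nat_def Suc_leI card_gt_0_iff empty_iff)
    have max: "Max (card ` \<Lambda>) = D - 1"
    proof (rule Max_eqI)
      show "finite (card ` \<Lambda>)" using simplicial_complex_finite[OF sc\<Lambda>] by simp
      show "y \<le> D - 1" if y: "y \<in> card ` \<Lambda>" for y
      proof -
        obtain G where G: "G \<in> \<Lambda>" "y = card G" using y by auto
        then have "insert v G \<in> \<Gamma>" "v \<notin> G" "finite G" using finF by (auto simp: \<Lambda>_def link_def)
        then show ?thesis using leD[of "insert v G"] G by simp
      qed
      have "card (H - {v}) = D - 1" using H finF[OF H(1)] by simp
      then show "D - 1 \<in> card ` \<Lambda>" using mem[OF H(1,2)] by (metis image_eqI)
    qed
    have "\<exists>G\<in>\<Lambda>. F - {v} \<subseteq> G \<and> card G = Max (card ` \<Lambda>)"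
    proof (rule less.hyps)
      show "Max (card ` \<Lambda>) < Max (card ` \<Gamma>)" using max D1 by (simp add: D_def)
      show "cohen_macaulay TYPE('k) \<Lambda>"
        unfolding \<Lambda>_def by (rule cohen_macaulay_link[OF sc less.prems(2) Sv[OF v]])
    qed (use sc\<Lambda> mem[OF F] in auto)
    then obtain G where G: "G \<in> \<Lambda>" "F - {v} \<subseteq> G" "card G = D - 1" using max by auto
    then have "insert v G \<in> \<Gamma>" "v \<notin> G" "finite G" using finF by (auto simp: \<Lambda>_def link_def)
    moreover have "card (insert v G) = D" using calculation G(3) D1 by simp
    moreover have "F \<subseteq> insert v G" using G(2) by blast
    ultimately show ?thesis by blast
  qed
  have good: "w \<in> S" if w: "{w} \<in> \<Gamma>" for w
  \<comment> \<open>Homology in degree 0 is known to vanish only below the dimension; for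
    \<open>D \<le> 1\<close> a vertex is already a face of maximal size.\<close>
  proof (cases "D \<le> 1")
    case True
    have "card {w} = D" using leD[OF w] True by simp
    then show ?thesis using w by (auto simp: S_def)
  next
    case False
    then obtain a where a: "a \<in> G0" using G0 by (metis card.empty ex_in_conv zero_le_one)
    have "cdim \<Gamma> = int D - 1" by (simp add: cdim_def D_def)
    then have "red_hom_vanishes TYPE('k) (link \<Gamma> {}) 0"
      using less.prems(2) simplicial_complex_empty[OF sc] False unfolding cohen_macaulay_def by auto
    then have h0: "red_hom_vanishes TYPE('k) \<Gamma> 0" by simp
    have closed: "u \<in> S" if "v \<in> S" "u \<noteq> v" "{u, v} \<in> \<Gamma>" for u v
      using extend[OF that(3) _ that(1)] by (auto simp: S_def)
    have "a \<in> S" using a G0 by (auto simp: S_def)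
    moreover have "finite S"
      by (rule finite_subset[of _ "\<Union>\<Gamma>"]) (use fin\<Gamma> finF in \<open>auto simp: S_def\<close>)
    ultimately show ?thesis
      using cohen_macaulay_connected[OF sc h0, of S a w] closed Sv w by blast
  qed
  show ?case
  proof (cases "F = {}")
    case True
    then show ?thesis using G0 by (auto simp: D_def)
  next
    case False
    then obtain v where v: "v \<in> F" by blast
    then have "v \<in> S" using good simplicial_complex_subset[OF sc less.prems(3), of "{v}"] by auto
    from extend[OF less.prems(3) v this] show ?thesis by (simp add: D_def)
  qed
qed

lemma bdry_eq_contr:
  assumes fin: "finite V" and \<Lambda>V: "\<Union>\<Lambda> \<subseteq> V" and sc: "simplicial_complex \<Lambda>" and c: "c \<in> chain_space \<Lambda> n" and G: "G \<in> \<Lambda>"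
  shows "bdry \<Lambda> c G = contr V (\<lambda>_. 1) c G"
proof -
  have finG: "finite G" using simplicial_complex_finite_face[OF sc G] .
  have "bdry \<Lambda> c G = (\<Sum>v\<in>{v. v \<notin> G \<and> insert v G \<in> \<Lambda>}. vcontr v c G)"
    unfolding bdry_def by (rule sum.cong) (use finG in \<open>auto simp: vcontr_def vsign_def\<close>)
  also have "\<dots> = (\<Sum>v\<in>V. vcontr v c G)"
    by (rule sum.mono_neutral_left) (use fin \<Lambda>V c in \<open>auto simp: vcontr_def in_chains_iff\<close>)
  finally show ?thesis by (simp add: contr_def)
qed

lemma exact_at_of_red_hom_vanishes:
  fixes \<Lambda> :: "'a::linorder set set"
  assumes fin: "finite V" and \<Lambda>V: "\<Union>\<Lambda> \<subseteq> V" and sc: "simplicial_complex \<Lambda>"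
    and h: "red_hom_vanishes TYPE('k::field) \<Lambda> (int k - 1)"
  shows "exact_at V (\<lambda>_. 1 :: 'k) \<Lambda> k"
  unfolding exact_at_def
proof (intro ballI impI)
  fix z :: "'a set \<Rightarrow> 'k"
  assume z: "z \<in> chain_space \<Lambda> k" "contr V (\<lambda>_. 1) z = 0"
  have "is_chain \<Lambda> k z" using z(1) by (simp add: chain_space_def)
  moreover have "\<forall>G\<in>\<Lambda>. card G + 1 = k \<longrightarrow> bdry \<Lambda> z G = 0"
    using bdry_eq_contr[OF fin \<Lambda>V sc z(1)] z(2) by simp
  ultimately have "\<exists>e :: 'a set \<Rightarrow> 'k. is_chain \<Lambda> (k + 1) e \<and> (\<forall>G\<in>\<Lambda>. card G = k \<longrightarrow> bdry \<Lambda> e G = z G)"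
    using h unfolding red_hom_vanishes_def by auto
  then obtain e :: "'a set \<Rightarrow> 'k" where e: "e \<in> chain_space \<Lambda> (Suc k)" "\<forall>G\<in>\<Lambda>. card G = k \<longrightarrow> bdry \<Lambda> e G = z G"
    by (auto simp: chain_space_def)
  have "contr V (\<lambda>_. 1) e G = z G" for G
  proof (cases "G \<in> \<Lambda> \<and> card G = k")
    case True
    then show ?thesis using e(2) bdry_eq_contr[OF fin \<Lambda>V sc e(1)] by auto
  next
    case False
    then show ?thesis using contr_chains[OF sc e(1), of V "\<lambda>_. 1"] z(1) unfolding in_chains_iff by metis
  qed
  then show "\<exists>c\<in>chain_space \<Lambda> (Suc k). contr V (\<lambda>_. 1) c = z" using e(1) by blast
qed

section \<open>Extension of scalars to the algebraic closure\<close>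

interpretation closure_space: vector_space "\<lambda>(a::'k::field) (x::'k alg_closure). to_ac a * x"
  by unfold_locales (auto simp: algebra_simps)

text \<open>The coefficients of \<open>z\<close> are expanded in a basis \<open>E\<close> of their
  span over the base field. Independence of \<open>E\<close> makes every component a cycle over that
  field, and the components are filled separately.\<close>

lemma exact_at_alg_closure:
  fixes \<Lambda> :: "'a::linorder set set"
  assumes sc: "simplicial_complex \<Lambda>" and ex: "exact_at V (\<lambda>_. 1 :: 'k::field) \<Lambda> k"
  shows "exact_at V (\<lambda>_. 1 :: 'k alg_closure) \<Lambda> k"
  unfolding exact_at_def
proof (intro ballI impI)
  fix z :: "'a set \<Rightarrow> 'k alg_closure"
  assume z: "z \<in> chain_space \<Lambda> k" "contr V (\<lambda>_. 1) z = 0"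
  have fin\<Lambda>: "finite \<Lambda>" using simplicial_complex_finite[OF sc] .
  obtain E where E: "E \<subseteq> z ` \<Lambda>" "closure_space.independent E" "z ` \<Lambda> \<subseteq> closure_space.span E"
    using closure_space.maximal_independent_subset .
  have finE: "finite E" using E(1) fin\<Lambda> finite_subset by blast
  define \<zeta> where "\<zeta> b F = (if F \<in> \<Lambda> then closure_space.representation E (z F) b else 0)" for b F
  have \<zeta>: "\<zeta> b \<in> chain_space \<Lambda> k" for b
    unfolding in_chains_iff
  proof (intro allI impI)
    fix F assume F: "\<zeta> b F \<noteq> 0"
    then have "F \<in> \<Lambda>" "z F \<noteq> 0"
      by (auto simp: \<zeta>_def closure_space.representation_zero split: if_splits)
    then show "F \<in> \<Lambda> \<and> card F = k" using z(1) by (auto simp: in_chains_iff)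
  qed
  define lift where "lift c F = to_ac (c F)" for c :: "'a set \<Rightarrow> 'k" and F
  have contr_lift: "contr V (\<lambda>_. 1) (lift c) = lift (contr V (\<lambda>_. 1) c)" for c
  proof
    fix G
    have "vcontr v (lift c) G = to_ac (vcontr v c G)" for v
      by (simp add: vcontr_def vsign_def lift_def)
    then show "contr V (\<lambda>_. 1) (lift c) G = lift (contr V (\<lambda>_. 1) c) G"
      by (simp add: contr_def to_ac_sum) (simp add: lift_def contr_def to_ac_sum)
  qed
  have contr_comb: "contr V (\<lambda>_. 1) (\<Sum>b\<in>E. sc b (lift (x b))) = (\<Sum>b\<in>E. sc b (lift (contr V (\<lambda>_. 1) (x b))))" for x
  proof -
    interpret K: Vector_Spaces.linear sc sc "contr V (\<lambda>_. 1 :: 'k alg_closure)" by (rule contr_linear)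
    show ?thesis unfolding K.sum by (intro sum.cong refl) (simp only: contr_sc contr_lift)
  qed
  have zE: "z = (\<Sum>b\<in>E. sc b (lift (\<zeta> b)))"
  proof
    fix F
    show "z F = (\<Sum>b\<in>E. sc b (lift (\<zeta> b))) F"
    proof (cases "F \<in> \<Lambda>")
      case True
      then have "z F \<in> closure_space.span E" using E(3) by blast
      have "(\<Sum>b\<in>E. sc b (lift (\<zeta> b))) F = (\<Sum>b\<in>E. to_ac (closure_space.representation E (z F) b) * b)"
        unfolding fun_sum_apply using True by (intro sum.cong) (simp_all add: lift_def \<zeta>_def)
      also have "\<dots> = z F"
        by (rule closure_space.sum_representation_eq[OF E(2) \<open>z F \<in> closure_space.span E\<close> finE subset_refl])
      finally show ?thesis by (rule sym)
    next
      case False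
      then show ?thesis using chains_outside[OF z(1)] by (simp add: fun_sum_apply lift_def \<zeta>_def)
    qed
  qed
  have "contr V (\<lambda>_. 1) (\<zeta> b) = 0" if b: "b \<in> E" for b
  proof
    fix G
    have "(\<Sum>b\<in>E. sc b (lift (contr V (\<lambda>_. 1) (\<zeta> b)))) = 0" using z(2) contr_comb[of \<zeta>] zE by simp
    then have "(\<Sum>b\<in>E. sc b (lift (contr V (\<lambda>_. 1) (\<zeta> b)))) G = 0" by simp
    then have "(\<Sum>b\<in>E. to_ac (contr V (\<lambda>_. 1) (\<zeta> b) G) * b) = 0"
      by (simp add: fun_sum_apply lift_def mult.commute)
    from closure_space.independentD[OF E(2) finE subset_refl this b]
    show "contr V (\<lambda>_. 1) (\<zeta> b) G = 0 G" by simp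
  qed
  then have "\<forall>b\<in>E. \<exists>e\<in>chain_space \<Lambda> (Suc k). contr V (\<lambda>_. 1) e = \<zeta> b"
    using ex \<zeta> unfolding exact_at_def by blast
  then obtain e where e: "\<forall>b\<in>E. e b \<in> chain_space \<Lambda> (Suc k) \<and> contr V (\<lambda>_. 1) (e b) = \<zeta> b" by metis
  define c where "c = (\<Sum>b\<in>E. sc b (lift (e b)))"
  have "contr V (\<lambda>_. 1) c = z"
    unfolding c_def contr_comb by (subst zE, rule sum.cong) (use e in auto)
  moreover have "c \<in> chain_space \<Lambda> (Suc k)"
    unfolding c_def
    by (intro fs.subspace_sum[OF chains_subspace] chains_sc) (use e in \<open>auto simp: in_chains_iff lift_def\<close>)
  ultimately show "\<exists>c\<in>chain_space \<Lambda> (Suc k). contr V (\<lambda>_. 1) c = z" by blast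
qed

text \<open>By purity the link of \<tau> contains a face whose size is the top face size minus
  \<open>card \<tau>\<close>, so its dimension is large enough for the Cohen-Macaulay condition to
  cover every degree that \<open>deep\<close> asks for.\<close>

lemma cohen_macaulay_deep:
  fixes \<Gamma> :: "'a::linorder set set"
  assumes sc: "simplicial_complex \<Gamma>" and cm: "cohen_macaulay TYPE('k::field) \<Gamma>"
  shows "deep TYPE('k alg_closure) (\<Union>\<Gamma>) (Max (card ` \<Gamma>)) \<Gamma>"
  unfolding deep_def
proof (intro conjI ballI allI impI)
  fix \<tau> k assume \<tau>: "\<tau> \<in> \<Gamma>" and k: "k + card \<tau> < Max (card ` \<Gamma>)"
  have finV: "finite (\<Union>\<Gamma>)"
    using simplicial_complex_finite[OF sc] simplicial_complex_finite_face[OF sc] by blast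
  have scl: "simplicial_complex (link \<Gamma> \<tau>)" using link_simplicial_complex[OF sc \<tau>] .
  obtain G where G: "G \<in> \<Gamma>" "\<tau> \<subseteq> G" "card G = Max (card ` \<Gamma>)"
    using cohen_macaulay_pure[OF sc cm \<tau>] by blast
  have "G - \<tau> \<in> link \<Gamma> \<tau>"
    using simplicial_complex_subset[OF sc G(1), of "G - \<tau>"] G by (auto simp: link_def Un_absorb1)
  moreover have "card (G - \<tau>) = Max (card ` \<Gamma>) - card \<tau>"
    using G simplicial_complex_finite_face[OF sc \<tau>] by (simp add: card_Diff_subset)
  ultimately have "int k - 1 < cdim (link \<Gamma> \<tau>)" using cdim_ge[OF scl] k by fastforce
  then have "red_hom_vanishes TYPE('k) (link \<Gamma> \<tau>) (int k - 1)"
    using cm \<tau> unfolding cohen_macaulay_def by blast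
  then have "exact_at (\<Union>\<Gamma>) (\<lambda>_. 1 :: 'k) (link \<Gamma> \<tau>) k"
    by (intro exact_at_of_red_hom_vanishes[OF finV _ scl]) (auto simp: link_def)
  then show "exact_at (\<Union>\<Gamma>) (\<lambda>_. 1 :: 'k alg_closure) (link \<Gamma> \<tau>) k"
    by (rule exact_at_alg_closure[OF scl])
qed (use sc in auto)

section \<open>Reduction to uniform families\<close>

text \<open>The lowest level is replaced by its upper shadow. A face of size \<open>k\<close> has at
  least \<open>D - k\<close> extensions, a set of size \<open>k + 1\<close> has at most
  \<open>k + 1\<close> subsets of size \<open>k\<close>, and \<open>D - k \<ge> k + 1\<close>. By
  the Sperner property the shadow is disjoint from the rest of \<open>A\<close>.\<close>

lemma sperner_raise_level:
  assumes sc: "simplicial_complex \<Gamma>" and pure: "\<And>F. F \<in> \<Gamma> \<Longrightarrow> \<exists>G\<in>\<Gamma>. F \<subseteq> G \<and> card G = D"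
    and A: "A \<subseteq> \<Gamma>" "sperner A" and k: "2 * k + 1 \<le> D" "\<And>F. F \<in> A \<Longrightarrow> k \<le> card F"
  defines "A' \<equiv> {F \<in> A. card F \<noteq> k} \<union> {G \<in> \<Gamma>. card G = Suc k \<and> (\<exists>F\<in>A. card F = k \<and> F \<subseteq> G)}"
  shows "card A \<le> card A'" "sperner A'"
proof -
  define L where "L = {F \<in> A. card F = k}"
  define U where "U = {G \<in> \<Gamma>. card G = Suc k \<and> (\<exists>F\<in>A. card F = k \<and> F \<subseteq> G)}"
  define R where "R = {F \<in> A. card F \<noteq> k}"
  have A': "A' = R \<union> U" by (simp add: A'_def R_def U_def)
  have fin\<Gamma>: "finite \<Gamma>" using simplicial_complex_finite[OF sc] .
  have finA: "finite A" using A(1) fin\<Gamma> finite_subset by blast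
  have fin: "finite L" "finite U" "finite R" using finA fin\<Gamma> by (auto simp: L_def U_def R_def)
  have finF: "finite F" if "F \<in> \<Gamma>" for F using simplicial_complex_finite_face[OF sc that] .
  have inc: "R \<inter> U = {}"
  proof (rule ccontr)
    assume "R \<inter> U \<noteq> {}"
    then obtain G F where "G \<in> A" "F \<in> A" "card F = k" "card G \<noteq> k" "F \<subseteq> G" by (auto simp: R_def U_def)
    then show False using A(2) unfolding sperner_def by blast
  qed
  have up: "D - k \<le> card {G \<in> U. F \<subseteq> G}" if F: "F \<in> L" for F
  proof -
    have F': "F \<in> \<Gamma>" "card F = k" "F \<in> A" using F A(1) by (auto simp: L_def)
    obtain H where H: "H \<in> \<Gamma>" "F \<subseteq> H" "card H = D" using pure[OF F'(1)] by blast
    have "(\<lambda>x. insert x F) ` (H - F) \<subseteq> {G \<in> U. F \<subseteq> G}"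
    proof
      fix G assume "G \<in> (\<lambda>x. insert x F) ` (H - F)"
      then obtain x where x: "x \<in> H - F" "G = insert x F" by blast
      then have "G \<in> \<Gamma>" using simplicial_complex_subset[OF sc H(1), of G] H by blast
      then show "G \<in> {G \<in> U. F \<subseteq> G}" using x F' finF[OF F'(1)] by (auto simp: U_def)
    qed
    moreover have "inj_on (\<lambda>x. insert x F) (H - F)" by (auto simp: inj_on_def)
    then have "card ((\<lambda>x. insert x F) ` (H - F)) = D - k"
      using H F' finF[OF F'(1)] by (simp add: card_image card_Diff_subset)
    ultimately show ?thesis using fin(2) by (metis (no_types, lifting) card_mono finite_Collect_conjI finite_subset mem_Collect_eq subsetI)
  qed
  have down: "card {F \<in> L. F \<subseteq> G} \<le> Suc k" if G: "G \<in> U" for G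
  proof -
    have G': "card G = Suc k" "finite G" using G finF by (auto simp: U_def)
    have "{F \<in> L. F \<subseteq> G} \<subseteq> (\<lambda>x. G - {x}) ` G"
    proof
      fix F assume F: "F \<in> {F \<in> L. F \<subseteq> G}"
      then have "card (G - F) = 1" using G' finite_subset[of F G] by (simp add: L_def card_Diff_subset)
      then obtain x where x: "G - F = {x}" by (auto simp: card_1_singleton_iff)
      then have "F = G - {x}" "x \<in> G" using F by auto
      then show "F \<in> (\<lambda>x. G - {x}) ` G" by blast
    qed
    then have "card {F \<in> L. F \<subseteq> G} \<le> card ((\<lambda>x. G - {x}) ` G)" using G' by (intro card_mono) auto
    also have "\<dots> \<le> Suc k" using card_image_le[OF G'(2), of "\<lambda>x. G - {x}"] G' by simp
    finally show ?thesis .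
  qed
  have "card L * Suc k \<le> card L * (D - k)" using k(1) by (intro mult_le_mono2) simp
  also have "\<dots> \<le> (\<Sum>F\<in>L. card {G \<in> U. F \<subseteq> G})"
    using sum_bounded_below[of L "D - k" "\<lambda>F. card {G \<in> U. F \<subseteq> G}"] up by simp
  also have "\<dots> = (\<Sum>G\<in>U. card {F \<in> L. F \<subseteq> G})"
  proof -
    have "(\<Sum>F\<in>L. card {G \<in> U. F \<subseteq> G}) = (\<Sum>F\<in>L. \<Sum>G\<in>U. if F \<subseteq> G then 1 else 0)"
      using fin by (simp add: sum.If_cases Int_def)
    also have "\<dots> = (\<Sum>G\<in>U. \<Sum>F\<in>L. if F \<subseteq> G then 1 else 0)" by (rule sum.swap)
    also have "\<dots> = (\<Sum>G\<in>U. card {F \<in> L. F \<subseteq> G})" using fin by (simp add: sum.If_cases Int_def)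
    finally show ?thesis .
  qed
  also have "\<dots> \<le> card U * Suc k"
    using sum_bounded_above[of U "\<lambda>G. card {F \<in> L. F \<subseteq> G}" "Suc k"] down by simp
  finally have LU: "card L \<le> card U" using mult_le_cancel2[of "card L" "Suc k" "card U"] by blast
  have "A = R \<union> L" "R \<inter> L = {}" by (auto simp: R_def L_def)
  then have "card A = card R + card L" using fin by (simp add: card_Un_disjoint)
  also have "\<dots> \<le> card R + card U" using LU by simp
  also have "\<dots> = card A'" unfolding A' using fin inc by (simp add: card_Un_disjoint)
  finally show "card A \<le> card A'" .
  show "sperner A'" unfolding sperner_def
  proof (intro ballI impI)
    fix G H assume GH: "G \<in> A'" "H \<in> A'" "G \<subseteq> H"
    consider "G \<in> R" "H \<in> R" | "G \<in> U" "H \<in> U" | "G \<in> R" "H \<in> U" | "G \<in> U" "H \<in> R"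
      using GH A' by blast
    then show "G = H"
    proof cases
      case 1
      then show ?thesis using A(2) GH(3) unfolding sperner_def R_def by blast
    next
      case 2
      then show ?thesis using GH(3) finF by (intro card_subset_eq) (auto simp: U_def)
    next
      case 3
      then have "Suc k \<le> card G" using k(2)[of G] by (auto simp: R_def)
      then show ?thesis using 3 GH(3) finF card_mono[of H G] by (intro card_subset_eq) (auto simp: U_def)
    next
      case 4
      then obtain F where "F \<in> A" "card F = k" "F \<subseteq> G" by (auto simp: U_def)
      moreover have "H \<in> A" "card H \<noteq> k" using 4 by (auto simp: R_def)
      ultimately show ?thesis using A(2) GH(3) unfolding sperner_def by (metis order.trans)
    qed
  qed
qed

text \<open>Here \<open>n\<close> bounds the number of occupied levels below \<open>r\<close>, and
  each raising removes the lowest. That new faces contain old ones is recorded because it preserves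
  cross-intersection.\<close>

lemma sperner_uniform:
  assumes sc: "simplicial_complex \<Gamma>" and pure: "\<And>F. F \<in> \<Gamma> \<Longrightarrow> \<exists>G\<in>\<Gamma>. F \<subseteq> G \<and> card G = D"
    and r: "2 * r \<le> D"
  shows "A \<subseteq> \<Gamma> \<Longrightarrow> sperner A \<Longrightarrow> (\<And>F. F \<in> A \<Longrightarrow> r - n \<le> card F \<and> card F \<le> r) \<Longrightarrow>
    \<exists>A'\<subseteq>faces \<Gamma> r. card A \<le> card A' \<and> (\<forall>G\<in>A'. \<exists>F\<in>A. F \<subseteq> G)"
proof (induction n arbitrary: A)
  case 0
  have "card F = r" if "F \<in> A" for F using 0(3)[OF that] by simp
  then have "A \<subseteq> faces \<Gamma> r" using 0(1) by (auto simp: faces_def)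
  then show ?case by blast
next
  case (Suc n)
  show ?case
  proof (cases "r \<le> n")
    case True
    then show ?thesis using Suc by simp
  next
    case False
    define k where "k = r - Suc n"
    have k: "Suc k = r - n" "k < r" using False by (auto simp: k_def)
    define A' where "A' = {F \<in> A. card F \<noteq> k} \<union> {G \<in> \<Gamma>. card G = Suc k \<and> (\<exists>F\<in>A. card F = k \<and> F \<subseteq> G)}"
    have kD: "2 * k + 1 \<le> D" using k r by linarith
    have kA: "k \<le> card F" if "F \<in> A" for F using Suc.prems(3)[OF that] by (simp add: k_def)
    have raise: "card A \<le> card A'" "sperner A'"
      unfolding A'_def
      using sperner_raise_level[OF sc pure Suc.prems(1,2) kD kA] by blast+
    have "A' \<subseteq> \<Gamma>" using Suc.prems(1) by (auto simp: A'_def)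
    moreover have "r - n \<le> card F \<and> card F \<le> r" if "F \<in> A'" for F
      using that Suc.prems(3)[of F] kA[of F] k by (auto simp: A'_def)
    ultimately obtain A'' where A'': "A'' \<subseteq> faces \<Gamma> r" "card A' \<le> card A''" "\<forall>G\<in>A''. \<exists>F\<in>A'. F \<subseteq> G"
      using Suc.IH[of A'] raise(2) by blast
    have "\<exists>F\<in>A. F \<subseteq> G" if "G \<in> A'" for G using that by (auto simp: A'_def)
    then have "\<forall>G\<in>A''. \<exists>F\<in>A. F \<subseteq> G" using A''(3) by (meson order.trans)
    moreover have "card A \<le> card A''" using A''(2) raise(1) by linarith
    ultimately show ?thesis using A''(1) by blast
  qed
qed

text \<open>The next apex replaces a vertex outside \<open>S\<close> and the earlier apexes. Such a
  vertex exists because these number fewer than \<open>2 * r \<le> D\<close>.\<close>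

lemma shifted_contains_apexes:
  assumes sc: "simplicial_complex \<Delta>" and sh: "shifted_wrt \<Delta> v r"
    and S: "S \<subseteq> G" "G \<in> \<Delta>" "card G = D" "2 * r \<le> D" "card S \<le> r"
  shows "i \<le> r \<Longrightarrow> \<exists>H\<in>\<Delta>. S \<union> v ` {1..i} \<subseteq> H \<and> card H = D"
proof (induction i)
  case 0
  then show ?case using S by auto
next
  case (Suc i)
  then obtain H where H: "H \<in> \<Delta>" "S \<union> v ` {1..i} \<subseteq> H" "card H = D" by auto
  have finH: "finite H" using simplicial_complex_finite_face[OF sc H(1)] .
  have range: "v ` {1..Suc i} = insert (v (Suc i)) (v ` {1..i})" by (simp add: atLeastAtMostSuc_conv)
  show ?case
  proof (cases "v (Suc i) \<in> H")
    case True
    then show ?thesis using H unfolding range by blast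
  next
    case False
    have "finite S" using H(2) finH finite_subset by blast
    then have "card (S \<union> v ` {1..i}) \<le> card S + card (v ` {1..i})" by (intro card_Un_le)
    also have "\<dots> \<le> r + i" using S(5) card_image_le[of "{1..i}" v] by simp
    also have "\<dots> < card H" using H(3) S(4) Suc.prems by simp
    finally have "S \<union> v ` {1..i} \<noteq> H" by auto
    then obtain w where w: "w \<in> H" "w \<notin> S \<union> v ` {1..i}" using H(2) by blast
    have "w \<notin> v ` {1..Suc i}" using w False unfolding range by auto
    then have "insert (v (Suc i)) (H - {w}) \<in> \<Delta>"
      using sh H(1) w(1) False Suc.prems unfolding shifted_wrt_def by auto
    moreover have "S \<union> v ` {1..Suc i} \<subseteq> insert (v (Suc i)) (H - {w})" using H(2) w(2) unfolding range by auto
    moreover have "card (insert (v (Suc i)) (H - {w})) = D"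
      using False w(1) finH H(3) by (metis DiffD1 card_Suc_Diff1 card_insert_disjoint finite_Diff)
    ultimately show ?thesis by blast
  qed
qed

theorem theorem2p19:
  fixes \<Delta> \<A> \<B> :: "'a::linorder set set" and v :: "nat \<Rightarrow> 'a" and d :: int and r :: nat
  assumes "simplicial_complex \<Delta>"
    and "depth TYPE('k::field) \<Delta> = d - 1"
    and "2 \<le> r" and "2 * int r \<le> d"
    and "\<A> \<noteq> {}" and "\<B> \<noteq> {}"
    and "sperner \<A>" and "sperner \<B>" and "cross_intersecting \<A> \<B>"
    and "\<A> \<subseteq> \<Delta>" and "\<B> \<subseteq> \<Delta>"
    and "\<forall>A\<in>\<A>. card A \<le> r" and "\<forall>B\<in>\<B>. card B \<le> r"
    and "shifted_wrt \<Delta> v r"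
  shows "int (card \<A>) + int (card \<B>)
           \<le> int (fvec \<Delta> r) - int (card {F \<in> \<Delta>. card F = r \<and> F \<inter> v ` {1..r} = {}}) + 1"
proof -
  note sc = assms(1)
  define D where "D = nat d"
  define \<Gamma> where "\<Gamma> = skeleton \<Delta> (d - 1)"
  define W where "W = v ` {1..r}"
  have dD: "d = int D" "2 * r \<le> D" using assms(3,4) by (auto simp: D_def)
  have \<Gamma>: "F \<in> \<Gamma> \<longleftrightarrow> F \<in> \<Delta> \<and> card F \<le> D" for F by (auto simp: \<Gamma>_def skeleton_def dD)
  have cm: "cohen_macaulay TYPE('k) \<Gamma>" and dim: "int D - 1 \<le> cdim \<Delta>"
    using depth_properties[OF sc, where 'k = 'k] assms(2) dD by (simp_all add: \<Gamma>_def)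
  have sc\<Gamma>: "simplicial_complex \<Gamma>"
    unfolding simplicial_complex_def
  proof (intro conjI ballI allI impI)
    show "\<Gamma> \<noteq> {}" using simplicial_complex_empty[OF sc] \<Gamma> by fastforce
    show "finite \<Gamma>" using simplicial_complex_finite[OF sc] by (rule rev_finite_subset) (auto simp: \<Gamma>)
    show "G \<in> \<Gamma>" if "F \<in> \<Gamma>" "G \<subseteq> F" for F G
      using that simplicial_complex_subset[OF sc] simplicial_complex_finite_face[OF sc]
      unfolding \<Gamma> by (meson card_mono order.trans)
  qed
  have finF: "finite F" if "F \<in> \<Gamma>" for F using simplicial_complex_finite_face[OF sc\<Gamma> that] .
  have Max: "Max (card ` \<Gamma>) = D"
  proof (rule Max_eqI)
    show "finite (card ` \<Gamma>)" using simplicial_complex_finite[OF sc\<Gamma>] by simp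
    show "y \<le> D" if "y \<in> card ` \<Gamma>" for y using that \<Gamma> by auto
    have "Max (card ` \<Delta>) \<in> card ` \<Delta>"
      using simplicial_complex_finite[OF sc] simplicial_complex_empty[OF sc] by (intro Max_in) auto
    then obtain F where F: "F \<in> \<Delta>" "card F = Max (card ` \<Delta>)" by auto
    then have "D \<le> card F" using dim by (simp add: cdim_def)
    then obtain G where G: "G \<subseteq> F" "card G = D" by (meson obtain_subset_with_card_n)
    then have "G \<in> \<Gamma>" using F simplicial_complex_subset[OF sc] by (auto simp: \<Gamma>)
    then show "D \<in> card ` \<Gamma>" using G by auto
  qed
  have pure: "\<exists>G\<in>\<Gamma>. F \<subseteq> G \<and> card G = D" if "F \<in> \<Gamma>" for F
    using cohen_macaulay_pure[OF sc\<Gamma> cm that] Max by simp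
  have deep: "deep TYPE('k alg_closure) (\<Union>\<Gamma>) D \<Gamma>" using cohen_macaulay_deep[OF sc\<Gamma> cm] Max by simp
  have finV: "finite (\<Union>\<Gamma>)" using simplicial_complex_finite[OF sc\<Gamma>] finF by blast
  \<comment> \<open>Purity puts \<open>S\<close> in a face of size \<open>D\<close>, and the
    exchanges keep this size, so the face obtained around \<open>W\<close> stays in the
    skeleton.\<close>
  have apex: "W \<union> S \<in> \<Gamma>" if S: "S \<in> \<Gamma>" "card S \<le> r" for S
  proof -
    obtain G where G: "G \<in> \<Gamma>" "S \<subseteq> G" "card G = D" using pure[OF S(1)] by blast
    obtain H where H: "H \<in> \<Delta>" "S \<union> W \<subseteq> H" "card H = D"
      using shifted_contains_apexes[OF sc assms(14) G(2) _ G(3) dD(2) S(2), of r] G(1) by (auto simp: \<Gamma> W_def)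
    then have "H \<in> \<Gamma>" by (simp add: \<Gamma>)
    then show ?thesis using simplicial_complex_subset[OF sc\<Gamma>, of H "W \<union> S"] H by blast
  qed
  have WV: "W \<subseteq> \<Union>\<Gamma>" using apex[OF simplicial_complex_empty[OF sc\<Gamma>]] by auto
  have cardW: "card W = r" using assms(14) by (simp add: W_def shifted_wrt_def card_image)
  have cardV: "2 * r \<le> card (\<Union>\<Gamma>)"
  proof -
    obtain G where "G \<in> \<Gamma>" "card G = D" using pure[OF simplicial_complex_empty[OF sc\<Gamma>]] by blast
    then show ?thesis using card_mono[OF finV, of G] dD(2) by (simp add: Union_upper)
  qed
  have sub: "\<A> \<subseteq> \<Gamma>" "\<B> \<subseteq> \<Gamma>" using assms(10-13) dD(2) by (force simp: \<Gamma>)+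
  obtain A where A: "A \<subseteq> faces \<Gamma> r" "card \<A> \<le> card A" "\<forall>G\<in>A. \<exists>F\<in>\<A>. F \<subseteq> G"
    using sperner_uniform[OF sc\<Gamma> pure dD(2) sub(1) assms(7), of r] assms(12) by auto
  obtain B where B: "B \<subseteq> faces \<Gamma> r" "card \<B> \<le> card B" "\<forall>G\<in>B. \<exists>F\<in>\<B>. F \<subseteq> G"
    using sperner_uniform[OF sc\<Gamma> pure dD(2) sub(2) assms(8), of r] assms(13) by auto
  have "finite \<A>" "finite \<B>" using sub simplicial_complex_finite[OF sc\<Gamma>] finite_subset by blast+
  then have ne: "A \<noteq> {}" "B \<noteq> {}" using A(2) B(2) assms(5,6) by (auto simp: card_gt_0_iff)
  have cross: "cross_intersecting A B"
    unfolding cross_intersecting_def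
  proof (intro ballI)
    fix F G assume "F \<in> A" "G \<in> B"
    then obtain F' G' where FG: "F' \<in> \<A>" "F' \<subseteq> F" "G' \<in> \<B>" "G' \<subseteq> G" using A(3) B(3) by blast
    then have "F' \<inter> G' \<noteq> {}" using assms(9) unfolding cross_intersecting_def by blast
    then show "F \<inter> G \<noteq> {}" using FG by blast
  qed
  \<comment> \<open>Every face counted by \<gamma> can be completed by \<open>W\<close>; this is how
    shiftedness enters the count of leading sets that avoid the prefix.\<close>
  have "{F \<in> \<Delta>. card F = r \<and> F \<inter> W = {}} \<subseteq> {S. card S = r \<and> S \<inter> W = {} \<and> W \<union> S \<in> \<Gamma>}"
    using apex dD(2) by (auto simp: \<Gamma>)
  moreover have "finite {S. card S = r \<and> S \<inter> W = {} \<and> W \<union> S \<in> \<Gamma>}"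
    by (rule finite_subset[of _ "Pow (\<Union>\<Gamma>)"]) (use finV in auto)
  ultimately have "card {F \<in> \<Delta>. card F = r \<and> F \<inter> W = {}} \<le> card {S. card S = r \<and> S \<inter> W = {} \<and> W \<union> S \<in> \<Gamma>}"
    by (rule card_mono[rotated])
  moreover have "card A + card B + card {S. card S = r \<and> S \<inter> W = {} \<and> W \<union> S \<in> \<Gamma>} \<le> card (faces \<Gamma> r) + 1"
    by (rule uniform_cross_intersecting_bound[OF finV deep dD(2) cardV A(1) B(1) ne cross WV cardW])
  moreover have "faces \<Gamma> r = {F \<in> \<Delta>. card F = r}" using dD(2) by (auto simp: faces_def \<Gamma>)
  then have "card (faces \<Gamma> r) = fvec \<Delta> r" by (simp add: fvec_def)
  ultimately have "card \<A> + card \<B> + card {F \<in> \<Delta>. card F = r \<and> F \<inter> v ` {1..r} = {}} \<le> fvec \<Delta> r + 1"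
    using A(2) B(2) unfolding W_def by linarith
  then show ?thesis by linarith
qed

end
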